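(* Let $N\ge 2$ be an integer and let $\mathcal{B}$ be an additive category. Let $\mathcal{S}_N(\mathcal{B})$ be the collection of sequences $0\to X\xrightarrow{f}Y\xrightarrow{g}Z\to 0$ of morphisms in $\mathsf{C}_N(\mathcal{B})$ such that $0\to X^i\xrightarrow{f^i}Y^i\xrightarrow{g^i}Z^i\to 0$ is split exact in $\mathcal{B}$ for every integer $i$. Then: (1) The category $\mathsf{C}_N(\mathcal{B})$ of $N$-complexes, with the exact structure $\mathcal{S}_N(\mathcal{B})$, is a Frobenius category. (2) The stable category of the Frobenius category $(\mathsf{C}_N(\mathcal{B}),\mathcal{S}_N(\mathcal{B}))$ is the homotopy category $\mathsf{K}_N(\mathcal{B})$. In particular $\mathsf{K}_N(\mathcal{B})$ has a structure of an (algebraic) triangulated category.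
   Context: An $N$-complex $X=(X^i,d_X^i)_{i\in\mathbb{Z}}$ in $\mathcal{B}$ consists of objects $X^i$ and morphisms $d_X^i:X^i\to X^{i+1}$ of $\mathcal{B}$ with $d_X^{i+N-1}\cdots d_X^{i+1}d_X^i=0$ for all $i$. A morphism $f:X\to Y$ is a family $f^i:X^i\to Y^i$ with $f^{i+1}d_X^i=d_Y^if^i$. This gives the category $\mathsf{C}_N(\mathcal{B})$. A morphism $f:X\to Y$ is null-homotopic if there are $s^i\in\operatorname{Hom}_{\mathcal{B}}(X^i,Y^{i-N+1})$ ($i\in\mathbb{Z}$) with $f^i=\sum_{j=1}^{N}d_Y^{i-1}\cdots d_Y^{i-N+j}\,s^{i+j-1}\,d_X^{i+j-2}\cdots d_X^i$ for all $i$ (there are $N-j$ factors $d_Y$ and $j-1$ factors $d_X$; empty products are identities). The homotopy category $\mathsf{K}_N(\mathcal{B})$ has the same objects as $\mathsf{C}_N(\mathcal{B})$, and its morphisms are those of $\mathsf{C}_N(\mathcal{B})$ modulo null-homotopic morphisms. A Frobenius category is an exact category (in the sense of Quillen) with enough projectives and enough injectives in which projectives and injectives coincide. Its stable category has the same objects, and morphisms are taken modulo those factoring through a projective-injective object; by Happel it is triangulated, and such triangulated categories are called algebraic. *)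

theory Defs
  imports "HOL-Algebra.Coset" "HOL-Algebra.FiniteProduct"
begin

section \<open>Additive categories\<close>

text \<open>
  Hom-sets are not required to be disjoint, so composition is indexed by objects:
  Comp C X Y Z g f is the composite of f : X \<rightarrow> Y and g : Y \<rightarrow> Z.
  A hom-set is the carrier of a HOL-Algebra commutative group. HOL-Algebra writes such groups
  multiplicatively: the sum of two morphisms is their \<otimes>, the zero morphism is \<one>, the negative
  of a morphism is its inv, and a finite sum is a finprod.
\<close>

record ('o, 'm) precat =
  Obj :: "'o set"
  Hom :: "'o \<Rightarrow> 'o \<Rightarrow> 'm monoid"
  Ident :: "'o \<Rightarrow> 'm"
  Comp :: "'o \<Rightarrow> 'o \<Rightarrow> 'o \<Rightarrow> 'm \<Rightarrow> 'm \<Rightarrow> 'm"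

abbreviation mor :: "('o, 'm) precat \<Rightarrow> 'o \<Rightarrow> 'o \<Rightarrow> 'm set" where
  "mor C X Y \<equiv> carrier (Hom C X Y)"

abbreviation zero_mor :: "('o, 'm) precat \<Rightarrow> 'o \<Rightarrow> 'o \<Rightarrow> 'm" where
  "zero_mor C X Y \<equiv> \<one>\<^bsub>Hom C X Y\<^esub>"

locale category =
  fixes C :: "('o, 'm) precat"
  assumes Ident_in: "X \<in> Obj C \<Longrightarrow> Ident C X \<in> mor C X X"
    and Comp_in: "\<lbrakk>X \<in> Obj C; Y \<in> Obj C; Z \<in> Obj C; f \<in> mor C X Y; g \<in> mor C Y Z\<rbrakk>
      \<Longrightarrow> Comp C X Y Z g f \<in> mor C X Z"
    and Comp_assoc: "\<lbrakk>W \<in> Obj C; X \<in> Obj C; Y \<in> Obj C; Z \<in> Obj C;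
        f \<in> mor C W X; g \<in> mor C X Y; h \<in> mor C Y Z\<rbrakk>
      \<Longrightarrow> Comp C W X Z (Comp C X Y Z h g) f = Comp C W Y Z h (Comp C W X Y g f)"
    and Ident_left: "\<lbrakk>X \<in> Obj C; Y \<in> Obj C; f \<in> mor C X Y\<rbrakk>
      \<Longrightarrow> Comp C X Y Y (Ident C Y) f = f"
    and Ident_right: "\<lbrakk>X \<in> Obj C; Y \<in> Obj C; f \<in> mor C X Y\<rbrakk>
      \<Longrightarrow> Comp C X X Y f (Ident C X) = f"

locale preadditive_category = category C for C :: "('o, 'm) precat" +
  assumes Hom_group: "\<lbrakk>X \<in> Obj C; Y \<in> Obj C\<rbrakk> \<Longrightarrow> comm_group (Hom C X Y)"
    and Comp_add_left: "\<lbrakk>X \<in> Obj C; Y \<in> Obj C; Z \<in> Obj C;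
        f \<in> mor C X Y; g \<in> mor C Y Z; g' \<in> mor C Y Z\<rbrakk>
      \<Longrightarrow> Comp C X Y Z (g \<otimes>\<^bsub>Hom C Y Z\<^esub> g') f
          = Comp C X Y Z g f \<otimes>\<^bsub>Hom C X Z\<^esub> Comp C X Y Z g' f"
    and Comp_add_right: "\<lbrakk>X \<in> Obj C; Y \<in> Obj C; Z \<in> Obj C;
        f \<in> mor C X Y; f' \<in> mor C X Y; g \<in> mor C Y Z\<rbrakk>
      \<Longrightarrow> Comp C X Y Z g (f \<otimes>\<^bsub>Hom C X Y\<^esub> f')
          = Comp C X Y Z g f \<otimes>\<^bsub>Hom C X Z\<^esub> Comp C X Y Z g f'"

definition is_zero_object :: "('o, 'm) precat \<Rightarrow> 'o \<Rightarrow> bool" where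
  "is_zero_object C Z \<longleftrightarrow> Z \<in> Obj C \<and>
     (\<forall>X\<in>Obj C. (\<exists>!f. f \<in> mor C X Z) \<and> (\<exists>!f. f \<in> mor C Z X))"

definition is_biproduct ::
    "('o, 'm) precat \<Rightarrow> 'o \<Rightarrow> 'o \<Rightarrow> 'o \<Rightarrow> 'm \<Rightarrow> 'm \<Rightarrow> 'm \<Rightarrow> 'm \<Rightarrow> bool" where
  "is_biproduct C A B P i1 i2 p1 p2 \<longleftrightarrow>
     A \<in> Obj C \<and> B \<in> Obj C \<and> P \<in> Obj C \<and>
     i1 \<in> mor C A P \<and> i2 \<in> mor C B P \<and> p1 \<in> mor C P A \<and> p2 \<in> mor C P B \<and>
     Comp C A P A p1 i1 = Ident C A \<and>
     Comp C B P B p2 i2 = Ident C B \<and>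
     Comp C B P A p1 i2 = zero_mor C B A \<and>
     Comp C A P B p2 i1 = zero_mor C A B \<and>
     Comp C P A P i1 p1 \<otimes>\<^bsub>Hom C P P\<^esub> Comp C P B P i2 p2 = Ident C P"

locale additive_category = preadditive_category C for C :: "('o, 'm) precat" +
  assumes zero_object: "\<exists>Z. is_zero_object C Z"
    and biproducts: "\<lbrakk>A \<in> Obj C; B \<in> Obj C\<rbrakk>
      \<Longrightarrow> \<exists>P i1 i2 p1 p2. is_biproduct C A B P i1 i2 p1 p2"

definition is_iso :: "('o, 'm) precat \<Rightarrow> 'o \<Rightarrow> 'o \<Rightarrow> 'm \<Rightarrow> bool" where
  "is_iso C X Y f \<longleftrightarrow> f \<in> mor C X Y \<and>
     (\<exists>g\<in>mor C Y X. Comp C X Y X g f = Ident C X \<and> Comp C Y X Y f g = Ident C Y)"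

text \<open>
  Equality of categories. It ignores the values of Hom, Ident and Comp on arguments that are not
  objects or not morphisms.
\<close>

definition same_category :: "('o, 'm) precat \<Rightarrow> ('o, 'm) precat \<Rightarrow> bool" where
  "same_category C D \<longleftrightarrow> Obj C = Obj D \<and>
     (\<forall>X\<in>Obj C. Ident C X = Ident D X) \<and>
     (\<forall>X\<in>Obj C. \<forall>Y\<in>Obj C. mor C X Y = mor D X Y \<and> zero_mor C X Y = zero_mor D X Y \<and>
        (\<forall>f\<in>mor C X Y. \<forall>g\<in>mor C X Y. f \<otimes>\<^bsub>Hom C X Y\<^esub> g = f \<otimes>\<^bsub>Hom D X Y\<^esub> g)) \<and>
     (\<forall>X\<in>Obj C. \<forall>Y\<in>Obj C. \<forall>Z\<in>Obj C. \<forall>f\<in>mor C X Y. \<forall>g\<in>mor C Y Z.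
        Comp C X Y Z g f = Comp D X Y Z g f)"


section \<open>Exact categories and Frobenius categories\<close>

text \<open>The sequence 0 \<rightarrow> X \<rightarrow> Y \<rightarrow> Z \<rightarrow> 0 with maps f and g is the tuple (X, f, Y, g, Z).\<close>

type_synonym ('o, 'm) ses = "'o \<times> 'm \<times> 'o \<times> 'm \<times> 'o"

definition is_kernel :: "('o, 'm) precat \<Rightarrow> 'o \<Rightarrow> 'o \<Rightarrow> 'o \<Rightarrow> 'm \<Rightarrow> 'm \<Rightarrow> bool" where
  "is_kernel C X Y Z f g \<longleftrightarrow> f \<in> mor C X Y \<and> g \<in> mor C Y Z \<and>
     Comp C X Y Z g f = zero_mor C X Z \<and>
     (\<forall>W\<in>Obj C. \<forall>h\<in>mor C W Y. Comp C W Y Z g h = zero_mor C W Z \<longrightarrow>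
        (\<exists>!k. k \<in> mor C W X \<and> Comp C W X Y f k = h))"

definition is_cokernel :: "('o, 'm) precat \<Rightarrow> 'o \<Rightarrow> 'o \<Rightarrow> 'o \<Rightarrow> 'm \<Rightarrow> 'm \<Rightarrow> bool" where
  "is_cokernel C X Y Z f g \<longleftrightarrow> f \<in> mor C X Y \<and> g \<in> mor C Y Z \<and>
     Comp C X Y Z g f = zero_mor C X Z \<and>
     (\<forall>W\<in>Obj C. \<forall>h\<in>mor C Y W. Comp C X Y W h f = zero_mor C X W \<longrightarrow>
        (\<exists>!k. k \<in> mor C Z W \<and> Comp C Y Z W k g = h))"

definition kernel_cokernel_pair :: "('o, 'm) precat \<Rightarrow> ('o, 'm) ses \<Rightarrow> bool" where
  "kernel_cokernel_pair C = (\<lambda>(X, f, Y, g, Z).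
     X \<in> Obj C \<and> Y \<in> Obj C \<and> Z \<in> Obj C \<and> is_kernel C X Y Z f g \<and> is_cokernel C X Y Z f g)"

definition ses_iso :: "('o, 'm) precat \<Rightarrow> ('o, 'm) ses \<Rightarrow> ('o, 'm) ses \<Rightarrow> bool" where
  "ses_iso C = (\<lambda>(X, f, Y, g, Z) (X', f', Y', g', Z').
     \<exists>a b c. is_iso C X X' a \<and> is_iso C Y Y' b \<and> is_iso C Z Z' c \<and>
       Comp C X Y Y' b f = Comp C X X' Y' f' a \<and>
       Comp C Y Z Z' c g = Comp C Y Y' Z' g' b)"

text \<open>
  is_pushout C X A Y P f a a' f': the square with f : X \<rightarrow> A, a : X \<rightarrow> Y, a' : A \<rightarrow> P,
  f' : Y \<rightarrow> P is a pushout of f and a. Dually, is_pullback C X A Y P f a a' f' concerns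
  f : A \<rightarrow> X, a : Y \<rightarrow> X, a' : P \<rightarrow> A, f' : P \<rightarrow> Y. In both, f' is parallel to f.
\<close>

definition is_pushout ::
    "('o, 'm) precat \<Rightarrow> 'o \<Rightarrow> 'o \<Rightarrow> 'o \<Rightarrow> 'o \<Rightarrow> 'm \<Rightarrow> 'm \<Rightarrow> 'm \<Rightarrow> 'm \<Rightarrow> bool" where
  "is_pushout C X A Y P f a a' f' \<longleftrightarrow>
     X \<in> Obj C \<and> A \<in> Obj C \<and> Y \<in> Obj C \<and> P \<in> Obj C \<and>
     f \<in> mor C X A \<and> a \<in> mor C X Y \<and> a' \<in> mor C A P \<and> f' \<in> mor C Y P \<and>
     Comp C X A P a' f = Comp C X Y P f' a \<and>
     (\<forall>W\<in>Obj C. \<forall>s\<in>mor C A W. \<forall>t\<in>mor C Y W. Comp C X A W s f = Comp C X Y W t a \<longrightarrow>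
        (\<exists>!k. k \<in> mor C P W \<and> Comp C A P W k a' = s \<and> Comp C Y P W k f' = t))"

definition is_pullback ::
    "('o, 'm) precat \<Rightarrow> 'o \<Rightarrow> 'o \<Rightarrow> 'o \<Rightarrow> 'o \<Rightarrow> 'm \<Rightarrow> 'm \<Rightarrow> 'm \<Rightarrow> 'm \<Rightarrow> bool" where
  "is_pullback C X A Y P f a a' f' \<longleftrightarrow>
     X \<in> Obj C \<and> A \<in> Obj C \<and> Y \<in> Obj C \<and> P \<in> Obj C \<and>
     f \<in> mor C A X \<and> a \<in> mor C Y X \<and> a' \<in> mor C P A \<and> f' \<in> mor C P Y \<and>
     Comp C P A X f a' = Comp C P Y X a f' \<and>
     (\<forall>W\<in>Obj C. \<forall>s\<in>mor C W A. \<forall>t\<in>mor C W Y. Comp C W A X f s = Comp C W Y X a t \<longrightarrow>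
        (\<exists>!k. k \<in> mor C W P \<and> Comp C W P A a' k = s \<and> Comp C W P Y f' k = t))"

definition admissible_mono :: "('o, 'm) ses set \<Rightarrow> 'o \<Rightarrow> 'o \<Rightarrow> 'm \<Rightarrow> bool" where
  "admissible_mono S X Y f \<longleftrightarrow> (\<exists>Z g. (X, f, Y, g, Z) \<in> S)"

definition admissible_epi :: "('o, 'm) ses set \<Rightarrow> 'o \<Rightarrow> 'o \<Rightarrow> 'm \<Rightarrow> bool" where
  "admissible_epi S Y Z g \<longleftrightarrow> (\<exists>X f. (X, f, Y, g, Z) \<in> S)"

text \<open>
  Quillen's axioms in the self-dual form used by Buehler ("Exact categories", Definition 2.1);
  Quillen's remaining axiom is redundant, as shown by Keller.
\<close>

locale exact_category = additive_category C for C :: "('o, 'm) precat" +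
  fixes S :: "('o, 'm) ses set"
  assumes conflation: "E \<in> S \<Longrightarrow> kernel_cokernel_pair C E"
    and iso_closed: "\<lbrakk>E \<in> S; kernel_cokernel_pair C E'; ses_iso C E E'\<rbrakk> \<Longrightarrow> E' \<in> S"
    and Ident_mono: "X \<in> Obj C \<Longrightarrow> admissible_mono S X X (Ident C X)"
    and Ident_epi: "X \<in> Obj C \<Longrightarrow> admissible_epi S X X (Ident C X)"
    and Comp_mono: "\<lbrakk>admissible_mono S X Y f; admissible_mono S Y Z g\<rbrakk>
      \<Longrightarrow> admissible_mono S X Z (Comp C X Y Z g f)"
    and Comp_epi: "\<lbrakk>admissible_epi S X Y f; admissible_epi S Y Z g\<rbrakk>
      \<Longrightarrow> admissible_epi S X Z (Comp C X Y Z g f)"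
    and pushout_mono: "\<lbrakk>admissible_mono S X A f; Y \<in> Obj C; a \<in> mor C X Y\<rbrakk>
      \<Longrightarrow> \<exists>P a' f'. is_pushout C X A Y P f a a' f' \<and> admissible_mono S Y P f'"
    and pullback_epi: "\<lbrakk>admissible_epi S A X f; Y \<in> Obj C; a \<in> mor C Y X\<rbrakk>
      \<Longrightarrow> \<exists>P a' f'. is_pullback C X A Y P f a a' f' \<and> admissible_epi S P Y f'"

definition projective :: "('o, 'm) precat \<Rightarrow> ('o, 'm) ses set \<Rightarrow> 'o \<Rightarrow> bool" where
  "projective C S P \<longleftrightarrow> P \<in> Obj C \<and>
     (\<forall>Y Z g. admissible_epi S Y Z g \<longrightarrow>
        (\<forall>h\<in>mor C P Z. \<exists>k\<in>mor C P Y. Comp C P Y Z g k = h))"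

definition injective :: "('o, 'm) precat \<Rightarrow> ('o, 'm) ses set \<Rightarrow> 'o \<Rightarrow> bool" where
  "injective C S I \<longleftrightarrow> I \<in> Obj C \<and>
     (\<forall>X Y f. admissible_mono S X Y f \<longrightarrow>
        (\<forall>h\<in>mor C X I. \<exists>k\<in>mor C Y I. Comp C X Y I k f = h))"

locale frobenius_category = exact_category C S for C :: "('o, 'm) precat" and S +
  assumes enough_projectives: "X \<in> Obj C \<Longrightarrow> \<exists>P g. projective C S P \<and> admissible_epi S P X g"
    and enough_injectives: "X \<in> Obj C \<Longrightarrow> \<exists>I f. injective C S I \<and> admissible_mono S X I f"
    and projective_iff_injective: "projective C S P \<longleftrightarrow> injective C S P"


section \<open>Quotients by ideals and the stable category\<close>

definition mor_class :: "('o, 'm) precat \<Rightarrow> ('o \<Rightarrow> 'o \<Rightarrow> 'm set) \<Rightarrow> 'o \<Rightarrow> 'o \<Rightarrow> 'm \<Rightarrow> 'm set" where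
  "mor_class C J X Y f = J X Y #>\<^bsub>Hom C X Y\<^esub> f"

text \<open>
  The category with the morphisms of C modulo the ideal J. When J is an ideal, the union that
  defines the composite of two cosets G and F is a union of equal cosets.
\<close>

definition quotient_category :: "('o, 'm) precat \<Rightarrow> ('o \<Rightarrow> 'o \<Rightarrow> 'm set) \<Rightarrow> ('o, 'm set) precat" where
  "quotient_category C J =
     \<lparr>Obj = Obj C,
      Hom = (\<lambda>X Y. Hom C X Y Mod J X Y),
      Ident = (\<lambda>X. mor_class C J X X (Ident C X)),
      Comp = (\<lambda>X Y Z G F. \<Union>g\<in>G. \<Union>f\<in>F. mor_class C J X Z (Comp C X Y Z g f))\<rparr>"

definition stable_ideal :: "('o, 'm) precat \<Rightarrow> ('o, 'm) ses set \<Rightarrow> 'o \<Rightarrow> 'o \<Rightarrow> 'm set" where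
  "stable_ideal C S X Y =
     {f \<in> mor C X Y. \<exists>P a b. projective C S P \<and> injective C S P \<and>
        a \<in> mor C X P \<and> b \<in> mor C P Y \<and> f = Comp C X P Y b a}"

definition stable_category :: "('o, 'm) precat \<Rightarrow> ('o, 'm) ses set \<Rightarrow> ('o, 'm set) precat" where
  "stable_category C S = quotient_category C (stable_ideal C S)"


section \<open>Functors\<close>

record ('o, 'm, 'p, 'n) fctr =
  FObj :: "'o \<Rightarrow> 'p"
  FMor :: "'o \<Rightarrow> 'o \<Rightarrow> 'm \<Rightarrow> 'n"

definition is_functor :: "('o, 'm) precat \<Rightarrow> ('p, 'n) precat \<Rightarrow> ('o, 'm, 'p, 'n) fctr \<Rightarrow> bool" where
  "is_functor C D F \<longleftrightarrow>
     (\<forall>X\<in>Obj C. FObj F X \<in> Obj D) \<and>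
     (\<forall>X\<in>Obj C. \<forall>Y\<in>Obj C. \<forall>f\<in>mor C X Y. FMor F X Y f \<in> mor D (FObj F X) (FObj F Y)) \<and>
     (\<forall>X\<in>Obj C. FMor F X X (Ident C X) = Ident D (FObj F X)) \<and>
     (\<forall>X\<in>Obj C. \<forall>Y\<in>Obj C. \<forall>Z\<in>Obj C. \<forall>f\<in>mor C X Y. \<forall>g\<in>mor C Y Z.
        FMor F X Z (Comp C X Y Z g f)
        = Comp D (FObj F X) (FObj F Y) (FObj F Z) (FMor F Y Z g) (FMor F X Y f))"

definition additive_functor ::
    "('o, 'm) precat \<Rightarrow> ('p, 'n) precat \<Rightarrow> ('o, 'm, 'p, 'n) fctr \<Rightarrow> bool" where
  "additive_functor C D F \<longleftrightarrow> is_functor C D F \<and>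
     (\<forall>X\<in>Obj C. \<forall>Y\<in>Obj C. FMor F X Y \<in> hom (Hom C X Y) (Hom D (FObj F X) (FObj F Y)))"

definition id_fctr :: "('o, 'm, 'o, 'm) fctr" where
  "id_fctr = \<lparr>FObj = (\<lambda>X. X), FMor = (\<lambda>X Y f. f)\<rparr>"

definition comp_fctr ::
    "('p, 'n, 'q, 'k) fctr \<Rightarrow> ('o, 'm, 'p, 'n) fctr \<Rightarrow> ('o, 'm, 'q, 'k) fctr" where
  "comp_fctr G F = \<lparr>FObj = (\<lambda>X. FObj G (FObj F X)),
                    FMor = (\<lambda>X Y f. FMor G (FObj F X) (FObj F Y) (FMor F X Y f))\<rparr>"

definition naturally_isomorphic ::
    "('o, 'm) precat \<Rightarrow> ('p, 'n) precat \<Rightarrow> ('o, 'm, 'p, 'n) fctr \<Rightarrow> ('o, 'm, 'p, 'n) fctr \<Rightarrow> bool"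
  where
  "naturally_isomorphic C D F G \<longleftrightarrow>
     (\<exists>\<eta>. (\<forall>X\<in>Obj C. is_iso D (FObj F X) (FObj G X) (\<eta> X)) \<and>
        (\<forall>X\<in>Obj C. \<forall>Y\<in>Obj C. \<forall>f\<in>mor C X Y.
           Comp D (FObj F X) (FObj F Y) (FObj G Y) (\<eta> Y) (FMor F X Y f)
           = Comp D (FObj F X) (FObj G X) (FObj G Y) (FMor G X Y f) (\<eta> X)))"

definition is_equivalence ::
    "('o, 'm) precat \<Rightarrow> ('p, 'n) precat \<Rightarrow> ('o, 'm, 'p, 'n) fctr \<Rightarrow> bool" where
  "is_equivalence C D F \<longleftrightarrow> is_functor C D F \<and>
     (\<exists>G. is_functor D C G \<and>
        naturally_isomorphic C C (comp_fctr G F) id_fctr \<and>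
        naturally_isomorphic D D (comp_fctr F G) id_fctr)"


section \<open>Triangulated categories\<close>

text \<open>
  The triangle X \<rightarrow> Y \<rightarrow> Z \<rightarrow> T X with maps u, v, w is the tuple (X, Y, Z, u, v, w).
\<close>

type_synonym ('o, 'm) triangle = "'o \<times> 'o \<times> 'o \<times> 'm \<times> 'm \<times> 'm"

definition is_triangle ::
    "('o, 'm) precat \<Rightarrow> ('o, 'm, 'o, 'm) fctr \<Rightarrow> ('o, 'm) triangle \<Rightarrow> bool" where
  "is_triangle K T = (\<lambda>(X, Y, Z, u, v, w).
     X \<in> Obj K \<and> Y \<in> Obj K \<and> Z \<in> Obj K \<and>
     u \<in> mor K X Y \<and> v \<in> mor K Y Z \<and> w \<in> mor K Z (FObj T X))"

definition triangle_morphism ::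
    "('o, 'm) precat \<Rightarrow> ('o, 'm, 'o, 'm) fctr \<Rightarrow> ('o, 'm) triangle \<Rightarrow> ('o, 'm) triangle
     \<Rightarrow> 'm \<Rightarrow> 'm \<Rightarrow> 'm \<Rightarrow> bool" where
  "triangle_morphism K T = (\<lambda>(X, Y, Z, u, v, w) (X', Y', Z', u', v', w') a b c.
     a \<in> mor K X X' \<and> b \<in> mor K Y Y' \<and> c \<in> mor K Z Z' \<and>
     Comp K X Y Y' b u = Comp K X X' Y' u' a \<and>
     Comp K Y Z Z' c v = Comp K Y Y' Z' v' b \<and>
     Comp K Z (FObj T X) (FObj T X') (FMor T X X' a) w = Comp K Z Z' (FObj T X') w' c)"

definition triangle_iso ::
    "('o, 'm) precat \<Rightarrow> ('o, 'm, 'o, 'm) fctr \<Rightarrow> ('o, 'm) triangle \<Rightarrow> ('o, 'm) triangle \<Rightarrow> bool" where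
  "triangle_iso K T = (\<lambda>(X, Y, Z, u, v, w) (X', Y', Z', u', v', w').
     \<exists>a b c. triangle_morphism K T (X, Y, Z, u, v, w) (X', Y', Z', u', v', w') a b c \<and>
       is_iso K X X' a \<and> is_iso K Y Y' b \<and> is_iso K Z Z' c)"

text \<open>
  Verdier's axioms TR1--TR4 for a class \<Delta> of distinguished triangles. As is usual for stable
  categories, the translation T is an additive self-equivalence and need not be a strict
  automorphism.
\<close>

locale triangulated_category = additive_category K for K :: "('o, 'm) precat" +
  fixes T :: "('o, 'm, 'o, 'm) fctr" and \<Delta> :: "('o, 'm) triangle set"
  assumes T_additive: "additive_functor K K T"
    and T_equivalence: "is_equivalence K K T"
    and distinguished_triangle: "t \<in> \<Delta> \<Longrightarrow> is_triangle K T t"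
    and TR1_iso: "\<lbrakk>t \<in> \<Delta>; is_triangle K T t'; triangle_iso K T t t'\<rbrakk> \<Longrightarrow> t' \<in> \<Delta>"
    and TR1_Ident: "\<lbrakk>X \<in> Obj K; is_zero_object K Z\<rbrakk>
      \<Longrightarrow> (X, X, Z, Ident K X, zero_mor K X Z, zero_mor K Z (FObj T X)) \<in> \<Delta>"
    and TR1_cone: "\<lbrakk>X \<in> Obj K; Y \<in> Obj K; u \<in> mor K X Y\<rbrakk> \<Longrightarrow> \<exists>Z v w. (X, Y, Z, u, v, w) \<in> \<Delta>"
    and TR2: "is_triangle K T (X, Y, Z, u, v, w) \<Longrightarrow>
      (X, Y, Z, u, v, w) \<in> \<Delta> \<longleftrightarrow>
      (Y, Z, FObj T X, v, w, inv\<^bsub>Hom K (FObj T X) (FObj T Y)\<^esub> (FMor T X Y u)) \<in> \<Delta>"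
    and TR3: "\<lbrakk>(X, Y, Z, u, v, w) \<in> \<Delta>; (X', Y', Z', u', v', w') \<in> \<Delta>;
        a \<in> mor K X X'; b \<in> mor K Y Y'; Comp K X Y Y' b u = Comp K X X' Y' u' a\<rbrakk>
      \<Longrightarrow> \<exists>c. triangle_morphism K T (X, Y, Z, u, v, w) (X', Y', Z', u', v', w') a b c"
    and TR4: "\<lbrakk>(X, Y, Z', u, i, i') \<in> \<Delta>; (Y, Z, X', v, j, j') \<in> \<Delta>;
        (X, Z, Y', Comp K X Y Z v u, k, k') \<in> \<Delta>\<rbrakk>
      \<Longrightarrow> \<exists>f g.
        triangle_morphism K T (X, Y, Z', u, i, i') (X, Z, Y', Comp K X Y Z v u, k, k')
          (Ident K X) v f \<and>
        triangle_morphism K T (X, Z, Y', Comp K X Y Z v u, k, k') (Y, Z, X', v, j, j')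
          u (Ident K Z) g \<and>
        (Z', Y', X', f, g, Comp K X' (FObj T Y) (FObj T Z') (FMor T Y Z' i) j') \<in> \<Delta>"

text \<open>
  Happel's structure on the stable category of (C, S). It depends on a choice of a sequence
  0 \<rightarrow> X \<rightarrow> I X \<rightarrow> T X \<rightarrow> 0 in S with maps \<iota> X, \<pi> X and I X injective, for each object X.
  T sends the class of f : X \<rightarrow> Y to the class of h : T X \<rightarrow> T Y whenever some g : I X \<rightarrow> I Y
  makes (f, g, h) a morphism between the chosen sequences. For f : X \<rightarrow> Y with pushout Cf of
  \<iota> X along f, the standard triangle of f has third map induced by \<pi> X and 0 : Y \<rightarrow> T X.
\<close>

definition stable_shift ::
    "('o, 'm) precat \<Rightarrow> ('o, 'm) ses set \<Rightarrow> ('o \<Rightarrow> 'o) \<Rightarrow> ('o \<Rightarrow> 'm) \<Rightarrow> ('o \<Rightarrow> 'm)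
     \<Rightarrow> ('o, 'm set, 'o, 'm set) fctr \<Rightarrow> bool" where
  "stable_shift C S I \<iota> \<pi> T \<longleftrightarrow>
     (\<forall>X\<in>Obj C. injective C S (I X) \<and> (X, \<iota> X, I X, \<pi> X, FObj T X) \<in> S) \<and>
     (\<forall>X\<in>Obj C. \<forall>Y\<in>Obj C.
        \<forall>f\<in>mor C X Y. \<forall>g\<in>mor C (I X) (I Y). \<forall>h\<in>mor C (FObj T X) (FObj T Y).
          Comp C X (I X) (I Y) g (\<iota> X) = Comp C X Y (I Y) (\<iota> Y) f \<longrightarrow>
          Comp C (I X) (FObj T X) (FObj T Y) h (\<pi> X)
            = Comp C (I X) (I Y) (FObj T Y) (\<pi> Y) g \<longrightarrow>
          FMor T X Y (mor_class C (stable_ideal C S) X Y f)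
            = mor_class C (stable_ideal C S) (FObj T X) (FObj T Y) h)"

inductive_set standard_triangles ::
    "('o, 'm) precat \<Rightarrow> ('o, 'm) ses set \<Rightarrow> ('o \<Rightarrow> 'o) \<Rightarrow> ('o \<Rightarrow> 'm) \<Rightarrow> ('o \<Rightarrow> 'm)
     \<Rightarrow> ('o, 'm set, 'o, 'm set) fctr \<Rightarrow> ('o, 'm set) triangle set"
  for C S I \<iota> \<pi> T where
  "\<lbrakk>X \<in> Obj C; Y \<in> Obj C; f \<in> mor C X Y;
    is_pushout C X (I X) Y Cf (\<iota> X) f e g;
    h \<in> mor C Cf (FObj T X);
    Comp C (I X) Cf (FObj T X) h e = \<pi> X;
    Comp C Y Cf (FObj T X) h g = zero_mor C Y (FObj T X)\<rbrakk>
   \<Longrightarrow> (X, Y, Cf,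
       mor_class C (stable_ideal C S) X Y f,
       mor_class C (stable_ideal C S) Y Cf g,
       mor_class C (stable_ideal C S) Cf (FObj T X) h)
      \<in> standard_triangles C S I \<iota> \<pi> T"

definition happel_structure ::
    "('o, 'm) precat \<Rightarrow> ('o, 'm) ses set \<Rightarrow> ('o, 'm set, 'o, 'm set) fctr
     \<Rightarrow> ('o, 'm set) triangle set \<Rightarrow> bool" where
  "happel_structure C S T \<Delta> \<longleftrightarrow>
     (\<exists>I \<iota> \<pi>. stable_shift C S I \<iota> \<pi> T \<and>
        \<Delta> = {t. is_triangle (stable_category C S) T t \<and>
               (\<exists>s\<in>standard_triangles C S I \<iota> \<pi> T. triangle_iso (stable_category C S) T s t)})"

text \<open>
  The triangulated category (K, T, \<Delta>) is algebraic, being the stable category of the Frobenius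
  category (C, S) with Happel's triangulated structure.
\<close>

definition algebraic_via ::
    "('o, 'm) precat \<Rightarrow> ('o, 'm) ses set \<Rightarrow> ('o, 'm set) precat
     \<Rightarrow> ('o, 'm set, 'o, 'm set) fctr \<Rightarrow> ('o, 'm set) triangle set \<Rightarrow> bool" where
  "algebraic_via C S K T \<Delta> \<longleftrightarrow>
     frobenius_category C S \<and> same_category (stable_category C S) K \<and> happel_structure C S T \<Delta>"


section \<open>N-complexes\<close>

record ('o, 'm) ncomplex =
  cobj :: "int \<Rightarrow> 'o"
  cdiff :: "int \<Rightarrow> 'm"

text \<open>The composite of the n consecutive differentials of X that starts in degree i.\<close>

primrec cdiff_pow :: "('o, 'm) precat \<Rightarrow> ('o, 'm) ncomplex \<Rightarrow> int \<Rightarrow> nat \<Rightarrow> 'm" where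
  "cdiff_pow B X i 0 = Ident B (cobj X i)"
| "cdiff_pow B X i (Suc n) =
     Comp B (cobj X i) (cobj X (i + int n)) (cobj X (i + int n + 1))
       (cdiff X (i + int n)) (cdiff_pow B X i n)"

definition is_ncomplex :: "nat \<Rightarrow> ('o, 'm) precat \<Rightarrow> ('o, 'm) ncomplex \<Rightarrow> bool" where
  "is_ncomplex N B X \<longleftrightarrow>
     (\<forall>i. cobj X i \<in> Obj B \<and> cdiff X i \<in> mor B (cobj X i) (cobj X (i + 1)) \<and>
        cdiff_pow B X i N = zero_mor B (cobj X i) (cobj X (i + int N)))"

definition is_chain_map ::
    "('o, 'm) precat \<Rightarrow> ('o, 'm) ncomplex \<Rightarrow> ('o, 'm) ncomplex \<Rightarrow> (int \<Rightarrow> 'm) \<Rightarrow> bool" where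
  "is_chain_map B X Y f \<longleftrightarrow>
     (\<forall>i. f i \<in> mor B (cobj X i) (cobj Y i) \<and>
        Comp B (cobj X i) (cobj X (i + 1)) (cobj Y (i + 1)) (f (i + 1)) (cdiff X i)
        = Comp B (cobj X i) (cobj Y i) (cobj Y (i + 1)) (cdiff Y i) (f i))"

definition ncomplex_category ::
    "nat \<Rightarrow> ('o, 'm) precat \<Rightarrow> (('o, 'm) ncomplex, int \<Rightarrow> 'm) precat" where
  "ncomplex_category N B =
     \<lparr>Obj = {X. is_ncomplex N B X},
      Hom = (\<lambda>X Y. \<lparr>carrier = {f. is_chain_map B X Y f},
                    mult = (\<lambda>f g i. f i \<otimes>\<^bsub>Hom B (cobj X i) (cobj Y i)\<^esub> g i),
                    one = (\<lambda>i. zero_mor B (cobj X i) (cobj Y i))\<rparr>),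
      Ident = (\<lambda>X i. Ident B (cobj X i)),
      Comp = (\<lambda>X Y Z g f i. Comp B (cobj X i) (cobj Y i) (cobj Z i) (g i) (f i))\<rparr>"

text \<open>Split exactness of 0 \<rightarrow> X \<rightarrow> Y \<rightarrow> Z \<rightarrow> 0: Y is a biproduct of X and Z via f and g.\<close>

definition split_exact :: "('o, 'm) precat \<Rightarrow> ('o, 'm) ses \<Rightarrow> bool" where
  "split_exact B = (\<lambda>(X, f, Y, g, Z). \<exists>s r. is_biproduct B X Z Y f s r g)"

definition degreewise_split ::
    "nat \<Rightarrow> ('o, 'm) precat \<Rightarrow> (('o, 'm) ncomplex, int \<Rightarrow> 'm) ses set" where
  "degreewise_split N B =
     {(X, f, Y, g, Z) | X f Y g Z.
        X \<in> Obj (ncomplex_category N B) \<and> Y \<in> Obj (ncomplex_category N B) \<and>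
        Z \<in> Obj (ncomplex_category N B) \<and>
        f \<in> mor (ncomplex_category N B) X Y \<and> g \<in> mor (ncomplex_category N B) Y Z \<and>
        (\<forall>i. split_exact B (cobj X i, f i, cobj Y i, g i, cobj Z i))}"

text \<open>
  The summand for j is the composite of s (i+j-1) : X (i+j-1) \<rightarrow> Y (i-N+j) with the j-1
  differentials from X i to X (i+j-1) and the N-j differentials from Y (i-N+j) to Y i.
\<close>

definition null_homotopic ::
    "nat \<Rightarrow> ('o, 'm) precat \<Rightarrow> ('o, 'm) ncomplex \<Rightarrow> ('o, 'm) ncomplex \<Rightarrow> (int \<Rightarrow> 'm) \<Rightarrow> bool" where
  "null_homotopic N B X Y f \<longleftrightarrow>
     (\<exists>s. (\<forall>i. s i \<in> mor B (cobj X i) (cobj Y (i - int N + 1))) \<and>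
        (\<forall>i. f i = (\<Otimes>\<^bsub>Hom B (cobj X i) (cobj Y i)\<^esub>j\<in>{1..N}.
           Comp B (cobj X i) (cobj Y (i - int N + int j)) (cobj Y i)
             (cdiff_pow B Y (i - int N + int j) (N - j))
             (Comp B (cobj X i) (cobj X (i + int j - 1)) (cobj Y (i - int N + int j))
                (s (i + int j - 1))
                (cdiff_pow B X i (j - 1))))))"

definition homotopy_category ::
    "nat \<Rightarrow> ('o, 'm) precat \<Rightarrow> (('o, 'm) ncomplex, (int \<Rightarrow> 'm) set) precat" where
  "homotopy_category N B =
     quotient_category (ncomplex_category N B)
       (\<lambda>X Y. {f \<in> mor (ncomplex_category N B) X Y. null_homotopic N B X Y f})"

end

theory Submission
  imports Defs
begin

text \<open>
  Both parts rest on one family of N-complexes, the sums of discs. The disc on an object A is the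
  complex with A in N consecutive degrees and identities between them. A chain map from X to a disc is an
  arbitrary map from X to A in the last degree of the disc, and a chain map from a disc to Y is an
  arbitrary map from A to Y in its first degree (disc_sum_map_in, disc_sum_map_out). Neither
  description involves a differential, and so sums of discs have the extension and lifting
  properties of injectives and projectives for all sequences that split degree by degree. Every
  N-complex X embeds into the sum of the discs that end with its objects, and is covered by the sum of
  the discs that begin with them, and both maps split in each degree. Hence there are enough
  projectives and enough injectives, and by a retract argument these two classes coincide. The axioms
  of an exact category hold since the pushouts, pullbacks, kernels and cokernels that they ask for are
  built from biproducts degree by degree; the differentials, and the vanishing of their N-fold
  composites, come from universal properties. This gives the Frobenius category (frobenius_CN).

  A chain map is zero in the stable category if and only if it extends along the embedding of X into
  the disc sum J on X. A chain map from J to Y is a family of maps s from X m to Y (m - N + 1), and expanding its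
  composite with the embedding along the summands of J gives precisely the formula for a
  null-homotopy with homotopy s (null_homotopic_iff_factors). So the stable ideal is the ideal
  of null-homotopic maps, and the two quotient categories agree (stable_ideal_CN).

  The triangulation is Happel's theorem for an arbitrary Frobenius category. The part of it
  that is formal is separated in the locale triangulation_criterion: once cones are known to be weak
  cokernels, the five lemma holds for triangles, because an endomorphism of a cone that is the
  identity on the other two vertices differs from 1 by a map of square zero. From the five lemma
  follow the backward rotation, and the octahedral axiom for all cones if it holds for some. What is left
  concerns pushouts of the inclusions X --> I X. The decisive fact for the octahedron is
  cone_of_conflation_in_\<Delta>: a cone may be formed with any admissible monomorphism from X into an
  injective, in place of the chosen one.
\<close>

section \<open>Preadditive categories\<close>

context category
begin

declare Ident_in [simp] Comp_in [simp] Comp_assoc [simp] Ident_left [simp] Ident_right [simp]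

text \<open>
  Composites are normalised by associating them to the right, and then an equation for g f no longer
  matches a term g (f k). This is the same equation in the form that rewrites such terms.
\<close>

lemma Comp_eq_Comp:
  assumes "Comp C X Y Z g f = h"
    and "W \<in> Obj C" "X \<in> Obj C" "Y \<in> Obj C" "Z \<in> Obj C"
    and "k \<in> mor C W X" "f \<in> mor C X Y" "g \<in> mor C Y Z"
  shows "Comp C W Y Z g (Comp C W X Y f k) = Comp C W X Z h k"
  using assms Comp_assoc by metis

lemma is_isoI:
  assumes "f \<in> mor C X Y" "g \<in> mor C Y X"
    and "Comp C X Y X g f = Ident C X" "Comp C Y X Y f g = Ident C Y"
  shows "is_iso C X Y f"
  using assms unfolding is_iso_def by blast

lemma is_isoE:
  assumes "is_iso C X Y f"
  obtains g where "f \<in> mor C X Y" "g \<in> mor C Y X" "is_iso C Y X g"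
    "Comp C X Y X g f = Ident C X" "Comp C Y X Y f g = Ident C Y"
  using assms unfolding is_iso_def by blast

lemma is_iso_Ident [simp]: "X \<in> Obj C \<Longrightarrow> is_iso C X X (Ident C X)"
  by (rule is_isoI[where g = "Ident C X"]) simp_all

lemma is_iso_Comp:
  assumes ob: "X \<in> Obj C" "Y \<in> Obj C" "Z \<in> Obj C"
    and f: "is_iso C X Y f" and g: "is_iso C Y Z g"
  shows "is_iso C X Z (Comp C X Y Z g f)"
proof -
  obtain f' where f': "f \<in> mor C X Y" "f' \<in> mor C Y X"
    "Comp C X Y X f' f = Ident C X" "Comp C Y X Y f f' = Ident C Y"
    using f by (rule is_isoE)
  obtain g' where g': "g \<in> mor C Y Z" "g' \<in> mor C Z Y"
    "Comp C Y Z Y g' g = Ident C Y" "Comp C Z Y Z g g' = Ident C Z"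
    using g by (rule is_isoE)
  note [simp] = ob f' g' Comp_eq_Comp[OF f'(4)] Comp_eq_Comp[OF g'(3)]
  show ?thesis
    by (rule is_isoI[where g = "Comp C Z Y X f' g'"]) simp_all
qed

end

context preadditive_category
begin

lemma zero_in [simp]: "X \<in> Obj C \<Longrightarrow> Y \<in> Obj C \<Longrightarrow> zero_mor C X Y \<in> mor C X Y"
  using Hom_group[of X Y] by (simp add: comm_group_def group.is_monoid monoid.one_closed)

lemma add_in [simp]:
  "\<lbrakk>X \<in> Obj C; Y \<in> Obj C; f \<in> mor C X Y; g \<in> mor C X Y\<rbrakk> \<Longrightarrow> f \<otimes>\<^bsub>Hom C X Y\<^esub> g \<in> mor C X Y"
  using Hom_group[of X Y] by (simp add: comm_group_def group.is_monoid monoid.m_closed)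

lemma neg_in [simp]:
  "\<lbrakk>X \<in> Obj C; Y \<in> Obj C; f \<in> mor C X Y\<rbrakk> \<Longrightarrow> inv\<^bsub>Hom C X Y\<^esub> f \<in> mor C X Y"
  using Hom_group[of X Y] by (simp add: comm_group_def group.inv_closed)

lemma add_zero_right [simp]:
  "\<lbrakk>X \<in> Obj C; Y \<in> Obj C; f \<in> mor C X Y\<rbrakk> \<Longrightarrow> f \<otimes>\<^bsub>Hom C X Y\<^esub> zero_mor C X Y = f"
  using Hom_group[of X Y] by (simp add: comm_group_def group.is_monoid monoid.r_one)

lemma add_zero_left [simp]:
  "\<lbrakk>X \<in> Obj C; Y \<in> Obj C; f \<in> mor C X Y\<rbrakk> \<Longrightarrow> zero_mor C X Y \<otimes>\<^bsub>Hom C X Y\<^esub> f = f"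
  using Hom_group[of X Y] by (simp add: comm_group_def group.is_monoid monoid.l_one)

lemma add_assoc:
  "\<lbrakk>X \<in> Obj C; Y \<in> Obj C; f \<in> mor C X Y; g \<in> mor C X Y; h \<in> mor C X Y\<rbrakk>
   \<Longrightarrow> (f \<otimes>\<^bsub>Hom C X Y\<^esub> g) \<otimes>\<^bsub>Hom C X Y\<^esub> h = f \<otimes>\<^bsub>Hom C X Y\<^esub> (g \<otimes>\<^bsub>Hom C X Y\<^esub> h)"
  using Hom_group[of X Y] by (simp add: comm_group_def group.is_monoid monoid.m_assoc)

lemma add_commute:
  "\<lbrakk>X \<in> Obj C; Y \<in> Obj C; f \<in> mor C X Y; g \<in> mor C X Y\<rbrakk>
   \<Longrightarrow> f \<otimes>\<^bsub>Hom C X Y\<^esub> g = g \<otimes>\<^bsub>Hom C X Y\<^esub> f"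
  using Hom_group[of X Y] by (simp add: comm_group_def comm_monoid.m_comm)

lemma add_left_commute:
  "\<lbrakk>X \<in> Obj C; Y \<in> Obj C; f \<in> mor C X Y; g \<in> mor C X Y; h \<in> mor C X Y\<rbrakk>
   \<Longrightarrow> f \<otimes>\<^bsub>Hom C X Y\<^esub> (g \<otimes>\<^bsub>Hom C X Y\<^esub> h) = g \<otimes>\<^bsub>Hom C X Y\<^esub> (f \<otimes>\<^bsub>Hom C X Y\<^esub> h)"
  using Hom_group[of X Y] by (simp add: comm_group_def comm_monoid.m_lcomm)

lemmas add_ac = add_assoc add_commute add_left_commute

lemma add_neg [simp]:
  "\<lbrakk>X \<in> Obj C; Y \<in> Obj C; f \<in> mor C X Y\<rbrakk> \<Longrightarrow> f \<otimes>\<^bsub>Hom C X Y\<^esub> inv\<^bsub>Hom C X Y\<^esub> f = zero_mor C X Y"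
  "\<lbrakk>X \<in> Obj C; Y \<in> Obj C; f \<in> mor C X Y\<rbrakk> \<Longrightarrow> inv\<^bsub>Hom C X Y\<^esub> f \<otimes>\<^bsub>Hom C X Y\<^esub> f = zero_mor C X Y"
  using Hom_group[of X Y] by (simp_all add: comm_group_def group.r_inv group.l_inv)

lemma add_neg_cancel [simp]:
  assumes "X \<in> Obj C" "Y \<in> Obj C" "f \<in> mor C X Y" "g \<in> mor C X Y"
  shows "f \<otimes>\<^bsub>Hom C X Y\<^esub> (inv\<^bsub>Hom C X Y\<^esub> f \<otimes>\<^bsub>Hom C X Y\<^esub> g) = g"
    and "inv\<^bsub>Hom C X Y\<^esub> f \<otimes>\<^bsub>Hom C X Y\<^esub> (f \<otimes>\<^bsub>Hom C X Y\<^esub> g) = g"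
    and "f \<otimes>\<^bsub>Hom C X Y\<^esub> (g \<otimes>\<^bsub>Hom C X Y\<^esub> inv\<^bsub>Hom C X Y\<^esub> f) = g"
  using assms add_left_commute[of X Y f g "inv\<^bsub>Hom C X Y\<^esub> f"]
  by (simp_all add: add_assoc[symmetric])

lemma neg_neg [simp]:
  "\<lbrakk>X \<in> Obj C; Y \<in> Obj C; f \<in> mor C X Y\<rbrakk> \<Longrightarrow> inv\<^bsub>Hom C X Y\<^esub> (inv\<^bsub>Hom C X Y\<^esub> f) = f"
  using Hom_group[of X Y] by (simp add: comm_group_def group.inv_inv)

lemma neg_zero [simp]:
  "\<lbrakk>X \<in> Obj C; Y \<in> Obj C\<rbrakk> \<Longrightarrow> inv\<^bsub>Hom C X Y\<^esub> (zero_mor C X Y) = zero_mor C X Y"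
  using Hom_group[of X Y] by (simp add: comm_group_def group.is_monoid monoid.inv_one)

lemma neg_add [simp]:
  "\<lbrakk>X \<in> Obj C; Y \<in> Obj C; f \<in> mor C X Y; g \<in> mor C X Y\<rbrakk>
   \<Longrightarrow> inv\<^bsub>Hom C X Y\<^esub> (f \<otimes>\<^bsub>Hom C X Y\<^esub> g) = inv\<^bsub>Hom C X Y\<^esub> f \<otimes>\<^bsub>Hom C X Y\<^esub> inv\<^bsub>Hom C X Y\<^esub> g"
  using Hom_group[of X Y] by (simp add: comm_group.inv_mult)

lemma add_left_cancel:
  "\<lbrakk>X \<in> Obj C; Y \<in> Obj C; f \<in> mor C X Y; g \<in> mor C X Y; h \<in> mor C X Y\<rbrakk>
   \<Longrightarrow> f \<otimes>\<^bsub>Hom C X Y\<^esub> g = f \<otimes>\<^bsub>Hom C X Y\<^esub> h \<longleftrightarrow> g = h"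
  using add_neg_cancel(2) by metis

lemma neg_eqI:
  assumes "X \<in> Obj C" "Y \<in> Obj C" "f \<in> mor C X Y" "g \<in> mor C X Y"
    and "f \<otimes>\<^bsub>Hom C X Y\<^esub> g = zero_mor C X Y"
  shows "inv\<^bsub>Hom C X Y\<^esub> f = g"
  using assms by (metis add_left_cancel add_neg(1) neg_in)

lemma Comp_zero_left [simp]:
  assumes "X \<in> Obj C" "Y \<in> Obj C" "Z \<in> Obj C" "f \<in> mor C X Y"
  shows "Comp C X Y Z (zero_mor C Y Z) f = zero_mor C X Z"
proof -
  let ?z = "Comp C X Y Z (zero_mor C Y Z) f"
  have "?z \<otimes>\<^bsub>Hom C X Z\<^esub> ?z = ?z \<otimes>\<^bsub>Hom C X Z\<^esub> zero_mor C X Z"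
    using assms by (simp add: Comp_add_left[symmetric])
  then show ?thesis
    using assms by (simp add: add_left_cancel del: add_zero_right)
qed

lemma Comp_zero_right [simp]:
  assumes "X \<in> Obj C" "Y \<in> Obj C" "Z \<in> Obj C" "g \<in> mor C Y Z"
  shows "Comp C X Y Z g (zero_mor C X Y) = zero_mor C X Z"
proof -
  let ?z = "Comp C X Y Z g (zero_mor C X Y)"
  have "?z \<otimes>\<^bsub>Hom C X Z\<^esub> ?z = ?z \<otimes>\<^bsub>Hom C X Z\<^esub> zero_mor C X Z"
    using assms by (simp add: Comp_add_right[symmetric])
  then show ?thesis
    using assms by (simp add: add_left_cancel del: add_zero_right)
qed

declare Comp_add_left [simp] Comp_add_right [simp]

lemma Comp_neg_left [simp]:
  assumes "X \<in> Obj C" "Y \<in> Obj C" "Z \<in> Obj C" "f \<in> mor C X Y" "g \<in> mor C Y Z"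
  shows "Comp C X Y Z (inv\<^bsub>Hom C Y Z\<^esub> g) f = inv\<^bsub>Hom C X Z\<^esub> (Comp C X Y Z g f)"
  by (rule neg_eqI[symmetric]) (use assms in \<open>simp_all flip: Comp_add_left\<close>)

lemma Comp_neg_right [simp]:
  assumes "X \<in> Obj C" "Y \<in> Obj C" "Z \<in> Obj C" "f \<in> mor C X Y" "g \<in> mor C Y Z"
  shows "Comp C X Y Z g (inv\<^bsub>Hom C X Y\<^esub> f) = inv\<^bsub>Hom C X Z\<^esub> (Comp C X Y Z g f)"
  by (rule neg_eqI[symmetric]) (use assms in \<open>simp_all flip: Comp_add_right\<close>)

definition diff :: "'o \<Rightarrow> 'o \<Rightarrow> 'm \<Rightarrow> 'm \<Rightarrow> 'm" where
  "diff X Y f g = f \<otimes>\<^bsub>Hom C X Y\<^esub> inv\<^bsub>Hom C X Y\<^esub> g"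

lemma diff_in [simp]:
  "\<lbrakk>X \<in> Obj C; Y \<in> Obj C; f \<in> mor C X Y; g \<in> mor C X Y\<rbrakk> \<Longrightarrow> diff X Y f g \<in> mor C X Y"
  by (simp add: diff_def)

lemma diff_self [simp]:
  "\<lbrakk>X \<in> Obj C; Y \<in> Obj C; f \<in> mor C X Y\<rbrakk> \<Longrightarrow> diff X Y f f = zero_mor C X Y"
  by (simp add: diff_def)

lemma diff_zero [simp]:
  "\<lbrakk>X \<in> Obj C; Y \<in> Obj C; f \<in> mor C X Y\<rbrakk> \<Longrightarrow> diff X Y f (zero_mor C X Y) = f"
  by (simp add: diff_def)

lemma Comp_diff_left [simp]:
  "\<lbrakk>X \<in> Obj C; Y \<in> Obj C; Z \<in> Obj C; f \<in> mor C X Y; g \<in> mor C Y Z; g' \<in> mor C Y Z\<rbrakk>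
   \<Longrightarrow> Comp C X Y Z (diff Y Z g g') f = diff X Z (Comp C X Y Z g f) (Comp C X Y Z g' f)"
  by (simp add: diff_def)

lemma Comp_diff_right [simp]:
  "\<lbrakk>X \<in> Obj C; Y \<in> Obj C; Z \<in> Obj C; f \<in> mor C X Y; f' \<in> mor C X Y; g \<in> mor C Y Z\<rbrakk>
   \<Longrightarrow> Comp C X Y Z g (diff X Y f f') = diff X Z (Comp C X Y Z g f) (Comp C X Y Z g f')"
  by (simp add: diff_def)

lemma add_diff_cancel [simp]:
  assumes "X \<in> Obj C" "Y \<in> Obj C" "f \<in> mor C X Y" "g \<in> mor C X Y"
  shows "g \<otimes>\<^bsub>Hom C X Y\<^esub> diff X Y f g = f" "diff X Y f g \<otimes>\<^bsub>Hom C X Y\<^esub> g = f"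
    "diff X Y (f \<otimes>\<^bsub>Hom C X Y\<^esub> g) g = f" "diff X Y (g \<otimes>\<^bsub>Hom C X Y\<^esub> f) g = f"
    "diff X Y f (diff X Y f g) = g"
  using assms by (simp_all add: diff_def add_ac)

lemma Comp_finprod_left:
  assumes ob: "X \<in> Obj C" "Y \<in> Obj C" "Z \<in> Obj C" and f: "f \<in> mor C X Y"
    and "finite K" "\<And>k. k \<in> K \<Longrightarrow> F k \<in> mor C Y Z"
  shows "Comp C X Y Z (finprod (Hom C Y Z) F K) f
    = finprod (Hom C X Z) (\<lambda>k. Comp C X Y Z (F k) f) K"
  using assms(5,6)
proof (induction K rule: finite_induct)
  case empty
  interpret YZ: comm_group "Hom C Y Z" using Hom_group ob by blast
  interpret XZ: comm_group "Hom C X Z" using Hom_group ob by blast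
  show ?case using ob f by simp
next
  case (insert k K)
  interpret YZ: comm_group "Hom C Y Z" using Hom_group ob by blast
  interpret XZ: comm_group "Hom C X Z" using Hom_group ob by blast
  have "finprod (Hom C Y Z) F K \<in> mor C Y Z"
    using insert by (intro YZ.finprod_closed) auto
  with insert ob f show ?case
    by (subst YZ.finprod_insert XZ.finprod_insert; auto)+
qed

lemma Comp_finprod_right:
  assumes ob: "X \<in> Obj C" "Y \<in> Obj C" "Z \<in> Obj C" and g: "g \<in> mor C Y Z"
    and "finite K" "\<And>k. k \<in> K \<Longrightarrow> F k \<in> mor C X Y"
  shows "Comp C X Y Z g (finprod (Hom C X Y) F K)
    = finprod (Hom C X Z) (\<lambda>k. Comp C X Y Z g (F k)) K"
  using assms(5,6)
proof (induction K rule: finite_induct)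
  case empty
  interpret XY: comm_group "Hom C X Y" using Hom_group ob by blast
  interpret XZ: comm_group "Hom C X Z" using Hom_group ob by blast
  show ?case using ob g by simp
next
  case (insert k K)
  interpret XY: comm_group "Hom C X Y" using Hom_group ob by blast
  interpret XZ: comm_group "Hom C X Z" using Hom_group ob by blast
  have "finprod (Hom C X Y) F K \<in> mor C X Y"
    using insert by (intro XY.finprod_closed) auto
  with insert ob g show ?case
    by (subst XY.finprod_insert XZ.finprod_insert; auto)+
qed

lemma finprod_in [simp]:
  assumes "X \<in> Obj C" "Y \<in> Obj C" "\<And>k. k \<in> K \<Longrightarrow> F k \<in> mor C X Y"
  shows "finprod (Hom C X Y) F K \<in> mor C X Y"
proof -
  interpret comm_group "Hom C X Y" using Hom_group assms by blast
  show ?thesis using assms by (intro finprod_closed) auto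
qed

lemma finprod_delta:
  assumes "X \<in> Obj C" "Y \<in> Obj C" "finite K" "l \<in> K" "F l \<in> mor C X Y"
    and "\<And>k. k \<in> K \<Longrightarrow> k \<noteq> l \<Longrightarrow> F k = zero_mor C X Y"
  shows "finprod (Hom C X Y) F K = F l"
proof -
  interpret comm_group "Hom C X Y" using Hom_group assms by blast
  have F: "F k \<in> mor C X Y" if "k \<in> K" for k
    using assms that by (cases "k = l") simp_all
  have "finprod (Hom C X Y) F K
      = finprod (Hom C X Y) (\<lambda>k. if l = k then F k else \<one>\<^bsub>Hom C X Y\<^esub>) K"
    using assms by (intro finprod_cong') (auto simp: F)
  also have "\<dots> = F l"
    using F by (intro finprod_singleton[OF assms(4,3)]) auto
  finally show ?thesis .
qed

lemma finprod_eqI: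
  assumes "X \<in> Obj C" "Y \<in> Obj C" "\<And>k. k \<in> K \<Longrightarrow> F k \<in> mor C X Y"
    and "\<And>k. k \<in> K \<Longrightarrow> G k = F k"
  shows "finprod (Hom C X Y) G K = finprod (Hom C X Y) F K"
proof -
  interpret comm_group "Hom C X Y" using Hom_group assms by blast
  show ?thesis using assms by (intro finprod_cong') auto
qed

lemma zero_object_Ident:
  assumes "is_zero_object C Z"
  shows "Ident C Z = zero_mor C Z Z"
  using assms unfolding is_zero_object_def by (metis Ident_in zero_in)

lemma zero_objectI:
  assumes "Z \<in> Obj C" "Ident C Z = zero_mor C Z Z"
  shows "is_zero_object C Z"
  unfolding is_zero_object_def
proof (intro conjI ballI assms(1))
  fix X assume X: "X \<in> Obj C"
  have "f = zero_mor C X Z" if "f \<in> mor C X Z" for f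
    using Ident_left[of X Z f] Comp_zero_left[of X Z Z f] assms X that by simp
  then show "\<exists>!f. f \<in> mor C X Z"
    using assms X by (intro ex1I[of _ "zero_mor C X Z"]) auto
  have "f = zero_mor C Z X" if "f \<in> mor C Z X" for f
    using Ident_right[of Z X f] Comp_zero_right[of Z Z X f] assms X that by simp
  then show "\<exists>!f. f \<in> mor C Z X"
    using assms X by (intro ex1I[of _ "zero_mor C Z X"]) auto
qed

lemma zero_object_in:
  assumes "is_zero_object C Z" "X \<in> Obj C"
  shows "Z \<in> Obj C" "f \<in> mor C X Z \<Longrightarrow> f = zero_mor C X Z" "f \<in> mor C Z X \<Longrightarrow> f = zero_mor C Z X"
  using assms unfolding is_zero_object_def by (metis zero_in)+

section \<open>Biproducts\<close>

lemma biproductD: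
  assumes "is_biproduct C A B P i1 i2 p1 p2"
  shows "A \<in> Obj C" "B \<in> Obj C" "P \<in> Obj C"
    and "i1 \<in> mor C A P" "i2 \<in> mor C B P" "p1 \<in> mor C P A" "p2 \<in> mor C P B"
    and "Comp C A P A p1 i1 = Ident C A" "Comp C B P B p2 i2 = Ident C B"
    and "Comp C B P A p1 i2 = zero_mor C B A" "Comp C A P B p2 i1 = zero_mor C A B"
    and "Comp C P A P i1 p1 \<otimes>\<^bsub>Hom C P P\<^esub> Comp C P B P i2 p2 = Ident C P"
  using assms unfolding is_biproduct_def by auto

text \<open>
  The biproduct equations in the form in which they occur inside composites, and the expansion of a
  map into or out of P along i1 p1 + i2 p2 = 1.
\<close>

lemma biproduct_reassoc:
  assumes "is_biproduct C A B P i1 i2 p1 p2" "W \<in> Obj C"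
  shows "k \<in> mor C W A \<Longrightarrow> Comp C W P A p1 (Comp C W A P i1 k) = k"
    and "k \<in> mor C W B \<Longrightarrow> Comp C W P B p2 (Comp C W B P i2 k) = k"
    and "k \<in> mor C W B \<Longrightarrow> Comp C W P A p1 (Comp C W B P i2 k) = zero_mor C W A"
    and "k \<in> mor C W A \<Longrightarrow> Comp C W P B p2 (Comp C W A P i1 k) = zero_mor C W B"
    and "k \<in> mor C W P \<Longrightarrow>
      Comp C W A P i1 (Comp C W P A p1 k) \<otimes>\<^bsub>Hom C W P\<^esub> Comp C W B P i2 (Comp C W P B p2 k) = k"
    and "k \<in> mor C P W \<Longrightarrow>
      Comp C P A W (Comp C A P W k i1) p1 \<otimes>\<^bsub>Hom C P W\<^esub> Comp C P B W (Comp C B P W k i2) p2 = k"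
proof -
  note b = biproductD[OF assms(1)]
  note [simp] = b(1-7) assms(2)
  show "k \<in> mor C W A \<Longrightarrow> Comp C W P A p1 (Comp C W A P i1 k) = k"
    using Comp_eq_Comp[OF b(8)] by simp
  show "k \<in> mor C W B \<Longrightarrow> Comp C W P B p2 (Comp C W B P i2 k) = k"
    using Comp_eq_Comp[OF b(9)] by simp
  show "k \<in> mor C W B \<Longrightarrow> Comp C W P A p1 (Comp C W B P i2 k) = zero_mor C W A"
    using Comp_eq_Comp[OF b(10)] by simp
  show "k \<in> mor C W A \<Longrightarrow> Comp C W P B p2 (Comp C W A P i1 k) = zero_mor C W B"
    using Comp_eq_Comp[OF b(11)] by simp
  show "Comp C W A P i1 (Comp C W P A p1 k) \<otimes>\<^bsub>Hom C W P\<^esub> Comp C W B P i2 (Comp C W P B p2 k) = k"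
    if "k \<in> mor C W P"
  proof -
    have "Comp C W P P (Comp C P A P i1 p1 \<otimes>\<^bsub>Hom C P P\<^esub> Comp C P B P i2 p2) k = k"
      using that by (simp only: b(12)) simp
    with that show ?thesis by simp
  qed
  show "Comp C P A W (Comp C A P W k i1) p1 \<otimes>\<^bsub>Hom C P W\<^esub> Comp C P B W (Comp C B P W k i2) p2 = k"
    if "k \<in> mor C P W"
  proof -
    have "Comp C P P W k (Comp C P A P i1 p1 \<otimes>\<^bsub>Hom C P P\<^esub> Comp C P B P i2 p2) = k"
      using that by (simp only: b(12)) simp
    with that show ?thesis by simp
  qed
qed

lemma biproduct_in_eqI:
  assumes "is_biproduct C A B P i1 i2 p1 p2" "W \<in> Obj C" "f \<in> mor C W P" "g \<in> mor C W P"
    and "Comp C W P A p1 f = Comp C W P A p1 g" "Comp C W P B p2 f = Comp C W P B p2 g"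
  shows "f = g"
  using biproduct_reassoc(5)[OF assms(1,2,3)] biproduct_reassoc(5)[OF assms(1,2,4)] assms(5,6)
  by metis

lemma biproduct_out_eqI:
  assumes "is_biproduct C A B P i1 i2 p1 p2" "W \<in> Obj C" "f \<in> mor C P W" "g \<in> mor C P W"
    and "Comp C A P W f i1 = Comp C A P W g i1" "Comp C B P W f i2 = Comp C B P W g i2"
  shows "f = g"
  using biproduct_reassoc(6)[OF assms(1,2,3)] biproduct_reassoc(6)[OF assms(1,2,4)] assms(5,6)
  by metis

lemma biproduct_swap:
  assumes "is_biproduct C A B P i1 i2 p1 p2"
  shows "is_biproduct C B A P i2 i1 p2 p1"
proof -
  note b = biproductD[OF assms]
  have "Comp C P B P i2 p2 \<otimes>\<^bsub>Hom C P P\<^esub> Comp C P A P i1 p1 = Ident C P"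
    using b(1-7) by (subst add_commute) (simp_all add: b(12))
  then show ?thesis
    unfolding is_biproduct_def by (intro conjI b)
qed

text \<open>
  Transport along isomorphisms of the objects: the remaining two maps are the conjugates of i2 and p1.
\<close>

lemma biproduct_iso:
  assumes b: "is_biproduct C A B P i1 i2 p1 p2"
    and ob: "A' \<in> Obj C" "B' \<in> Obj C" "P' \<in> Obj C"
    and i': "i' \<in> mor C A' P'" and p': "p' \<in> mor C P' B'"
    and a: "is_iso C A A' a" and e: "is_iso C P P' e" and c: "is_iso C B B' c"
    and i'a: "Comp C A P P' e i1 = Comp C A A' P' i' a"
    and p'e: "Comp C P B B' c p2 = Comp C P P' B' p' e"
  shows "\<exists>s r. is_biproduct C A' B' P' i' s r p'"
proof -
  obtain a' where a': "a \<in> mor C A A'" "a' \<in> mor C A' A"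
    "Comp C A A' A a' a = Ident C A" "Comp C A' A A' a a' = Ident C A'"
    using a by (rule is_isoE)
  obtain e' where e': "e \<in> mor C P P'" "e' \<in> mor C P' P"
    "Comp C P P' P e' e = Ident C P" "Comp C P' P P' e e' = Ident C P'"
    using e by (rule is_isoE)
  obtain c' where c': "c \<in> mor C B B'" "c' \<in> mor C B' B"
    "Comp C B B' B c' c = Ident C B" "Comp C B' B B' c c' = Ident C B'"
    using c by (rule is_isoE)
  note [simp] = biproductD[OF b] biproduct_reassoc[OF b] ob i' p' a' e' c'
    Comp_eq_Comp[OF e'(3)] Comp_eq_Comp[OF e'(4)]
    Comp_eq_Comp[OF a'(3)] Comp_eq_Comp[OF a'(4)] Comp_eq_Comp[OF c'(3)] Comp_eq_Comp[OF c'(4)]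
  have i': "i' = Comp C A' A P' (Comp C A P P' e i1) a'"
    by (simp only: i'a) simp
  have p': "p' = Comp C P' P B' (Comp C P B B' c p2) e'"
    by (simp only: p'e) simp
  have sum: "Comp C P' P P' e (Comp C P' A P i1 (Comp C P' P A p1 e'))
      \<otimes>\<^bsub>Hom C P' P'\<^esub> Comp C P' P P' e (Comp C P' B P i2 (Comp C P' P B p2 e')) = Ident C P'"
    by (subst Comp_add_right[symmetric]) simp_all
  have "is_biproduct C A' B' P' i' (Comp C B' B P' (Comp C B P P' e i2) c')
      (Comp C P' P A' (Comp C P A A' a p1) e') p'"
    unfolding is_biproduct_def i' p' using sum by simp
  then show ?thesis by blast
qed

text \<open>
  A map f that is a section of the projection p1 can replace i1, by the shear of P that replaces p2
  with p2 - p2 f p1. This matters because idempotents need not split in an additive category: a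
  general split monomorphism need not have a complement, but such an f has the complement B.
\<close>

lemma biproduct_change_mono:
  assumes b: "is_biproduct C A B P i1 i2 p1 p2"
    and f: "f \<in> mor C A P" "Comp C A P A p1 f = Ident C A"
  shows "\<exists>p2'. is_biproduct C A B P f i2 p1 p2'"
proof -
  note [simp] = biproductD[OF b] biproduct_reassoc[OF b] f Comp_eq_Comp[OF f(2)]
  have "Comp C P A P f p1 \<otimes>\<^bsub>Hom C P P\<^esub>
      Comp C P B P i2 (diff P B p2 (Comp C P P B p2 (Comp C P A P f p1))) = Ident C P"
    by (rule biproduct_in_eqI[OF b, where W = P]) simp_all
  then have "is_biproduct C A B P f i2 p1 (diff P B p2 (Comp C P P B p2 (Comp C P A P f p1)))"
    unfolding is_biproduct_def by simp
  then show ?thesis by blast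
qed

text \<open>
  The dual shear: a retraction g of i2 can replace p2 if i1 is replaced with i1 - i2 g i1.
\<close>

lemma biproduct_change_epi:
  assumes b: "is_biproduct C A B P i1 i2 p1 p2"
    and g: "g \<in> mor C P B" "Comp C B P B g i2 = Ident C B"
  shows "\<exists>i1'. is_biproduct C A B P i1' i2 p1 g"
proof -
  note [simp] = biproductD[OF b] biproduct_reassoc[OF b] g Comp_eq_Comp[OF g(2)]
  have "Comp C P A P (diff A P i1 (Comp C A B P i2 (Comp C A P B g i1))) p1 \<otimes>\<^bsub>Hom C P P\<^esub>
      Comp C P B P i2 g = Ident C P"
    by (rule biproduct_out_eqI[OF b, where W = P]) simp_all
  then have "is_biproduct C A B P (diff A P i1 (Comp C A B P i2 (Comp C A P B g i1))) i2 p1 g"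
    unfolding is_biproduct_def by simp
  then show ?thesis by blast
qed

lemma biproduct_with_zero:
  assumes "is_zero_object C Z" "X \<in> Obj C"
  shows "is_biproduct C X Z X (Ident C X) (zero_mor C Z X) (Ident C X) (zero_mor C X Z)"
  using zero_object_in(1)[OF assms] zero_object_Ident[OF assms(1)] assms(2)
  unfolding is_biproduct_def by simp

text \<open>
  Biproducts over an arbitrary finite index set. For N-complexes the index set is an interval of
  degrees, so that summands are named by their absolute degree.
\<close>

definition is_finite_biproduct ::
    "'i set \<Rightarrow> ('i \<Rightarrow> 'o) \<Rightarrow> 'o \<Rightarrow> ('i \<Rightarrow> 'm) \<Rightarrow> ('i \<Rightarrow> 'm) \<Rightarrow> bool" where
  "is_finite_biproduct K A P \<iota> p \<longleftrightarrow> finite K \<and> P \<in> Obj C \<and>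
     (\<forall>k\<in>K. A k \<in> Obj C \<and> \<iota> k \<in> mor C (A k) P \<and> p k \<in> mor C P (A k)) \<and>
     (\<forall>k\<in>K. \<forall>l\<in>K. Comp C (A l) P (A k) (p k) (\<iota> l)
        = (if l = k then Ident C (A k) else zero_mor C (A l) (A k))) \<and>
     finprod (Hom C P P) (\<lambda>k. Comp C P (A k) P (\<iota> k) (p k)) K = Ident C P"

lemma finite_biproductD:
  assumes "is_finite_biproduct K A P \<iota> p"
  shows "finite K" "P \<in> Obj C" "k \<in> K \<Longrightarrow> A k \<in> Obj C"
    and "k \<in> K \<Longrightarrow> \<iota> k \<in> mor C (A k) P" "k \<in> K \<Longrightarrow> p k \<in> mor C P (A k)"
    and "k \<in> K \<Longrightarrow> l \<in> K \<Longrightarrow> Comp C (A l) P (A k) (p k) (\<iota> l)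
        = (if l = k then Ident C (A k) else zero_mor C (A l) (A k))"
    and "finprod (Hom C P P) (\<lambda>k. Comp C P (A k) P (\<iota> k) (p k)) K = Ident C P"
  using assms unfolding is_finite_biproduct_def by blast+

lemma finite_biproduct_expand:
  assumes "is_finite_biproduct K A P \<iota> p" "W \<in> Obj C" "V \<in> Obj C"
    and "f \<in> mor C W P" "g \<in> mor C P V"
  shows "Comp C W P V g f
    = finprod (Hom C W V) (\<lambda>k. Comp C W (A k) V (Comp C (A k) P V g (\<iota> k)) (Comp C W P (A k) (p k) f)) K"
proof -
  note b = finite_biproductD[OF assms(1)]
  note [simp] = b(1-5) assms(2-5)
  have "Comp C W P V g f
      = Comp C W P V g (Comp C W P P (finprod (Hom C P P) (\<lambda>k. Comp C P (A k) P (\<iota> k) (p k)) K) f)"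
    by (simp add: b(7))
  also have "Comp C W P P (finprod (Hom C P P) (\<lambda>k. Comp C P (A k) P (\<iota> k) (p k)) K) f
      = finprod (Hom C W P) (\<lambda>k. Comp C W P P (Comp C P (A k) P (\<iota> k) (p k)) f) K"
    by (rule Comp_finprod_left) simp_all
  also have "Comp C W P V g \<dots>
      = finprod (Hom C W V) (\<lambda>k. Comp C W P V g (Comp C W P P (Comp C P (A k) P (\<iota> k) (p k)) f)) K"
    by (rule Comp_finprod_right) simp_all
  also have "\<dots> = finprod (Hom C W V)
      (\<lambda>k. Comp C W (A k) V (Comp C (A k) P V g (\<iota> k)) (Comp C W P (A k) (p k) f)) K"
    by (rule finprod_eqI) simp_all
  finally show ?thesis .
qed

lemma finite_biproduct_in_eqI:
  assumes b: "is_finite_biproduct K A P \<iota> p" and W: "W \<in> Obj C"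
    and "f \<in> mor C W P" "g \<in> mor C W P"
    and e: "\<And>k. k \<in> K \<Longrightarrow> Comp C W P (A k) (p k) f = Comp C W P (A k) (p k) g"
  shows "f = g"
proof -
  note [simp] = finite_biproductD(1-5)[OF b] assms(2-4)
  let ?S = "\<lambda>h. finprod (Hom C W P) (\<lambda>k. Comp C W (A k) P (\<iota> k) (Comp C W P (A k) (p k) h)) K"
  have S: "finprod (Hom C W P)
      (\<lambda>k. Comp C W (A k) P (Comp C (A k) P P (Ident C P) (\<iota> k)) (Comp C W P (A k) (p k) h)) K = ?S h"
    if "h \<in> mor C W P" for h
    using that by (intro finprod_eqI) simp_all
  have expand: "h = ?S h" if "h \<in> mor C W P" for h
    using finite_biproduct_expand[OF b W _ that, of P "Ident C P"] that S[OF that] by simp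
  have "f = ?S f" by (rule expand) simp
  also have "\<dots> = ?S g"
    by (rule finprod_eqI) (simp_all add: e)
  also have "\<dots> = g" by (rule expand[symmetric]) simp
  finally show ?thesis .
qed

lemma finite_biproduct_out_eqI:
  assumes b: "is_finite_biproduct K A P \<iota> p" and W: "W \<in> Obj C"
    and "f \<in> mor C P W" "g \<in> mor C P W"
    and e: "\<And>k. k \<in> K \<Longrightarrow> Comp C (A k) P W f (\<iota> k) = Comp C (A k) P W g (\<iota> k)"
  shows "f = g"
proof -
  note [simp] = finite_biproductD(1-5)[OF b] assms(2-4)
  let ?S = "\<lambda>h. finprod (Hom C P W) (\<lambda>k. Comp C P (A k) W (Comp C (A k) P W h (\<iota> k)) (p k)) K"
  have S: "finprod (Hom C P W)
      (\<lambda>k. Comp C P (A k) W (Comp C (A k) P W h (\<iota> k)) (Comp C P P (A k) (p k) (Ident C P))) K = ?S h"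
    if "h \<in> mor C P W" for h
    using that by (intro finprod_eqI) simp_all
  have expand: "h = ?S h" if "h \<in> mor C P W" for h
    using finite_biproduct_expand[OF b _ W _ that, of P "Ident C P"] that S[OF that] by simp
  have "f = ?S f" by (rule expand) simp
  also have "\<dots> = ?S g"
    by (rule finprod_eqI) (simp_all add: e del: Comp_assoc)
  also have "\<dots> = g" by (rule expand[symmetric]) simp
  finally show ?thesis .
qed

lemma finite_biproduct_in:
  assumes b: "is_finite_biproduct K A P \<iota> p" and W: "W \<in> Obj C"
    and f: "\<And>k. k \<in> K \<Longrightarrow> f k \<in> mor C W (A k)"
  obtains h where "h \<in> mor C W P" "\<And>k. k \<in> K \<Longrightarrow> Comp C W P (A k) (p k) h = f k"
proof
  note [simp] = finite_biproductD(1-5)[OF b] W f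
  let ?h = "finprod (Hom C W P) (\<lambda>l. Comp C W (A l) P (\<iota> l) (f l)) K"
  show "?h \<in> mor C W P" by simp
  fix k assume k [simp]: "k \<in> K"
  have "Comp C W P (A k) (p k) ?h
      = finprod (Hom C W (A k)) (\<lambda>l. Comp C W P (A k) (p k) (Comp C W (A l) P (\<iota> l) (f l))) K"
    by (rule Comp_finprod_right) simp_all
  also have "\<dots> = Comp C W P (A k) (p k) (Comp C W (A k) P (\<iota> k) (f k))"
    by (rule finprod_delta) (simp_all add: Comp_eq_Comp[OF finite_biproductD(6)[OF b]])
  finally show "Comp C W P (A k) (p k) ?h = f k"
    by (simp add: Comp_eq_Comp[OF finite_biproductD(6)[OF b]])
qed

lemma finite_biproduct_out:
  assumes b: "is_finite_biproduct K A P \<iota> p" and W: "W \<in> Obj C"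
    and f: "\<And>k. k \<in> K \<Longrightarrow> f k \<in> mor C (A k) W"
  obtains h where "h \<in> mor C P W" "\<And>k. k \<in> K \<Longrightarrow> Comp C (A k) P W h (\<iota> k) = f k"
proof
  note [simp] = finite_biproductD(1-5)[OF b] W f
  let ?h = "finprod (Hom C P W) (\<lambda>l. Comp C P (A l) W (f l) (p l)) K"
  show "?h \<in> mor C P W" by simp
  fix k assume k [simp]: "k \<in> K"
  have "Comp C (A k) P W ?h (\<iota> k)
      = finprod (Hom C (A k) W) (\<lambda>l. Comp C (A k) P W (Comp C P (A l) W (f l) (p l)) (\<iota> k)) K"
    by (rule Comp_finprod_left) simp_all
  also have "\<dots> = Comp C (A k) P W (Comp C P (A k) W (f k) (p k)) (\<iota> k)"
    by (rule finprod_delta) (auto simp add: finite_biproductD(6)[OF b])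
  finally show "Comp C (A k) P W ?h (\<iota> k) = f k"
    by (simp add: finite_biproductD(6)[OF b])
qed

end

context additive_category
begin

text \<open>
  The complement of a composite of two inclusions of summands is the sum of the two complements. The
  conclusion exhibits the composite of the inclusions and the composite of the projections at once;
  after exchanging summands it therefore serves for epimorphisms as well.
\<close>

lemma biproduct_Comp:
  assumes b: "is_biproduct C X W Y f s r g" and b': "is_biproduct C Y V Z f' s' r' g'"
  shows "\<exists>U s'' g''. is_biproduct C X U Z (Comp C X Y Z f' f) s'' (Comp C Z Y X r r') g''"
proof -
  obtain U j1 j2 q1 q2 where u: "is_biproduct C W V U j1 j2 q1 q2"
    using biproducts[OF biproductD(2)[OF b] biproductD(2)[OF b']] by blast
  note [simp] = biproductD[OF b] biproductD[OF b'] biproductD[OF u]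
    biproduct_reassoc[OF b] biproduct_reassoc[OF b'] biproduct_reassoc[OF u]
  let ?s = "Comp C U W Z (Comp C W Y Z f' s) q1 \<otimes>\<^bsub>Hom C U Z\<^esub> Comp C U V Z s' q2"
  let ?g = "Comp C Z W U j1 (Comp C Z Y W g r') \<otimes>\<^bsub>Hom C Z U\<^esub> Comp C Z V U j2 g'"
  have "Comp C Z X Z (Comp C X Y Z f' f) (Comp C Z Y X r r') \<otimes>\<^bsub>Hom C Z Z\<^esub> Comp C Z U Z ?s ?g = Ident C Z"
  proof (rule biproduct_in_eqI[OF b', where W = Z])
    show "Comp C Z Z Y r' (Comp C Z X Z (Comp C X Y Z f' f) (Comp C Z Y X r r') \<otimes>\<^bsub>Hom C Z Z\<^esub> Comp C Z U Z ?s ?g)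
      = Comp C Z Z Y r' (Ident C Z)"
      by simp
  qed simp_all
  then have "is_biproduct C X U Z (Comp C X Y Z f' f) ?s (Comp C Z Y X r r') ?g"
    unfolding is_biproduct_def by simp
  then show ?thesis by blast
qed

lemma finite_biproduct_exists:
  assumes "finite K" "\<And>k. k \<in> K \<Longrightarrow> A k \<in> Obj C"
  obtains P \<iota> p where "is_finite_biproduct K A P \<iota> p"
proof -
  have "\<exists>P \<iota> p. is_finite_biproduct K A P \<iota> p"
    using assms
  proof (induction K rule: finite_induct)
    case empty
    obtain Z where Z: "is_zero_object C Z" using zero_object by blast
    then have "is_finite_biproduct {} A Z \<iota> p" for \<iota> p
      using Hom_group[of Z Z] zero_object_Ident[OF Z]
      unfolding is_finite_biproduct_def comm_group_def
      by (simp add: comm_monoid.finprod_empty is_zero_object_def)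
    then show ?case by blast
  next
    case (insert l K)
    then obtain Q \<iota> p where b: "is_finite_biproduct K A Q \<iota> p" by auto
    have Al [simp]: "A l \<in> Obj C" using insert by simp
    obtain P i1 i2 p1 p2 where c: "is_biproduct C Q (A l) P i1 i2 p1 p2"
      using biproducts[OF finite_biproductD(2)[OF b] Al] by blast
    note [simp] = finite_biproductD(1-5)[OF b] biproductD[OF c] biproduct_reassoc[OF c]
    let ?\<iota> = "\<lambda>k. if k = l then i2 else Comp C (A k) Q P i1 (\<iota> k)"
    let ?p = "\<lambda>k. if k = l then p2 else Comp C P Q (A k) (p k) p1"
    have ne: "k \<noteq> l" if "k \<in> K" for k using insert that by blast
    interpret PP: comm_group "Hom C P P" by (rule Hom_group) simp_all
    have "finprod (Hom C P P) (\<lambda>k. Comp C P (A k) P (?\<iota> k) (?p k)) K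
        = finprod (Hom C P P) (\<lambda>k. Comp C P (A k) P (Comp C (A k) Q P i1 (\<iota> k)) (Comp C P Q (A k) (p k) p1)) K"
      by (rule finprod_eqI) (simp_all add: ne)
    also have "\<dots> = Comp C P Q P i1 p1"
      using finite_biproduct_expand[OF b, of P P p1 i1] by simp
    finally have "finprod (Hom C P P) (\<lambda>k. Comp C P (A k) P (?\<iota> k) (?p k)) (insert l K) = Ident C P"
      using insert(1,2) biproductD(12)[OF biproduct_swap[OF c]] by (subst PP.finprod_insert) (auto simp: ne)
    then have "is_finite_biproduct (insert l K) A P ?\<iota> ?p"
      unfolding is_finite_biproduct_def using insert(1,4) ne
      by (auto simp: finite_biproductD(6)[OF b] Comp_eq_Comp[OF finite_biproductD(6)[OF b]])
    then show ?case by blast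
  qed
  then show ?thesis using that by blast
qed

text \<open>
  The complement of one summand is a biproduct W of the others. The maps between W and P are
  determined by their components, and all equations are checked on components.
\<close>

lemma finite_biproduct_summand:
  assumes b: "is_finite_biproduct K A P \<iota> p" and k: "k \<in> K"
  obtains W s g where "is_biproduct C (A k) W P (\<iota> k) s (p k) g"
proof -
  note bs = finite_biproductD(1-5)[OF b]
  note eq = finite_biproductD(6)[OF b]
  obtain W \<iota>' p' where b': "is_finite_biproduct (K - {k}) A W \<iota>' p'"
    using finite_biproduct_exists[of "K - {k}" A] bs by auto
  note bs' = finite_biproductD(1-5)[OF b']
  note eq' = finite_biproductD(6)[OF b']
  note [simp] = bs bs' k
  obtain s where s: "s \<in> mor C W P" "\<And>l. l \<in> K - {k} \<Longrightarrow> Comp C (A l) W P s (\<iota>' l) = \<iota> l"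
    using finite_biproduct_out[OF b', of P \<iota>] by auto
  obtain g where g: "g \<in> mor C P W" "\<And>l. l \<in> K - {k} \<Longrightarrow> Comp C P W (A l) (p' l) g = p l"
    using finite_biproduct_in[OF b', of P p] by auto
  note [simp] = s(1) g(1) s(2) g(2) Comp_eq_Comp[OF s(2)] Comp_eq_Comp[OF g(2)]
  have gs: "Comp C W P W g s = Ident C W"
  proof (rule finite_biproduct_out_eqI[OF b', where W = W])
    fix l assume l: "l \<in> K - {k}"
    show "Comp C (A l) W W (Comp C W P W g s) (\<iota>' l) = Comp C (A l) W W (Ident C W) (\<iota>' l)"
      by (rule finite_biproduct_in_eqI[OF b', where W = "A l"]) (use l in \<open>simp_all add: eq eq'\<close>)
  qed simp_all
  have ps: "Comp C W P (A k) (p k) s = zero_mor C W (A k)"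
    by (rule finite_biproduct_out_eqI[OF b', where W = "A k"]) (auto simp add: eq)
  have g\<iota>: "Comp C (A k) P W g (\<iota> k) = zero_mor C (A k) W"
    by (rule finite_biproduct_in_eqI[OF b', where W = "A k"]) (auto simp add: eq)
  have g\<iota>': "Comp C (A l) P W g (\<iota> l) = \<iota>' l" if "l \<in> K - {k}" for l
    by (rule finite_biproduct_in_eqI[OF b', where W = "A l"]) (use that in \<open>auto simp add: eq eq'\<close>)
  have "Comp C P (A k) P (\<iota> k) (p k) \<otimes>\<^bsub>Hom C P P\<^esub> Comp C P W P s g = Ident C P"
  proof (rule finite_biproduct_out_eqI[OF b, where W = P])
    fix l assume l: "l \<in> K"
    show "Comp C (A l) P P (Comp C P (A k) P (\<iota> k) (p k) \<otimes>\<^bsub>Hom C P P\<^esub> Comp C P W P s g) (\<iota> l)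
      = Comp C (A l) P P (Ident C P) (\<iota> l)"
      using l by (cases "l = k") (auto simp add: eq g\<iota> g\<iota>')
  qed simp_all
  then have "is_biproduct C (A k) W P (\<iota> k) s (p k) g"
    unfolding is_biproduct_def using eq[OF k k] by (simp add: gs ps g\<iota>)
  then show ?thesis by (rule that)
qed

end

section \<open>Quotients by ideals of morphisms\<close>

locale hom_ideal = preadditive_category C for C :: "('o, 'm) precat" +
  fixes J :: "'o \<Rightarrow> 'o \<Rightarrow> 'm set"
  assumes ideal_subgroup: "\<lbrakk>X \<in> Obj C; Y \<in> Obj C\<rbrakk> \<Longrightarrow> subgroup (J X Y) (Hom C X Y)"
    and ideal_Comp_left: "\<lbrakk>X \<in> Obj C; Y \<in> Obj C; Z \<in> Obj C; f \<in> J X Y; g \<in> mor C Y Z\<rbrakk>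
      \<Longrightarrow> Comp C X Y Z g f \<in> J X Z"
    and ideal_Comp_right: "\<lbrakk>X \<in> Obj C; Y \<in> Obj C; Z \<in> Obj C; f \<in> mor C X Y; g \<in> J Y Z\<rbrakk>
      \<Longrightarrow> Comp C X Y Z g f \<in> J X Z"
begin

abbreviation Q :: "('o, 'm set) precat" where "Q \<equiv> quotient_category C J"

abbreviation cls :: "'o \<Rightarrow> 'o \<Rightarrow> 'm \<Rightarrow> 'm set" where "cls \<equiv> mor_class C J"

lemma ideal_zero: "\<lbrakk>X \<in> Obj C; Y \<in> Obj C\<rbrakk> \<Longrightarrow> zero_mor C X Y \<in> J X Y"
  using ideal_subgroup subgroup.one_closed by metis

lemma Obj_quotient [simp]: "Obj Q = Obj C"
  by (simp add: quotient_category_def)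

lemma mor_quotient:
  "mor Q X Y = cls X Y ` mor C X Y"
  by (simp add: quotient_category_def mor_class_def carrier_FactGroup)

lemma cls_in [simp]: "f \<in> mor C X Y \<Longrightarrow> cls X Y f \<in> mor Q X Y"
  by (simp add: mor_quotient)

lemma mor_quotientE:
  assumes "F \<in> mor Q X Y"
  obtains f where "f \<in> mor C X Y" "F = cls X Y f"
  using assms by (auto simp: mor_quotient)

lemma mem_cls_iff:
  assumes "X \<in> Obj C" "Y \<in> Obj C" "f \<in> mor C X Y"
  shows "g \<in> cls X Y f \<longleftrightarrow> g \<in> mor C X Y \<and> diff X Y g f \<in> J X Y"
proof -
  interpret subgroup "J X Y" "Hom C X Y" using ideal_subgroup assms by blast
  interpret comm_group "Hom C X Y" using Hom_group assms by blast
  show ?thesis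
    unfolding mor_class_def diff_def
    using rcos_module[OF is_group assms(3)] elemrcos_carrier[OF is_group assms(3)] by blast
qed

lemma cls_self: "\<lbrakk>X \<in> Obj C; Y \<in> Obj C; f \<in> mor C X Y\<rbrakk> \<Longrightarrow> f \<in> cls X Y f"
  by (simp add: mem_cls_iff ideal_zero)

lemma cls_eq_iff:
  assumes "X \<in> Obj C" "Y \<in> Obj C" "f \<in> mor C X Y" "g \<in> mor C X Y"
  shows "cls X Y f = cls X Y g \<longleftrightarrow> diff X Y f g \<in> J X Y"
proof -
  interpret subgroup "J X Y" "Hom C X Y" using ideal_subgroup assms by blast
  interpret comm_group "Hom C X Y" using Hom_group assms by blast
  show ?thesis
    using mem_cls_iff[OF assms(1,2,4), of f] cls_self[OF assms(1-3)] assms(3,4)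
      repr_independence[OF _ assms(4), of f "J X Y"] subgroup_axioms
    unfolding mor_class_def by blast
qed

lemma Ident_quotient [simp]: "Ident Q X = cls X X (Ident C X)"
  by (simp add: quotient_category_def)

lemma zero_quotient [simp]:
  assumes "X \<in> Obj C" "Y \<in> Obj C"
  shows "zero_mor Q X Y = cls X Y (zero_mor C X Y)"
proof -
  interpret subgroup "J X Y" "Hom C X Y" using ideal_subgroup assms by blast
  interpret comm_group "Hom C X Y" using Hom_group assms by blast
  show ?thesis
    by (simp add: quotient_category_def mor_class_def rcos_const[OF is_group ideal_zero[OF assms]])
qed

lemma add_quotient [simp]:
  assumes "X \<in> Obj C" "Y \<in> Obj C" "f \<in> mor C X Y" "g \<in> mor C X Y"
  shows "cls X Y f \<otimes>\<^bsub>Hom Q X Y\<^esub> cls X Y g = cls X Y (f \<otimes>\<^bsub>Hom C X Y\<^esub> g)"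
proof -
  interpret comm_group "Hom C X Y" using Hom_group assms by blast
  interpret normal "J X Y" "Hom C X Y"
    using ideal_subgroup[OF assms(1,2)] by (rule subgroup_imp_normal)
  show ?thesis
    using rcos_sum[OF assms(3,4)] by (simp add: quotient_category_def mor_class_def)
qed

text \<open>
  All terms of the union that defines the composite of two cosets agree, because
  g' f' - g f = g' (f' - f) + (g' - g) f lies in the ideal.
\<close>

lemma Comp_quotient [simp]:
  assumes "X \<in> Obj C" "Y \<in> Obj C" "Z \<in> Obj C" "f \<in> mor C X Y" "g \<in> mor C Y Z"
  shows "Comp Q X Y Z (cls Y Z g) (cls X Y f) = cls X Z (Comp C X Y Z g f)"
proof -
  have "cls X Z (Comp C X Y Z g' f') = cls X Z (Comp C X Y Z g f)"
    if "g' \<in> cls Y Z g" "f' \<in> cls X Y f" for g' f'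
  proof -
    interpret subgroup "J X Z" "Hom C X Z" using ideal_subgroup assms by blast
    have g': "g' \<in> mor C Y Z" "diff Y Z g' g \<in> J Y Z" and f': "f' \<in> mor C X Y" "diff X Y f' f \<in> J X Y"
      using that assms by (simp_all add: mem_cls_iff)
    have "diff X Z (Comp C X Y Z g' f') (Comp C X Y Z g f)
        = Comp C X Y Z g' (diff X Y f' f) \<otimes>\<^bsub>Hom C X Z\<^esub> Comp C X Y Z (diff Y Z g' g) f"
      using assms g'(1) f'(1) by (simp add: diff_def add_ac)
    also have "\<dots> \<in> J X Z"
      using assms g' f' by (intro m_closed ideal_Comp_left ideal_Comp_right)
    finally show ?thesis
      using assms g'(1) f'(1) by (simp add: cls_eq_iff)
  qed
  then have "(\<Union>g'\<in>cls Y Z g. \<Union>f'\<in>cls X Y f. cls X Z (Comp C X Y Z g' f'))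
      = (\<Union>g'\<in>cls Y Z g. \<Union>f'\<in>cls X Y f. cls X Z (Comp C X Y Z g f))"
    by (intro SUP_cong refl)
  also have "\<dots> = cls X Z (Comp C X Y Z g f)"
    using cls_self[OF assms(1,2,4)] cls_self[OF assms(2,3,5)] by blast
  finally show ?thesis
    by (simp add: quotient_category_def)
qed

lemma preadditive_quotient: "preadditive_category Q"
proof (intro preadditive_category.intro category.intro preadditive_category_axioms.intro)
  fix X assume "X \<in> Obj Q"
  then show "Ident Q X \<in> mor Q X X" by simp
next
  fix X Y Z F G
  assume "X \<in> Obj Q" "Y \<in> Obj Q" "Z \<in> Obj Q" "F \<in> mor Q X Y" "G \<in> mor Q Y Z"
  then show "Comp Q X Y Z G F \<in> mor Q X Z"
    by (auto elim!: mor_quotientE)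
next
  fix W X Y Z F G H
  assume "W \<in> Obj Q" "X \<in> Obj Q" "Y \<in> Obj Q" "Z \<in> Obj Q" "F \<in> mor Q W X" "G \<in> mor Q X Y" "H \<in> mor Q Y Z"
  then show "Comp Q W X Z (Comp Q X Y Z H G) F = Comp Q W Y Z H (Comp Q W X Y G F)"
    by (auto elim!: mor_quotientE)
next
  fix X Y F assume "X \<in> Obj Q" "Y \<in> Obj Q" "F \<in> mor Q X Y"
  then show "Comp Q X Y Y (Ident Q Y) F = F" "Comp Q X X Y F (Ident Q X) = F"
    by (auto elim!: mor_quotientE)
next
  fix X Y assume "X \<in> Obj Q" "Y \<in> Obj Q"
  then show "comm_group (Hom Q X Y)"
    using comm_group.abelian_FactGroup[OF Hom_group ideal_subgroup]
    by (simp add: quotient_category_def)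
next
  fix X Y Z F G G'
  assume "X \<in> Obj Q" "Y \<in> Obj Q" "Z \<in> Obj Q" "F \<in> mor Q X Y" "G \<in> mor Q Y Z" "G' \<in> mor Q Y Z"
  then show "Comp Q X Y Z (G \<otimes>\<^bsub>Hom Q Y Z\<^esub> G') F
      = Comp Q X Y Z G F \<otimes>\<^bsub>Hom Q X Z\<^esub> Comp Q X Y Z G' F"
    by (auto elim!: mor_quotientE)
next
  fix X Y Z F F' G
  assume "X \<in> Obj Q" "Y \<in> Obj Q" "Z \<in> Obj Q" "F \<in> mor Q X Y" "F' \<in> mor Q X Y" "G \<in> mor Q Y Z"
  then show "Comp Q X Y Z G (F \<otimes>\<^bsub>Hom Q X Y\<^esub> F')
      = Comp Q X Y Z G F \<otimes>\<^bsub>Hom Q X Z\<^esub> Comp Q X Y Z G F'"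
    by (auto elim!: mor_quotientE)
qed

sublocale Q: preadditive_category Q
  by (rule preadditive_quotient)

lemma neg_quotient [simp]:
  assumes "X \<in> Obj C" "Y \<in> Obj C" "f \<in> mor C X Y"
  shows "inv\<^bsub>Hom Q X Y\<^esub> (cls X Y f) = cls X Y (inv\<^bsub>Hom C X Y\<^esub> f)"
  by (rule Q.neg_eqI) (use assms in simp_all)

lemma is_iso_clsI:
  assumes "X \<in> Obj C" "Y \<in> Obj C" "f \<in> mor C X Y" "g \<in> mor C Y X"
    and "diff X X (Comp C X Y X g f) (Ident C X) \<in> J X X"
    and "diff Y Y (Comp C Y X Y f g) (Ident C Y) \<in> J Y Y"
  shows "is_iso Q X Y (cls X Y f)"
  by (rule Q.is_isoI[where g = "cls Y X g"]) (use assms in \<open>simp_all add: cls_eq_iff\<close>)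

end

locale additive_hom_ideal = additive_category C + hom_ideal C J for C :: "('o, 'm) precat" and J
begin

lemma zero_object_quotient:
  assumes "is_zero_object C Z"
  shows "is_zero_object Q Z"
  using assms zero_object_Ident[OF assms]
  by (intro Q.zero_objectI) (auto simp: is_zero_object_def)

lemma biproduct_quotient:
  assumes "is_biproduct C A B P i1 i2 p1 p2"
  shows "is_biproduct Q A B P (cls A P i1) (cls B P i2) (cls P A p1) (cls P B p2)"
  using biproductD[OF assms] unfolding is_biproduct_def by simp

sublocale Q: additive_category Q
proof
  show "\<exists>Z. is_zero_object Q Z"
    using zero_object zero_object_quotient by blast
  show "\<exists>P i1 i2 p1 p2. is_biproduct Q A B P i1 i2 p1 p2" if "A \<in> Obj Q" "B \<in> Obj Q" for A B
    using biproducts[of A B] that biproduct_quotient by fastforce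
qed

end

section \<open>The additive category of N-complexes\<close>

locale additive_complexes = additive_category B for B :: "('o, 'm) precat" +
  fixes N :: nat
  assumes N_pos: "0 < N"
begin

abbreviation CN :: "(('o, 'm) ncomplex, int \<Rightarrow> 'm) precat" where
  "CN \<equiv> ncomplex_category N B"

abbreviation SN :: "(('o, 'm) ncomplex, int \<Rightarrow> 'm) ses set" where
  "SN \<equiv> degreewise_split N B"

text \<open>
  An N-complex before the condition on N-fold composites of differentials has been verified.
\<close>

definition is_sequence :: "('o, 'm) ncomplex \<Rightarrow> bool" where
  "is_sequence X \<longleftrightarrow> (\<forall>i. cobj X i \<in> Obj B \<and> cdiff X i \<in> mor B (cobj X i) (cobj X (i + 1)))"

text \<open>
  The composite of the differentials from degree i to degree j. Naming both end degrees, rather than a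
  start and a length, makes equal composites have syntactically equal source and target.
\<close>

definition dpath :: "('o, 'm) ncomplex \<Rightarrow> int \<Rightarrow> int \<Rightarrow> 'm" where
  "dpath X i j = cdiff_pow B X i (nat (j - i))"

lemma sequence_in [simp]:
  assumes "is_sequence X"
  shows "cobj X i \<in> Obj B" "cdiff X i \<in> mor B (cobj X i) (cobj X (i + 1))"
  using assms by (simp_all add: is_sequence_def)

lemma is_sequenceI:
  assumes "\<And>i. cobj X i \<in> Obj B" "\<And>i. cdiff X i \<in> mor B (cobj X i) (cobj X (i + 1))"
  shows "is_sequence X"
  unfolding is_sequence_def using assms by blast

lemma dpath_self [simp]: "dpath X i i = Ident B (cobj X i)"
  by (simp add: dpath_def)

lemma dpath_step:
  assumes "i \<le> j"
  shows "dpath X i (j + 1) = Comp B (cobj X i) (cobj X j) (cobj X (j + 1)) (cdiff X j) (dpath X i j)"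
proof -
  have "nat (j + 1 - i) = Suc (nat (j - i))" "i + int (nat (j - i)) = j"
    using assms by simp_all
  then show ?thesis by (simp add: dpath_def)
qed

lemma dpath_in [simp]:
  assumes "is_sequence X" "i \<le> j"
  shows "dpath X i j \<in> mor B (cobj X i) (cobj X j)"
  using assms(2) by (induction rule: int_ge_induct) (simp_all add: assms(1) dpath_step)

lemma dpath_step':
  assumes "is_sequence X" "i + 1 \<le> j"
  shows "Comp B (cobj X i) (cobj X (i + 1)) (cobj X j) (dpath X (i + 1) j) (cdiff X i) = dpath X i j"
  using assms(2) by (induction rule: int_ge_induct) (use assms(1) in \<open>simp_all add: dpath_step\<close>)

lemma is_ncomplex_iff:
  "is_ncomplex N B X \<longleftrightarrow> is_sequence X \<and>
     (\<forall>i. dpath X i (i + int N) = zero_mor B (cobj X i) (cobj X (i + int N)))"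
  unfolding is_ncomplex_def is_sequence_def dpath_def by (simp add: all_conj_distrib del: sequence_in)

lemma ncomplex_sequence [simp]: "is_ncomplex N B X \<Longrightarrow> is_sequence X"
  unfolding is_ncomplex_iff by blast

lemma dpath_zero:
  assumes "is_ncomplex N B X" "i + int N \<le> j"
  shows "dpath X i j = zero_mor B (cobj X i) (cobj X j)"
  using assms(2)
proof (induction rule: int_ge_induct)
  case base
  show ?case using assms(1) unfolding is_ncomplex_iff by blast
next
  case (step j)
  then show ?case using assms(1) by (simp add: dpath_step)
qed

lemma chain_map_in [simp]:
  "is_chain_map B X Y f \<Longrightarrow> f i \<in> mor B (cobj X i) (cobj Y i)"
  by (simp add: is_chain_map_def)

lemma chain_map_comm:
  "is_chain_map B X Y f \<Longrightarrow>
   Comp B (cobj X i) (cobj X (i + 1)) (cobj Y (i + 1)) (f (i + 1)) (cdiff X i)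
   = Comp B (cobj X i) (cobj Y i) (cobj Y (i + 1)) (cdiff Y i) (f i)"
  unfolding is_chain_map_def by blast

lemma chain_map_comm':
  "\<lbrakk>is_chain_map B X Y f; is_sequence X; is_sequence Y; W \<in> Obj B; k \<in> mor B W (cobj X i)\<rbrakk> \<Longrightarrow>
   Comp B W (cobj X (i + 1)) (cobj Y (i + 1)) (f (i + 1))
     (Comp B W (cobj X i) (cobj X (i + 1)) (cdiff X i) k)
   = Comp B W (cobj Y i) (cobj Y (i + 1)) (cdiff Y i) (Comp B W (cobj X i) (cobj Y i) (f i) k)"
  by (simp add: Comp_eq_Comp[OF chain_map_comm])

lemma chain_map_dpath:
  assumes "is_chain_map B X Y f" "is_sequence X" "is_sequence Y" "i \<le> j"
  shows "Comp B (cobj X i) (cobj X j) (cobj Y j) (f j) (dpath X i j)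
    = Comp B (cobj X i) (cobj Y i) (cobj Y j) (dpath Y i j) (f i)"
  using assms(4)
  by (induction rule: int_ge_induct) (use assms(1-3) in \<open>simp_all add: dpath_step chain_map_comm'\<close>)

lemma chain_mapI:
  assumes "\<And>i. f i \<in> mor B (cobj X i) (cobj Y i)"
    and "\<And>i. Comp B (cobj X i) (cobj X (i + 1)) (cobj Y (i + 1)) (f (i + 1)) (cdiff X i)
      = Comp B (cobj X i) (cobj Y i) (cobj Y (i + 1)) (cdiff Y i) (f i)"
  shows "is_chain_map B X Y f"
  unfolding is_chain_map_def using assms by blast

lemma CN_simps [simp]:
  "X \<in> Obj CN \<longleftrightarrow> is_ncomplex N B X"
  "f \<in> mor CN X Y \<longleftrightarrow> is_chain_map B X Y f"
  "zero_mor CN X Y = (\<lambda>i. zero_mor B (cobj X i) (cobj Y i))"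
  "f \<otimes>\<^bsub>Hom CN X Y\<^esub> f' = (\<lambda>i. f i \<otimes>\<^bsub>Hom B (cobj X i) (cobj Y i)\<^esub> f' i)"
  "Ident CN X = (\<lambda>i. Ident B (cobj X i))"
  "Comp CN X Y Z g h = (\<lambda>i. Comp B (cobj X i) (cobj Y i) (cobj Z i) (g i) (h i))"
  by (simp_all add: ncomplex_category_def)

lemma chain_map_zero:
  "is_sequence X \<Longrightarrow> is_sequence Y \<Longrightarrow> is_chain_map B X Y (\<lambda>i. zero_mor B (cobj X i) (cobj Y i))"
  by (rule chain_mapI) simp_all

lemma chain_map_add:
  "\<lbrakk>is_sequence X; is_sequence Y; is_chain_map B X Y f; is_chain_map B X Y g\<rbrakk>
   \<Longrightarrow> is_chain_map B X Y (\<lambda>i. f i \<otimes>\<^bsub>Hom B (cobj X i) (cobj Y i)\<^esub> g i)"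
  by (rule chain_mapI) (simp_all add: chain_map_comm)

lemma chain_map_neg:
  "\<lbrakk>is_sequence X; is_sequence Y; is_chain_map B X Y f\<rbrakk>
   \<Longrightarrow> is_chain_map B X Y (\<lambda>i. inv\<^bsub>Hom B (cobj X i) (cobj Y i)\<^esub> f i)"
  by (rule chain_mapI) (simp_all add: chain_map_comm)

lemma chain_map_Ident: "is_sequence X \<Longrightarrow> is_chain_map B X X (\<lambda>i. Ident B (cobj X i))"
  by (rule chain_mapI) simp_all

lemma chain_map_Comp:
  "\<lbrakk>is_sequence X; is_sequence Y; is_sequence Z; is_chain_map B X Y f; is_chain_map B Y Z g\<rbrakk>
   \<Longrightarrow> is_chain_map B X Z (\<lambda>i. Comp B (cobj X i) (cobj Y i) (cobj Z i) (g i) (f i))"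
  by (rule chain_mapI) (simp_all add: chain_map_comm chain_map_comm')

lemma preadditive_CN: "preadditive_category CN"
proof (intro preadditive_category.intro category.intro preadditive_category_axioms.intro)
  fix X Y assume "X \<in> Obj CN" "Y \<in> Obj CN"
  then have [simp]: "is_sequence X" "is_sequence Y" by simp_all
  show "comm_group (Hom CN X Y)"
  proof (rule comm_groupI)
    fix f assume "f \<in> mor CN X Y"
    then have f: "is_chain_map B X Y f" by simp
    show "\<exists>g\<in>mor CN X Y. g \<otimes>\<^bsub>Hom CN X Y\<^esub> f = zero_mor CN X Y"
      by (rule bexI[where x = "\<lambda>i. inv\<^bsub>Hom B (cobj X i) (cobj Y i)\<^esub> f i"])
        (use f in \<open>simp_all add: chain_map_neg\<close>)
  qed (simp_all add: chain_map_zero chain_map_add add_ac)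
qed (simp_all add: chain_map_Ident chain_map_Comp)

sublocale CN: preadditive_category CN
  by (rule preadditive_CN)

text \<open>
  N-fold composites of differentials vanish on P because they vanish after precomposition with two
  jointly epic families of maps from N-complexes. This is how all colimits below become N-complexes:
  objects and differentials come from universal properties in the base category.
\<close>

lemma ncomplex_from_quotients:
  assumes A: "is_ncomplex N B A" and A': "is_ncomplex N B A'" and P: "is_sequence P"
    and u: "is_chain_map B A P u" "is_chain_map B A' P u'"
    and epi: "\<And>i W h k. \<lbrakk>W \<in> Obj B; h \<in> mor B (cobj P i) W; k \<in> mor B (cobj P i) W;
        Comp B (cobj A i) (cobj P i) W h (u i) = Comp B (cobj A i) (cobj P i) W k (u i);
        Comp B (cobj A' i) (cobj P i) W h (u' i) = Comp B (cobj A' i) (cobj P i) W k (u' i)\<rbrakk> \<Longrightarrow> h = k"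
  shows "is_ncomplex N B P"
  unfolding is_ncomplex_iff
proof (intro conjI allI P)
  fix i
  note [simp] = A A' P u
  show "dpath P i (i + int N) = zero_mor B (cobj P i) (cobj P (i + int N))"
    by (rule epi[of "cobj P (i + int N)" _ i]) (simp_all add: dpath_zero flip: chain_map_dpath)
qed

text \<open>
  The dual principle, for jointly monic families, which handles limits.
\<close>

lemma ncomplex_from_subobjects:
  assumes A: "is_ncomplex N B A" and A': "is_ncomplex N B A'" and P: "is_sequence P"
    and u: "is_chain_map B P A u" "is_chain_map B P A' u'"
    and mono: "\<And>i W h k. \<lbrakk>W \<in> Obj B; h \<in> mor B W (cobj P i); k \<in> mor B W (cobj P i);
        Comp B W (cobj P i) (cobj A i) (u i) h = Comp B W (cobj P i) (cobj A i) (u i) k;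
        Comp B W (cobj P i) (cobj A' i) (u' i) h = Comp B W (cobj P i) (cobj A' i) (u' i) k\<rbrakk> \<Longrightarrow> h = k"
  shows "is_ncomplex N B P"
  unfolding is_ncomplex_iff
proof (intro conjI allI P)
  fix i
  note [simp] = A A' P u
  show "dpath P i (i + int N) = zero_mor B (cobj P i) (cobj P (i + int N))"
    by (rule mono[of "cobj P i" _ "i + int N"]) (simp_all add: dpath_zero chain_map_dpath)
qed

lemma zero_ncomplex:
  assumes "is_zero_object B Z"
  defines "E \<equiv> \<lparr>cobj = \<lambda>i. Z, cdiff = \<lambda>i. Ident B Z\<rparr>"
  shows "is_zero_object CN E"
proof -
  have Z [simp]: "Z \<in> Obj B" "Ident B Z = zero_mor B Z Z"
    using assms(1) zero_object_Ident by (auto simp: is_zero_object_def)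
  have "is_sequence E"
    by (rule is_sequenceI) (simp_all add: E_def)
  moreover have "h = zero_mor B Z W" if "h \<in> mor B Z W" "W \<in> Obj B" for h W
    using zero_object_in(3)[OF assms(1) that(2,1)] .
  ultimately have "is_ncomplex N B E"
    unfolding is_ncomplex_iff by (metis dpath_in E_def le_add_same_cancel1 ncomplex.select_convs(1) of_nat_0_le_iff sequence_in(1))
  then show ?thesis
    by (intro CN.zero_objectI) (simp_all add: E_def)
qed

lemma degreewise_biproduct:
  assumes "is_ncomplex N B X" "is_ncomplex N B Y" "is_ncomplex N B P"
    and "is_chain_map B X P i1" "is_chain_map B Y P i2" "is_chain_map B P X p1" "is_chain_map B P Y p2"
    and "\<And>i. is_biproduct B (cobj X i) (cobj Y i) (cobj P i) (i1 i) (i2 i) (p1 i) (p2 i)"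
  shows "is_biproduct CN X Y P i1 i2 p1 p2"
  using assms biproductD[OF assms(8)] unfolding is_biproduct_def[of CN] by simp

lemma additive_CN: "additive_category CN"
proof (intro additive_category.intro preadditive_CN additive_category_axioms.intro)
  show "\<exists>Z. is_zero_object CN Z"
    using zero_object zero_ncomplex by blast
  fix X Y assume XY: "X \<in> Obj CN" "Y \<in> Obj CN"
  have "\<exists>P i1 i2 p1 p2. is_biproduct B (cobj X i) (cobj Y i) P i1 i2 p1 p2" for i
    using XY by (intro biproducts) simp_all
  then obtain P i1 i2 p1 p2
    where b: "\<And>i. is_biproduct B (cobj X i) (cobj Y i) (P i) (i1 i) (i2 i) (p1 i) (p2 i)"
    by metis
  define D where "D i = Comp B (P i) (cobj X i) (P (i + 1))
        (Comp B (cobj X i) (cobj X (i + 1)) (P (i + 1)) (i1 (i + 1)) (cdiff X i)) (p1 i)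
      \<otimes>\<^bsub>Hom B (P i) (P (i + 1))\<^esub> Comp B (P i) (cobj Y i) (P (i + 1))
        (Comp B (cobj Y i) (cobj Y (i + 1)) (P (i + 1)) (i2 (i + 1)) (cdiff Y i)) (p2 i)" for i
  define Q where "Q = \<lparr>cobj = P, cdiff = D\<rparr>"
  have Q [simp]: "cobj Q i = P i" "cdiff Q i = D i" for i by (simp_all add: Q_def)
  have XY' [simp]: "is_ncomplex N B X" "is_ncomplex N B Y" using XY by simp_all
  note [simp] = biproductD[OF b] biproduct_reassoc[OF b]
  have sQ: "is_sequence Q"
    by (rule is_sequenceI) (simp_all add: D_def)
  have c: "is_chain_map B X Q i1" "is_chain_map B Y Q i2" "is_chain_map B Q X p1" "is_chain_map B Q Y p2"
    by (rule chain_mapI; simp add: D_def)+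
  have nQ: "is_ncomplex N B Q"
    by (rule ncomplex_from_quotients[OF XY' sQ c(1,2)]) (use biproduct_out_eqI[OF b] in simp)
  have "is_biproduct CN X Y Q i1 i2 p1 p2"
    by (rule degreewise_biproduct[OF XY' nQ c]) (simp add: b)
  then show "\<exists>P i1 i2 p1 p2. is_biproduct CN X Y P i1 i2 p1 p2" by blast
qed

sublocale CN: additive_category CN
  by (rule additive_CN)

end

section \<open>Pushouts and pullbacks\<close>

context category
begin

lemma pushoutD:
  assumes "is_pushout C X A Y P f a a' f'"
  shows "X \<in> Obj C" "A \<in> Obj C" "Y \<in> Obj C" "P \<in> Obj C"
    and "f \<in> mor C X A" "a \<in> mor C X Y" "a' \<in> mor C A P" "f' \<in> mor C Y P"
    and "Comp C X A P a' f = Comp C X Y P f' a"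
  using assms unfolding is_pushout_def by auto

lemma pushout_ex1:
  assumes "is_pushout C X A Y P f a a' f'" "W \<in> Obj C" "s \<in> mor C A W" "t \<in> mor C Y W"
    and "Comp C X A W s f = Comp C X Y W t a"
  shows "\<exists>!k. k \<in> mor C P W \<and> Comp C A P W k a' = s \<and> Comp C Y P W k f' = t"
  using assms unfolding is_pushout_def by blast

lemma pushout_ex:
  assumes "is_pushout C X A Y P f a a' f'" "W \<in> Obj C" "s \<in> mor C A W" "t \<in> mor C Y W"
    and "Comp C X A W s f = Comp C X Y W t a"
  obtains k where "k \<in> mor C P W" "Comp C A P W k a' = s" "Comp C Y P W k f' = t"
  using pushout_ex1[OF assms] that by blast

lemma pushout_eqI:
  assumes p: "is_pushout C X A Y P f a a' f'" and W: "W \<in> Obj C"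
    and h: "h \<in> mor C P W" and k: "k \<in> mor C P W"
    and e: "Comp C A P W h a' = Comp C A P W k a'" "Comp C Y P W h f' = Comp C Y P W k f'"
  shows "h = k"
proof -
  note [simp] = pushoutD[OF p] W h k
  have "Comp C X A W (Comp C A P W k a') f = Comp C X Y W (Comp C Y P W k f') a"
    by simp
  then have "\<exists>!l. l \<in> mor C P W \<and> Comp C A P W l a' = Comp C A P W k a' \<and> Comp C Y P W l f' = Comp C Y P W k f'"
    by (intro pushout_ex1[OF p W]) simp_all
  then show ?thesis using h k e by blast
qed

lemma pullbackD:
  assumes "is_pullback C X A Y P f a a' f'"
  shows "X \<in> Obj C" "A \<in> Obj C" "Y \<in> Obj C" "P \<in> Obj C"
    and "f \<in> mor C A X" "a \<in> mor C Y X" "a' \<in> mor C P A" "f' \<in> mor C P Y"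
    and "Comp C P A X f a' = Comp C P Y X a f'"
  using assms unfolding is_pullback_def by auto

lemma pullback_ex1:
  assumes "is_pullback C X A Y P f a a' f'" "W \<in> Obj C" "s \<in> mor C W A" "t \<in> mor C W Y"
    and "Comp C W A X f s = Comp C W Y X a t"
  shows "\<exists>!k. k \<in> mor C W P \<and> Comp C W P A a' k = s \<and> Comp C W P Y f' k = t"
  using assms unfolding is_pullback_def by blast

lemma pullback_ex:
  assumes "is_pullback C X A Y P f a a' f'" "W \<in> Obj C" "s \<in> mor C W A" "t \<in> mor C W Y"
    and "Comp C W A X f s = Comp C W Y X a t"
  obtains k where "k \<in> mor C W P" "Comp C W P A a' k = s" "Comp C W P Y f' k = t"
  using pullback_ex1[OF assms] that by blast

lemma pullback_eqI:
  assumes p: "is_pullback C X A Y P f a a' f'" and W: "W \<in> Obj C"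
    and h: "h \<in> mor C W P" and k: "k \<in> mor C W P"
    and e: "Comp C W P A a' h = Comp C W P A a' k" "Comp C W P Y f' h = Comp C W P Y f' k"
  shows "h = k"
proof -
  note [simp] = pullbackD[OF p] W h k
  have "Comp C W A X f (Comp C W P A a' k) = Comp C W Y X a (Comp C W P Y f' k)"
    by (simp add: Comp_eq_Comp[OF pullbackD(9)[OF p]])
  then have "\<exists>!l. l \<in> mor C W P \<and> Comp C W P A a' l = Comp C W P A a' k \<and> Comp C W P Y f' l = Comp C W P Y f' k"
    by (intro pullback_ex1[OF p W]) simp_all
  then show ?thesis using h k e by blast
qed

end

context preadditive_category
begin

text \<open>
  The pushout of the inclusion X --> X + Z along a : X --> Y is the inclusion Y --> Y + Z.
\<close>

lemma pushout_of_biproduct: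
  assumes b: "is_biproduct C X Z A f s r g" and c: "is_biproduct C Y Z P j1 j2 q1 q2"
    and a: "a \<in> mor C X Y"
  shows "is_pushout C X A Y P f a
    (Comp C A Y P j1 (Comp C A X Y a r) \<otimes>\<^bsub>Hom C A P\<^esub> Comp C A Z P j2 g) j1"
proof -
  note [simp] = biproductD[OF b] biproduct_reassoc[OF b] biproductD[OF c] biproduct_reassoc[OF c] a
  let ?a' = "Comp C A Y P j1 (Comp C A X Y a r) \<otimes>\<^bsub>Hom C A P\<^esub> Comp C A Z P j2 g"
  have "\<exists>!k. k \<in> mor C P W \<and> Comp C A P W k ?a' = u \<and> Comp C Y P W k j1 = t"
    if W [simp]: "W \<in> Obj C" and u [simp]: "u \<in> mor C A W" and t [simp]: "t \<in> mor C Y W"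
      and eq: "Comp C X A W u f = Comp C X Y W t a" for W u t
  proof (rule ex1I[of _ "Comp C P Y W t q1 \<otimes>\<^bsub>Hom C P W\<^esub> Comp C P Z W (Comp C Z A W u s) q2"])
    have "Comp C A X W (Comp C X Y W t a) r \<otimes>\<^bsub>Hom C A W\<^esub> Comp C A Z W (Comp C Z A W u s) g = u"
      using biproduct_reassoc(6)[OF b W u] by (simp only: eq)
    then show "Comp C P Y W t q1 \<otimes>\<^bsub>Hom C P W\<^esub> Comp C P Z W (Comp C Z A W u s) q2 \<in> mor C P W \<and>
      Comp C A P W (Comp C P Y W t q1 \<otimes>\<^bsub>Hom C P W\<^esub> Comp C P Z W (Comp C Z A W u s) q2) ?a' = u \<and>
      Comp C Y P W (Comp C P Y W t q1 \<otimes>\<^bsub>Hom C P W\<^esub> Comp C P Z W (Comp C Z A W u s) q2) j1 = t"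
      by simp
  next
    fix k assume k: "k \<in> mor C P W \<and> Comp C A P W k ?a' = u \<and> Comp C Y P W k j1 = t"
    then have [simp]: "k \<in> mor C P W" by blast
    have "Comp C Z P W k j2 = Comp C Z A W (Comp C A P W k ?a') s"
      by simp
    also have "Comp C A P W k ?a' = u" using k by blast
    finally have kj2: "Comp C Z P W k j2 = Comp C Z A W u s" .
    have kj1: "Comp C Y P W k j1 = t" using k by blast
    show "k = Comp C P Y W t q1 \<otimes>\<^bsub>Hom C P W\<^esub> Comp C P Z W (Comp C Z A W u s) q2"
      by (rule biproduct_out_eqI[OF c W]) (simp_all add: kj1 kj2)
  qed
  then show ?thesis
    unfolding is_pushout_def by simp
qed

text \<open>
  The pullback of the projection K + X --> X along a : Y --> X is the projection K + Y --> Y.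
\<close>

lemma pullback_of_biproduct:
  assumes b: "is_biproduct C K X A i s r f" and c: "is_biproduct C K Y P j1 j2 q1 q2"
    and a: "a \<in> mor C Y X"
  shows "is_pullback C X A Y P f a
    (Comp C P K A i q1 \<otimes>\<^bsub>Hom C P A\<^esub> Comp C P X A s (Comp C P Y X a q2)) q2"
proof -
  note [simp] = biproductD[OF b] biproduct_reassoc[OF b] biproductD[OF c] biproduct_reassoc[OF c] a
  let ?a' = "Comp C P K A i q1 \<otimes>\<^bsub>Hom C P A\<^esub> Comp C P X A s (Comp C P Y X a q2)"
  have "\<exists>!k. k \<in> mor C W P \<and> Comp C W P A ?a' k = u \<and> Comp C W P Y q2 k = t"
    if W [simp]: "W \<in> Obj C" and u [simp]: "u \<in> mor C W A" and t [simp]: "t \<in> mor C W Y"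
      and eq: "Comp C W A X f u = Comp C W Y X a t" for W u t
  proof (rule ex1I[of _ "Comp C W K P j1 (Comp C W A K r u) \<otimes>\<^bsub>Hom C W P\<^esub> Comp C W Y P j2 t"])
    have "Comp C W K A i (Comp C W A K r u) \<otimes>\<^bsub>Hom C W A\<^esub> Comp C W X A s (Comp C W Y X a t) = u"
      using biproduct_reassoc(5)[OF b W u] by (simp only: eq)
    then show "Comp C W K P j1 (Comp C W A K r u) \<otimes>\<^bsub>Hom C W P\<^esub> Comp C W Y P j2 t \<in> mor C W P \<and>
      Comp C W P A ?a' (Comp C W K P j1 (Comp C W A K r u) \<otimes>\<^bsub>Hom C W P\<^esub> Comp C W Y P j2 t) = u \<and>
      Comp C W P Y q2 (Comp C W K P j1 (Comp C W A K r u) \<otimes>\<^bsub>Hom C W P\<^esub> Comp C W Y P j2 t) = t"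
      by simp
  next
    fix k assume k: "k \<in> mor C W P \<and> Comp C W P A ?a' k = u \<and> Comp C W P Y q2 k = t"
    then have [simp]: "k \<in> mor C W P" by blast
    have "Comp C W P K q1 k = Comp C W A K r (Comp C W P A ?a' k)"
      by simp
    also have "Comp C W P A ?a' k = u" using k by blast
    finally have qk1: "Comp C W P K q1 k = Comp C W A K r u" .
    have qk2: "Comp C W P Y q2 k = t" using k by blast
    show "k = Comp C W K P j1 (Comp C W A K r u) \<otimes>\<^bsub>Hom C W P\<^esub> Comp C W Y P j2 t"
      by (rule biproduct_in_eqI[OF c W]) (simp_all add: qk1 qk2)
  qed
  then show ?thesis
    unfolding is_pullback_def by simp
qed

end

context additive_complexes
begin

text \<open>
  Degreewise pushouts assemble to a pushout of N-complexes: the universal property in degree i gives the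
  differential, and its uniqueness part makes the induced maps chain maps.
\<close>

lemma pushout_complex:
  assumes X [simp]: "is_ncomplex N B X" and A [simp]: "is_ncomplex N B A" and Y [simp]: "is_ncomplex N B Y"
    and f [simp]: "is_chain_map B X A f" and a [simp]: "is_chain_map B X Y a"
    and p: "\<And>i. is_pushout B (cobj X i) (cobj A i) (cobj Y i) (P i) (f i) (a i) (a' i) (f' i)"
  obtains Q where "is_pushout CN X A Y Q f a a' f'" "\<And>i. cobj Q i = P i"
proof -
  note [simp] = pushoutD(4,7,8)[OF p]
  have sq: "Comp B (cobj X i) (cobj A i) (P i) (a' i) (f i) = Comp B (cobj X i) (cobj Y i) (P i) (f' i) (a i)" for i
    by (rule pushoutD(9)[OF p])
  have "\<exists>d\<in>mor B (P i) (P (i + 1)).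
      Comp B (cobj A i) (P i) (P (i + 1)) d (a' i)
        = Comp B (cobj A i) (cobj A (i + 1)) (P (i + 1)) (a' (i + 1)) (cdiff A i) \<and>
      Comp B (cobj Y i) (P i) (P (i + 1)) d (f' i)
        = Comp B (cobj Y i) (cobj Y (i + 1)) (P (i + 1)) (f' (i + 1)) (cdiff Y i)" for i
  proof (rule pushout_ex[OF p[of i]])
    show "Comp B (cobj X i) (cobj A i) (P (i + 1))
        (Comp B (cobj A i) (cobj A (i + 1)) (P (i + 1)) (a' (i + 1)) (cdiff A i)) (f i)
      = Comp B (cobj X i) (cobj Y i) (P (i + 1))
        (Comp B (cobj Y i) (cobj Y (i + 1)) (P (i + 1)) (f' (i + 1)) (cdiff Y i)) (a i)"
      by (simp add: Comp_eq_Comp[OF sq] flip: chain_map_comm[OF f] chain_map_comm[OF a])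
  qed (simp_all, blast)
  then obtain D where D: "\<And>i. D i \<in> mor B (P i) (P (i + 1))"
    "\<And>i. Comp B (cobj A i) (P i) (P (i + 1)) (D i) (a' i)
        = Comp B (cobj A i) (cobj A (i + 1)) (P (i + 1)) (a' (i + 1)) (cdiff A i)"
    "\<And>i. Comp B (cobj Y i) (P i) (P (i + 1)) (D i) (f' i)
        = Comp B (cobj Y i) (cobj Y (i + 1)) (P (i + 1)) (f' (i + 1)) (cdiff Y i)"
    by metis
  define Q where "Q = \<lparr>cobj = P, cdiff = D\<rparr>"
  have Q [simp]: "cobj Q i = P i" "cdiff Q i = D i" for i by (simp_all add: Q_def)
  have sQ: "is_sequence Q" by (rule is_sequenceI) (simp_all add: D(1))
  have c: "is_chain_map B A Q a'" "is_chain_map B Y Q f'"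
    by (rule chain_mapI; simp add: D(2,3))+
  have nQ [simp]: "is_ncomplex N B Q"
    by (rule ncomplex_from_quotients[OF A Y sQ c]) (use pushout_eqI[OF p] in simp)
  have "\<exists>!k. k \<in> mor CN Q W \<and> Comp CN A Q W k a' = s \<and> Comp CN Y Q W k f' = t"
    if W: "W \<in> Obj CN" and st: "s \<in> mor CN A W" "t \<in> mor CN Y W"
      and eq: "Comp CN X A W s f = Comp CN X Y W t a" for W s t
  proof -
    have [simp]: "is_ncomplex N B W" "is_chain_map B A W s" "is_chain_map B Y W t"
      using W st by simp_all
    have "\<exists>k. k \<in> mor B (P i) (cobj W i) \<and> Comp B (cobj A i) (P i) (cobj W i) k (a' i) = s i \<and>
        Comp B (cobj Y i) (P i) (cobj W i) k (f' i) = t i" for i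
    proof (rule pushout_ex[OF p[of i]])
      show "Comp B (cobj X i) (cobj A i) (cobj W i) (s i) (f i)
          = Comp B (cobj X i) (cobj Y i) (cobj W i) (t i) (a i)"
        using fun_cong[OF eq, of i] by simp
    qed (simp_all, blast)
    then obtain k where k: "\<And>i. k i \<in> mor B (P i) (cobj W i)"
      "\<And>i. Comp B (cobj A i) (P i) (cobj W i) (k i) (a' i) = s i"
      "\<And>i. Comp B (cobj Y i) (P i) (cobj W i) (k i) (f' i) = t i"
      by metis
    have kc: "is_chain_map B Q W k"
    proof (rule chain_mapI)
      fix i
      show "Comp B (cobj Q i) (cobj Q (i + 1)) (cobj W (i + 1)) (k (i + 1)) (cdiff Q i) =
        Comp B (cobj Q i) (cobj W i) (cobj W (i + 1)) (cdiff W i) (k i)"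
        by (rule pushout_eqI[OF p[of i], where W = "cobj W (i + 1)"])
          (simp_all add: k D Comp_eq_Comp[OF k(2)] Comp_eq_Comp[OF k(3)] chain_map_comm)
    qed (simp add: k)
    show ?thesis
    proof (rule ex1I[of _ k])
      fix l assume l: "l \<in> mor CN Q W \<and> Comp CN A Q W l a' = s \<and> Comp CN Y Q W l f' = t"
      then have "is_chain_map B Q W l" by simp
      from chain_map_in[OF this] have l1: "l i \<in> mor B (P i) (cobj W i)" for i by simp
      have l2: "Comp B (cobj A i) (P i) (cobj W i) (l i) (a' i) = s i"
        "Comp B (cobj Y i) (P i) (cobj W i) (l i) (f' i) = t i" for i
        using l by auto
      show "l = k"
      proof (rule ext)
        show "l i = k i" for i
          by (rule pushout_eqI[OF p[of i], where W = "cobj W i"]) (simp_all add: l1 k l2)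
      qed
    qed (simp add: kc k)
  qed
  then have "is_pushout CN X A Y Q f a a' f'"
    unfolding is_pushout_def[of CN] by (simp add: c sq)
  then show ?thesis using that by simp
qed

lemma pullback_complex:
  assumes X [simp]: "is_ncomplex N B X" and A [simp]: "is_ncomplex N B A" and Y [simp]: "is_ncomplex N B Y"
    and f [simp]: "is_chain_map B A X f" and a [simp]: "is_chain_map B Y X a"
    and p: "\<And>i. is_pullback B (cobj X i) (cobj A i) (cobj Y i) (P i) (f i) (a i) (a' i) (f' i)"
  obtains Q where "is_pullback CN X A Y Q f a a' f'" "\<And>i. cobj Q i = P i"
proof -
  note [simp] = pullbackD(4,7,8)[OF p]
  have sq: "Comp B (P i) (cobj A i) (cobj X i) (f i) (a' i) = Comp B (P i) (cobj Y i) (cobj X i) (a i) (f' i)" for i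
    by (rule pullbackD(9)[OF p])
  have "\<exists>d\<in>mor B (P i) (P (i + 1)).
      Comp B (P i) (P (i + 1)) (cobj A (i + 1)) (a' (i + 1)) d
        = Comp B (P i) (cobj A i) (cobj A (i + 1)) (cdiff A i) (a' i) \<and>
      Comp B (P i) (P (i + 1)) (cobj Y (i + 1)) (f' (i + 1)) d
        = Comp B (P i) (cobj Y i) (cobj Y (i + 1)) (cdiff Y i) (f' i)" for i
  proof (rule pullback_ex[OF p[of "i + 1"]])
    show "Comp B (P i) (cobj A (i + 1)) (cobj X (i + 1)) (f (i + 1))
        (Comp B (P i) (cobj A i) (cobj A (i + 1)) (cdiff A i) (a' i))
      = Comp B (P i) (cobj Y (i + 1)) (cobj X (i + 1)) (a (i + 1))
        (Comp B (P i) (cobj Y i) (cobj Y (i + 1)) (cdiff Y i) (f' i))"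
      by (simp add: chain_map_comm'[OF f] chain_map_comm'[OF a] sq)
  qed (simp_all, blast)
  then obtain D where D: "\<And>i. D i \<in> mor B (P i) (P (i + 1))"
    "\<And>i. Comp B (P i) (P (i + 1)) (cobj A (i + 1)) (a' (i + 1)) (D i)
        = Comp B (P i) (cobj A i) (cobj A (i + 1)) (cdiff A i) (a' i)"
    "\<And>i. Comp B (P i) (P (i + 1)) (cobj Y (i + 1)) (f' (i + 1)) (D i)
        = Comp B (P i) (cobj Y i) (cobj Y (i + 1)) (cdiff Y i) (f' i)"
    by metis
  define Q where "Q = \<lparr>cobj = P, cdiff = D\<rparr>"
  have Q [simp]: "cobj Q i = P i" "cdiff Q i = D i" for i by (simp_all add: Q_def)
  have sQ: "is_sequence Q" by (rule is_sequenceI) (simp_all add: D(1))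
  have c: "is_chain_map B Q A a'" "is_chain_map B Q Y f'"
    by (rule chain_mapI; simp add: D(2,3))+
  have nQ [simp]: "is_ncomplex N B Q"
    by (rule ncomplex_from_subobjects[OF A Y sQ c]) (use pullback_eqI[OF p] in simp)
  have "\<exists>!k. k \<in> mor CN W Q \<and> Comp CN W Q A a' k = s \<and> Comp CN W Q Y f' k = t"
    if W: "W \<in> Obj CN" and st: "s \<in> mor CN W A" "t \<in> mor CN W Y"
      and eq: "Comp CN W A X f s = Comp CN W Y X a t" for W s t
  proof -
    have [simp]: "is_ncomplex N B W" "is_chain_map B W A s" "is_chain_map B W Y t"
      using W st by simp_all
    have "\<exists>k. k \<in> mor B (cobj W i) (P i) \<and> Comp B (cobj W i) (P i) (cobj A i) (a' i) k = s i \<and>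
        Comp B (cobj W i) (P i) (cobj Y i) (f' i) k = t i" for i
    proof (rule pullback_ex[OF p[of i]])
      show "Comp B (cobj W i) (cobj A i) (cobj X i) (f i) (s i)
          = Comp B (cobj W i) (cobj Y i) (cobj X i) (a i) (t i)"
        using fun_cong[OF eq, of i] by simp
    qed (simp_all, blast)
    then obtain k where k: "\<And>i. k i \<in> mor B (cobj W i) (P i)"
      "\<And>i. Comp B (cobj W i) (P i) (cobj A i) (a' i) (k i) = s i"
      "\<And>i. Comp B (cobj W i) (P i) (cobj Y i) (f' i) (k i) = t i"
      by metis
    have kc: "is_chain_map B W Q k"
    proof (rule chain_mapI)
      fix i
      show "Comp B (cobj W i) (cobj W (i + 1)) (cobj Q (i + 1)) (k (i + 1)) (cdiff W i) =
        Comp B (cobj W i) (cobj Q i) (cobj Q (i + 1)) (cdiff Q i) (k i)"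
        by (rule pullback_eqI[OF p[of "i + 1"], where W = "cobj W i"])
          (simp_all add: k D Comp_eq_Comp[OF k(2)] Comp_eq_Comp[OF k(3)]
            Comp_eq_Comp[OF D(2)] Comp_eq_Comp[OF D(3)] chain_map_comm)
    qed (simp add: k)
    show ?thesis
    proof (rule ex1I[of _ k])
      fix l assume l: "l \<in> mor CN W Q \<and> Comp CN W Q A a' l = s \<and> Comp CN W Q Y f' l = t"
      then have "is_chain_map B W Q l" by simp
      from chain_map_in[OF this] have l1: "l i \<in> mor B (cobj W i) (P i)" for i by simp
      have l2: "Comp B (cobj W i) (P i) (cobj A i) (a' i) (l i) = s i"
        "Comp B (cobj W i) (P i) (cobj Y i) (f' i) (l i) = t i" for i
        using l by auto
      show "l = k"
      proof (rule ext)
        show "l i = k i" for i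
          by (rule pullback_eqI[OF p[of i], where W = "cobj W i"]) (simp_all add: l1 k l2)
      qed
    qed (simp add: kc k)
  qed
  then have "is_pullback CN X A Y Q f a a' f'"
    unfolding is_pullback_def[of CN] by (simp add: c sq)
  then show ?thesis using that by simp
qed

section \<open>The degreewise split exact structure\<close>

lemma in_SN_iff:
  "(X, f, Y, g, Z) \<in> SN \<longleftrightarrow>
     is_ncomplex N B X \<and> is_ncomplex N B Y \<and> is_ncomplex N B Z \<and>
     is_chain_map B X Y f \<and> is_chain_map B Y Z g \<and>
     (\<forall>i. \<exists>s r. is_biproduct B (cobj X i) (cobj Z i) (cobj Y i) (f i) s r (g i))"
  by (simp add: degreewise_split_def split_exact_def)

lemma SN_E:
  assumes "(X, f, Y, g, Z) \<in> SN"
  obtains s r where "is_ncomplex N B X" "is_ncomplex N B Y" "is_ncomplex N B Z"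
    "is_chain_map B X Y f" "is_chain_map B Y Z g"
    "\<And>i. is_biproduct B (cobj X i) (cobj Z i) (cobj Y i) (f i) (s i) (r i) (g i)"
  using assms unfolding in_SN_iff by metis

lemma admissible_monoE:
  assumes "admissible_mono SN X Y f"
  obtains Z s r g where "is_ncomplex N B X" "is_ncomplex N B Y" "is_chain_map B X Y f"
    "\<And>i. is_biproduct B (cobj X i) (Z i) (cobj Y i) (f i) (s i) (r i) (g i)"
proof -
  obtain Z g where "(X, f, Y, g, Z) \<in> SN"
    using assms unfolding admissible_mono_def by blast
  then show ?thesis by (rule SN_E) (rule that)
qed

lemma admissible_epiE:
  assumes "admissible_epi SN Y Z g"
  obtains X f s r where "is_ncomplex N B Y" "is_ncomplex N B Z" "is_chain_map B Y Z g"
    "\<And>i. is_biproduct B (X i) (cobj Z i) (cobj Y i) (f i) (s i) (r i) (g i)"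
proof -
  obtain X f where "(X, f, Y, g, Z) \<in> SN"
    using assms unfolding admissible_epi_def by blast
  then show ?thesis by (rule SN_E) (rule that)
qed

text \<open>
  Only f has to be compatible with the differentials: the complements in the single degrees form a
  complex, with the differential induced from Y, because the projections g are degreewise epic.
\<close>

lemma admissible_monoI:
  assumes X [simp]: "is_ncomplex N B X" and Y [simp]: "is_ncomplex N B Y"
    and f [simp]: "is_chain_map B X Y f"
    and split: "\<And>i. \<exists>Z s r g. is_biproduct B (cobj X i) Z (cobj Y i) (f i) s r g"
  shows "admissible_mono SN X Y f"
proof -
  obtain Z s r g where b: "\<And>i. is_biproduct B (cobj X i) (Z i) (cobj Y i) (f i) (s i) (r i) (g i)"
    using split by metis
  note [simp] = biproductD[OF b] biproduct_reassoc[OF b]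
  define D where "D i = Comp B (Z i) (cobj Y (i + 1)) (Z (i + 1)) (g (i + 1))
    (Comp B (Z i) (cobj Y i) (cobj Y (i + 1)) (cdiff Y i) (s i))" for i
  have D [simp]: "D i \<in> mor B (Z i) (Z (i + 1))" for i by (simp add: D_def)
  have gf: "Comp B (cobj X i) (cobj Y (i + 1)) (Z (i + 1)) (g (i + 1))
      (Comp B (cobj X i) (cobj Y i) (cobj Y (i + 1)) (cdiff Y i) (f i)) = zero_mor B (cobj X i) (Z (i + 1))" for i
    by (simp flip: chain_map_comm[OF f])
  have Dg: "Comp B (cobj Y i) (Z i) (Z (i + 1)) (D i) (g i)
      = Comp B (cobj Y i) (cobj Y (i + 1)) (Z (i + 1)) (g (i + 1)) (cdiff Y i)" for i
    by (rule biproduct_out_eqI[OF b[of i], where W = "Z (i + 1)"]) (simp_all add: gf, simp add: D_def)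
  define Q where "Q = \<lparr>cobj = Z, cdiff = D\<rparr>"
  have Q [simp]: "cobj Q i = Z i" "cdiff Q i = D i" for i by (simp_all add: Q_def)
  have sQ: "is_sequence Q" by (rule is_sequenceI) simp_all
  have c: "is_chain_map B Y Q g" by (rule chain_mapI) (simp_all add: Dg)
  have epi: "h = k" if "W \<in> Obj B" "h \<in> mor B (Z i) W" "k \<in> mor B (Z i) W"
    "Comp B (cobj Y i) (Z i) W h (g i) = Comp B (cobj Y i) (Z i) W k (g i)" for i W h k
    using arg_cong[OF that(4), of "\<lambda>u. Comp B (Z i) (cobj Y i) W u (s i)"] that(1-3) by simp
  have "is_ncomplex N B Q"
    by (rule ncomplex_from_quotients[OF Y Y sQ c c]) (use epi in simp)
  then have "(X, f, Y, g, Q) \<in> SN"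
    unfolding in_SN_iff using c b by auto
  then show ?thesis unfolding admissible_mono_def by blast
qed

text \<open>
  Dually, the kernels in the single degrees form a complex, with the differential induced from Y.
\<close>

lemma admissible_epiI:
  assumes Y [simp]: "is_ncomplex N B Y" and Z [simp]: "is_ncomplex N B Z"
    and g [simp]: "is_chain_map B Y Z g"
    and split: "\<And>i. \<exists>X f s r. is_biproduct B X (cobj Z i) (cobj Y i) f s r (g i)"
  shows "admissible_epi SN Y Z g"
proof -
  obtain X f s r where b: "\<And>i. is_biproduct B (X i) (cobj Z i) (cobj Y i) (f i) (s i) (r i) (g i)"
    using split by metis
  note [simp] = biproductD[OF b] biproduct_reassoc[OF b]
  define D where "D i = Comp B (X i) (cobj Y (i + 1)) (X (i + 1)) (r (i + 1))
    (Comp B (X i) (cobj Y i) (cobj Y (i + 1)) (cdiff Y i) (f i))" for i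
  have D [simp]: "D i \<in> mor B (X i) (X (i + 1))" for i by (simp add: D_def)
  have gf: "Comp B (X i) (cobj Y (i + 1)) (cobj Z (i + 1)) (g (i + 1))
      (Comp B (X i) (cobj Y i) (cobj Y (i + 1)) (cdiff Y i) (f i)) = zero_mor B (X i) (cobj Z (i + 1))" for i
    by (simp add: chain_map_comm'[OF g])
  have fD: "Comp B (X i) (X (i + 1)) (cobj Y (i + 1)) (f (i + 1)) (D i)
      = Comp B (X i) (cobj Y i) (cobj Y (i + 1)) (cdiff Y i) (f i)" for i
    by (rule biproduct_in_eqI[OF b[of "i + 1"], where W = "X i"]) (simp_all add: gf, simp add: D_def)
  define Q where "Q = \<lparr>cobj = X, cdiff = D\<rparr>"
  have Q [simp]: "cobj Q i = X i" "cdiff Q i = D i" for i by (simp_all add: Q_def)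
  have sQ: "is_sequence Q" by (rule is_sequenceI) simp_all
  have c: "is_chain_map B Q Y f" by (rule chain_mapI) (simp_all add: fD)
  have mono: "h = k" if "W \<in> Obj B" "h \<in> mor B W (X i)" "k \<in> mor B W (X i)"
    "Comp B W (X i) (cobj Y i) (f i) h = Comp B W (X i) (cobj Y i) (f i) k" for i W h k
    using arg_cong[OF that(4), of "\<lambda>u. Comp B W (cobj Y i) (X i) (r i) u"] that(1-3) by simp
  have "is_ncomplex N B Q"
    by (rule ncomplex_from_subobjects[OF Y Y sQ c c]) (use mono in simp)
  then have "(Q, f, Y, g, Z) \<in> SN"
    unfolding in_SN_iff using c b by auto
  then show ?thesis unfolding admissible_epi_def by blast
qed

text \<open>
  The factorisation of h through f is r h with the degreewise retraction r of f. Although r need not be a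
  chain map, r h is one, because f is degreewise monic.
\<close>

lemma degreewise_split_kernel:
  assumes E: "(X, f, Y, g, Z) \<in> SN"
  shows "is_kernel CN X Y Z f g"
proof -
  obtain s r where [simp]: "is_ncomplex N B X" "is_ncomplex N B Y" "is_ncomplex N B Z"
    "is_chain_map B X Y f" "is_chain_map B Y Z g"
    and b: "\<And>i. is_biproduct B (cobj X i) (cobj Z i) (cobj Y i) (f i) (s i) (r i) (g i)"
    by (rule SN_E[OF E]) (rule that)
  note [simp] = biproductD[OF b] biproduct_reassoc[OF b]
  have "\<exists>!k. k \<in> mor CN W X \<and> Comp CN W X Y f k = h"
    if W: "W \<in> Obj CN" and h: "h \<in> mor CN W Y" and gh: "Comp CN W Y Z g h = zero_mor CN W Z" for W h
  proof -
    have [simp]: "is_ncomplex N B W" "is_chain_map B W Y h" using W h by simp_all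
    define k where "k i = Comp B (cobj W i) (cobj Y i) (cobj X i) (r i) (h i)" for i
    have k [simp]: "k i \<in> mor B (cobj W i) (cobj X i)" for i by (simp add: k_def)
    have gh': "Comp B (cobj W i) (cobj Y i) (cobj Z i) (g i) (h i) = zero_mor B (cobj W i) (cobj Z i)" for i
      using fun_cong[OF gh, of i] by simp
    have fk: "Comp B (cobj W i) (cobj X i) (cobj Y i) (f i) (k i) = h i" for i
      by (rule biproduct_in_eqI[OF b[of i], where W = "cobj W i"]) (simp_all add: gh', simp add: k_def)
    have uniq: "l = k i" if "l \<in> mor B (cobj W i) (cobj X i)"
      "Comp B (cobj W i) (cobj X i) (cobj Y i) (f i) l = h i" for l i
      unfolding k_def that(2)[symmetric] using that(1) by simp
    have "is_chain_map B W X k"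
    proof (rule chain_mapI)
      fix i
      have "Comp B (cobj W i) (cobj X i) (cobj X (i + 1)) (cdiff X i) (k i)
        = Comp B (cobj W i) (cobj Y (i + 1)) (cobj X (i + 1)) (r (i + 1))
           (Comp B (cobj W i) (cobj X (i + 1)) (cobj Y (i + 1)) (f (i + 1))
             (Comp B (cobj W i) (cobj X i) (cobj X (i + 1)) (cdiff X i) (k i)))"
        by simp
      also have "\<dots> = Comp B (cobj W i) (cobj Y (i + 1)) (cobj X (i + 1)) (r (i + 1))
           (Comp B (cobj W i) (cobj Y i) (cobj Y (i + 1)) (cdiff Y i) (h i))"
        by (subst chain_map_comm'[where Y = Y]) (simp_all add: fk)
      also have "\<dots> = Comp B (cobj W i) (cobj W (i + 1)) (cobj X (i + 1)) (k (i + 1)) (cdiff W i)"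
        by (simp add: k_def chain_map_comm[of W Y])
      finally show "Comp B (cobj W i) (cobj W (i + 1)) (cobj X (i + 1)) (k (i + 1)) (cdiff W i)
        = Comp B (cobj W i) (cobj X i) (cobj X (i + 1)) (cdiff X i) (k i)" ..
    qed simp
    then show ?thesis
    proof (intro ex1I[of _ k])
      fix l assume l: "l \<in> mor CN W X \<and> Comp CN W X Y f l = h"
      then have l1: "is_chain_map B W X l" by simp
      have l2: "Comp B (cobj W i) (cobj X i) (cobj Y i) (f i) (l i) = h i" for i
        using fun_cong[OF conjunct2[OF l], of i] by simp
      have "l i = k i" for i
        by (rule uniq[OF chain_map_in[OF l1] l2])
      then show "l = k" by blast
    qed (simp add: fk)
  qed
  then show ?thesis
    unfolding is_kernel_def by simp
qed

lemma degreewise_split_cokernel: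
  assumes E: "(X, f, Y, g, Z) \<in> SN"
  shows "is_cokernel CN X Y Z f g"
proof -
  obtain s r where [simp]: "is_ncomplex N B X" "is_ncomplex N B Y" "is_ncomplex N B Z"
    "is_chain_map B X Y f" "is_chain_map B Y Z g"
    and b: "\<And>i. is_biproduct B (cobj X i) (cobj Z i) (cobj Y i) (f i) (s i) (r i) (g i)"
    by (rule SN_E[OF E]) (rule that)
  note [simp] = biproductD[OF b] biproduct_reassoc[OF b]
  have "\<exists>!k. k \<in> mor CN Z W \<and> Comp CN Y Z W k g = h"
    if W: "W \<in> Obj CN" and h: "h \<in> mor CN Y W" and gh: "Comp CN X Y W h f = zero_mor CN X W" for W h
  proof -
    have [simp]: "is_ncomplex N B W" "is_chain_map B Y W h" using W h by simp_all
    define k where "k i = Comp B (cobj Z i) (cobj Y i) (cobj W i) (h i) (s i)" for i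
    have k [simp]: "k i \<in> mor B (cobj Z i) (cobj W i)" for i by (simp add: k_def)
    have hf': "Comp B (cobj X i) (cobj Y i) (cobj W i) (h i) (f i) = zero_mor B (cobj X i) (cobj W i)" for i
      using fun_cong[OF gh, of i] by simp
    have kg: "Comp B (cobj Y i) (cobj Z i) (cobj W i) (k i) (g i) = h i" for i
      by (rule biproduct_out_eqI[OF b[of i], where W = "cobj W i"]) (simp_all add: hf', simp add: k_def)
    have uniq: "l = k i" if "l \<in> mor B (cobj Z i) (cobj W i)"
      "Comp B (cobj Y i) (cobj Z i) (cobj W i) l (g i) = h i" for l i
      unfolding k_def that(2)[symmetric] using that(1) by simp
    have "is_chain_map B Z W k"
    proof (rule chain_mapI)
      fix i
      have "Comp B (cobj Z i) (cobj Z (i + 1)) (cobj W (i + 1)) (k (i + 1)) (cdiff Z i)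
        = Comp B (cobj Z i) (cobj Z (i + 1)) (cobj W (i + 1)) (k (i + 1))
            (Comp B (cobj Z i) (cobj Z i) (cobj Z (i + 1)) (cdiff Z i)
              (Comp B (cobj Z i) (cobj Y i) (cobj Z i) (g i) (s i)))"
        by simp
      also have "\<dots> = Comp B (cobj Z i) (cobj Z (i + 1)) (cobj W (i + 1)) (k (i + 1))
            (Comp B (cobj Z i) (cobj Y (i + 1)) (cobj Z (i + 1)) (g (i + 1))
              (Comp B (cobj Z i) (cobj Y i) (cobj Y (i + 1)) (cdiff Y i) (s i)))"
        by (subst chain_map_comm'[of Y Z g]) simp_all
      also have "\<dots> = Comp B (cobj Z i) (cobj W i) (cobj W (i + 1)) (cdiff W i) (k i)"
        by (simp add: Comp_eq_Comp[OF kg] chain_map_comm'[of Y W], simp add: k_def)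
      finally show "Comp B (cobj Z i) (cobj Z (i + 1)) (cobj W (i + 1)) (k (i + 1)) (cdiff Z i)
        = Comp B (cobj Z i) (cobj W i) (cobj W (i + 1)) (cdiff W i) (k i)" .
    qed simp
    then show ?thesis
    proof (intro ex1I[of _ k])
      fix l assume l: "l \<in> mor CN Z W \<and> Comp CN Y Z W l g = h"
      then have l1: "is_chain_map B Z W l" by simp
      have l2: "Comp B (cobj Y i) (cobj Z i) (cobj W i) (l i) (g i) = h i" for i
        using fun_cong[OF conjunct2[OF l], of i] by simp
      have "l i = k i" for i
        by (rule uniq[OF chain_map_in[OF l1] l2])
      then show "l = k" by blast
    qed (simp add: kg)
  qed
  then show ?thesis
    unfolding is_cokernel_def by simp
qed

lemma is_iso_degreewise:
  assumes "is_iso CN X Y f" "is_ncomplex N B X" "is_ncomplex N B Y"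
  shows "is_iso B (cobj X i) (cobj Y i) (f i)"
proof -
  obtain g where g: "f \<in> mor CN X Y" "g \<in> mor CN Y X"
      "Comp CN X Y X g f = Ident CN X" "Comp CN Y X Y f g = Ident CN Y"
    using assms(1) by (rule CN.is_isoE)
  show ?thesis
    by (rule is_isoI[where g = "g i"])
      (use g(1,2) fun_cong[OF g(3), of i] fun_cong[OF g(4), of i] in simp_all)
qed

text \<open>
  Each axiom reduces to the base category: a chain map is an admissible monomorphism as soon as every
  component is the inclusion of a biproduct summand, and dually for epimorphisms.
\<close>

lemma exact_CN: "exact_category CN SN"
proof (intro exact_category.intro additive_CN exact_category_axioms.intro)
  fix E assume E: "E \<in> SN"
  obtain X f Y g Z where [simp]: "E = (X, f, Y, g, Z)" by (cases E)
  show "kernel_cokernel_pair CN E"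
    using E degreewise_split_kernel[of X f Y g Z] degreewise_split_cokernel[of X f Y g Z]
    unfolding kernel_cokernel_pair_def by (simp add: in_SN_iff)
next
  fix E E' assume E: "E \<in> SN" and E': "kernel_cokernel_pair CN E'" and iso: "ses_iso CN E E'"
  obtain X f Y g Z where EE: "E = (X, f, Y, g, Z)" by (cases E)
  obtain X' f' Y' g' Z' where EE': "E' = (X', f', Y', g', Z')" by (cases E')
  obtain s r where nc: "is_ncomplex N B X" "is_ncomplex N B Y" "is_ncomplex N B Z"
    and b: "\<And>i. is_biproduct B (cobj X i) (cobj Z i) (cobj Y i) (f i) (s i) (r i) (g i)"
    by (rule SN_E[OF E[unfolded EE]]) (rule that)
  have nc': "is_ncomplex N B X'" "is_ncomplex N B Y'" "is_ncomplex N B Z'"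
    "is_chain_map B X' Y' f'" "is_chain_map B Y' Z' g'"
    using E' unfolding EE' kernel_cokernel_pair_def is_kernel_def by simp_all
  obtain a e c where iso': "is_iso CN X X' a" "is_iso CN Y Y' e" "is_iso CN Z Z' c"
    "Comp CN X Y Y' e f = Comp CN X X' Y' f' a" "Comp CN Y Z Z' c g = Comp CN Y Y' Z' g' e"
    using iso unfolding EE EE' ses_iso_def by auto
  have "\<exists>s r. is_biproduct B (cobj X' i) (cobj Z' i) (cobj Y' i) (f' i) s r (g' i)" for i
    by (rule biproduct_iso[OF b[of i], where a = "a i" and e = "e i" and c = "c i"])
      (use nc nc' is_iso_degreewise[OF iso'(1)] is_iso_degreewise[OF iso'(2)] is_iso_degreewise[OF iso'(3)]
        fun_cong[OF iso'(4), of i] fun_cong[OF iso'(5), of i] in simp_all)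
  then show "E' \<in> SN"
    unfolding EE' in_SN_iff using nc' by blast
next
  fix X assume "X \<in> Obj CN"
  then have X [simp]: "is_ncomplex N B X" by simp
  obtain O' where "is_zero_object B O'" using zero_object by blast
  then have b: "is_biproduct B (cobj X i) O' (cobj X i) (Ident B (cobj X i)) (zero_mor B O' (cobj X i))
      (Ident B (cobj X i)) (zero_mor B (cobj X i) O')" for i
    by (rule biproduct_with_zero) simp
  show "admissible_mono SN X X (Ident CN X)"
    by (rule admissible_monoI) (simp_all add: chain_map_Ident, use b in blast)
  show "admissible_epi SN X X (Ident CN X)"
    by (rule admissible_epiI) (simp_all add: chain_map_Ident, use biproduct_swap[OF b] in blast)
next
  fix X Y Z f g assume fg: "admissible_mono SN X Y f" "admissible_mono SN Y Z g"
  obtain Z1 s1 r1 g1 where 1: "is_ncomplex N B X" "is_ncomplex N B Y" "is_chain_map B X Y f"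
    "\<And>i. is_biproduct B (cobj X i) (Z1 i) (cobj Y i) (f i) (s1 i) (r1 i) (g1 i)"
    by (rule admissible_monoE[OF fg(1)]) (rule that)
  obtain Z2 s2 r2 g2 where 2: "is_ncomplex N B Y" "is_ncomplex N B Z" "is_chain_map B Y Z g"
    "\<And>i. is_biproduct B (cobj Y i) (Z2 i) (cobj Z i) (g i) (s2 i) (r2 i) (g2 i)"
    by (rule admissible_monoE[OF fg(2)]) (rule that)
  have "\<exists>W s r p. is_biproduct B (cobj X i) W (cobj Z i) (Comp B (cobj X i) (cobj Y i) (cobj Z i) (g i) (f i)) s r p" for i
    using biproduct_Comp[OF 1(4)[of i] 2(4)[of i]] by blast
  then show "admissible_mono SN X Z (Comp CN X Y Z g f)"
    by (intro admissible_monoI) (use 1(1-3) 2(1-3) in \<open>simp_all add: chain_map_Comp\<close>)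
next
  fix X Y Z f g assume fg: "admissible_epi SN X Y f" "admissible_epi SN Y Z g"
  obtain K1 i1 s1 r1 where 1: "is_ncomplex N B X" "is_ncomplex N B Y" "is_chain_map B X Y f"
    "\<And>i. is_biproduct B (K1 i) (cobj Y i) (cobj X i) (i1 i) (s1 i) (r1 i) (f i)"
    by (rule admissible_epiE[OF fg(1)]) (rule that)
  obtain K2 i2 s2 r2 where 2: "is_ncomplex N B Y" "is_ncomplex N B Z" "is_chain_map B Y Z g"
    "\<And>i. is_biproduct B (K2 i) (cobj Z i) (cobj Y i) (i2 i) (s2 i) (r2 i) (g i)"
    by (rule admissible_epiE[OF fg(2)]) (rule that)
  have "\<exists>K j s r. is_biproduct B K (cobj Z i) (cobj X i) j s r (Comp B (cobj X i) (cobj Y i) (cobj Z i) (g i) (f i))" for i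
    using biproduct_Comp[OF biproduct_swap[OF 2(4)[of i]] biproduct_swap[OF 1(4)[of i]]] biproduct_swap by blast
  then show "admissible_epi SN X Z (Comp CN X Y Z g f)"
    by (intro admissible_epiI) (use 1(1-3) 2(1-3) in \<open>simp_all add: chain_map_Comp\<close>)
next
  fix X A f Y a
  assume f: "admissible_mono SN X A f" and Y: "Y \<in> Obj CN" and a: "a \<in> mor CN X Y"
  obtain Z s r g where 1: "is_ncomplex N B X" "is_ncomplex N B A" "is_chain_map B X A f"
    and b: "\<And>i. is_biproduct B (cobj X i) (Z i) (cobj A i) (f i) (s i) (r i) (g i)"
    by (rule admissible_monoE[OF f]) (rule that)
  have Y' [simp]: "is_ncomplex N B Y" and a' [simp]: "is_chain_map B X Y a" using Y a by simp_all
  have "\<exists>P j1 j2 q1 q2. is_biproduct B (cobj Y i) (Z i) P j1 j2 q1 q2" for i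
    using biproductD(2)[OF b] by (intro biproducts) simp_all
  then obtain P j1 j2 q1 q2 where c: "\<And>i. is_biproduct B (cobj Y i) (Z i) (P i) (j1 i) (j2 i) (q1 i) (q2 i)"
    by metis
  obtain Q a'' where Q: "is_pushout CN X A Y Q f a a'' j1" "\<And>i. cobj Q i = P i"
    by (rule pushout_complex[OF 1(1,2) Y' 1(3) a' pushout_of_biproduct[OF b c chain_map_in[OF a']]]) blast
  have "admissible_mono SN Y Q j1"
  proof (rule admissible_monoI)
    show "\<exists>Z s r g. is_biproduct B (cobj Y i) Z (cobj Q i) (j1 i) s r g" for i
      unfolding Q(2) using c by blast
  qed (use CN.pushoutD[OF Q(1)] in simp_all)
  then show "\<exists>P a' f'. is_pushout CN X A Y P f a a' f' \<and> admissible_mono SN Y P f'"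
    using Q(1) by blast
next
  fix A X f Y a
  assume f: "admissible_epi SN A X f" and Y: "Y \<in> Obj CN" and a: "a \<in> mor CN Y X"
  obtain K k s r where 1: "is_ncomplex N B A" "is_ncomplex N B X" "is_chain_map B A X f"
    and b: "\<And>i. is_biproduct B (K i) (cobj X i) (cobj A i) (k i) (s i) (r i) (f i)"
    by (rule admissible_epiE[OF f]) (rule that)
  have Y' [simp]: "is_ncomplex N B Y" and a' [simp]: "is_chain_map B Y X a" using Y a by simp_all
  have "\<exists>P j1 j2 q1 q2. is_biproduct B (K i) (cobj Y i) P j1 j2 q1 q2" for i
    using biproductD(1)[OF b] by (intro biproducts) simp_all
  then obtain P j1 j2 q1 q2 where c: "\<And>i. is_biproduct B (K i) (cobj Y i) (P i) (j1 i) (j2 i) (q1 i) (q2 i)"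
    by metis
  obtain Q a'' where Q: "is_pullback CN X A Y Q f a a'' q2" "\<And>i. cobj Q i = P i"
    by (rule pullback_complex[OF 1(2,1) Y' 1(3) a' pullback_of_biproduct[OF b c chain_map_in[OF a']]]) blast
  have "admissible_epi SN Q Y q2"
  proof (rule admissible_epiI)
    show "\<exists>K k s r. is_biproduct B K (cobj Y i) (cobj Q i) k s r (q2 i)" for i
      unfolding Q(2) using c by blast
  qed (use CN.pullbackD[OF Q(1)] in simp_all)
  then show "\<exists>P a' f'. is_pullback CN X A Y P f a a' f' \<and> admissible_epi SN P Y f'"
    using Q(1) by blast
qed

section \<open>Sums of discs\<close>

text \<open>
  The disc on an object A ending in degree m is the complex with A in degrees m - N + 1, ..., m and
  identities as differentials between them. A disc sum is the sum over all m of the discs on M m ending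
  in degree m. Its object in degree i is the finite biproduct of M i, ..., M (i + N - 1), and its
  differential drops the summand M i and keeps the others. It depends on a family of objects only.
\<close>

definition is_disc_sum ::
    "(int \<Rightarrow> 'o) \<Rightarrow> ('o, 'm) ncomplex \<Rightarrow> (int \<Rightarrow> int \<Rightarrow> 'm) \<Rightarrow> (int \<Rightarrow> int \<Rightarrow> 'm) \<Rightarrow> bool" where
  "is_disc_sum M J \<iota> p \<longleftrightarrow> is_ncomplex N B J \<and>
     (\<forall>i. is_finite_biproduct {i..<i + int N} M (cobj J i) (\<iota> i) (p i)) \<and>
     (\<forall>i. \<forall>m\<in>{i + 1..<i + 1 + int N}.
        Comp B (cobj J i) (cobj J (i + 1)) (M m) (p (i + 1) m) (cdiff J i)
        = (if m < i + int N then p i m else zero_mor B (cobj J i) (M m)))"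

lemma disc_sumD:
  assumes "is_disc_sum M J \<iota> p"
  shows "is_ncomplex N B J" "is_finite_biproduct {i..<i + int N} M (cobj J i) (\<iota> i) (p i)"
    and "m \<in> {i + 1..<i + 1 + int N} \<Longrightarrow>
        Comp B (cobj J i) (cobj J (i + 1)) (M m) (p (i + 1) m) (cdiff J i)
        = (if m < i + int N then p i m else zero_mor B (cobj J i) (M m))"
  using assms unfolding is_disc_sum_def by blast+

lemma disc_sum_in:
  assumes "is_disc_sum M J \<iota> p" "i \<le> m" "m < i + int N"
  shows "M m \<in> Obj B" "\<iota> i m \<in> mor B (M m) (cobj J i)" "p i m \<in> mor B (cobj J i) (M m)"
  using finite_biproductD(3-5)[OF disc_sumD(2)[OF assms(1), of i], of m] assms(2,3) by simp_all

lemma disc_sum_obj: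
  assumes "is_disc_sum M J \<iota> p"
  shows "M m \<in> Obj B"
  using disc_sum_in(1)[OF assms, of m m] N_pos by simp

lemma disc_sum_delta:
  assumes "is_disc_sum M J \<iota> p" "i \<le> m" "m < i + int N" "i \<le> l" "l < i + int N"
  shows "Comp B (M l) (cobj J i) (M m) (p i m) (\<iota> i l)
    = (if l = m then Ident B (M m) else zero_mor B (M l) (M m))"
  using finite_biproductD(6)[OF disc_sumD(2)[OF assms(1), of i], of m l] assms(2-5) by simp

lemma disc_sum_exists:
  assumes M: "\<And>m. M m \<in> Obj B"
  obtains J \<iota> p where "is_disc_sum M J \<iota> p"
proof -
  have "\<exists>P \<iota> p. is_finite_biproduct {i..<i + int N} M P \<iota> p" for i
    by (rule finite_biproduct_exists[of "{i..<i + int N}" M]) (simp_all add: M, blast)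
  then obtain P \<iota> p where b: "\<And>i. is_finite_biproduct {i..<i + int N} M (P i) (\<iota> i) (p i)"
    by metis
  have [simp]: "P i \<in> Obj B" for i using finite_biproductD(2)[OF b] .
  have p_in [simp]: "p i m \<in> mor B (P i) (M m)" if "i \<le> m" "m < i + int N" for i m
    using finite_biproductD(5)[OF b] that by simp
  have "\<exists>d. d \<in> mor B (P i) (P (i + 1)) \<and> (\<forall>m\<in>{i + 1..<i + 1 + int N}.
      Comp B (P i) (P (i + 1)) (M m) (p (i + 1) m) d
        = (if m < i + int N then p i m else zero_mor B (P i) (M m)))" for i
    by (rule finite_biproduct_in[OF b[of "i + 1"], of "P i"
          "\<lambda>m. if m < i + int N then p i m else zero_mor B (P i) (M m)"]) (simp, simp add: M, blast)
  then obtain D where D: "\<And>i. D i \<in> mor B (P i) (P (i + 1))"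
    "\<And>i m. i + 1 \<le> m \<Longrightarrow> m < i + 1 + int N \<Longrightarrow> Comp B (P i) (P (i + 1)) (M m) (p (i + 1) m) (D i)
        = (if m < i + int N then p i m else zero_mor B (P i) (M m))"
    by (metis atLeastLessThan_iff)
  define J where "J = \<lparr>cobj = P, cdiff = D\<rparr>"
  have J [simp]: "cobj J i = P i" "cdiff J i = D i" for i by (simp_all add: J_def)
  have sJ [simp]: "is_sequence J" by (rule is_sequenceI) (simp_all add: D)
  have dpath_J_in: "dpath J i j \<in> mor B (P i) (P j)" if "i \<le> j" for i j
    using dpath_in[OF sJ that] by simp
  have path: "Comp B (P i) (P j) (M m) (p j m) (dpath J i j)
      = (if m < i + int N then p i m else zero_mor B (P i) (M m))"
    if "i \<le> j" "j \<le> m" "m < j + int N" for i j m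
    using that
  proof (induction arbitrary: m rule: int_ge_induct)
    case base
    then show ?case by (simp add: M)
  next
    case (step j)
    then show ?case
      using step.IH[of m] by (simp add: M D Comp_eq_Comp[OF D(2)] dpath_step dpath_J_in)
  qed
  have "dpath J i (i + int N) = zero_mor B (P i) (P (i + int N))" for i
    by (rule finite_biproduct_in_eqI[OF b[of "i + int N"], where W = "P i"]) (simp_all add: M path dpath_J_in)
  then have "is_ncomplex N B J"
    unfolding is_ncomplex_iff by simp
  then have "is_disc_sum M J \<iota> p"
    unfolding is_disc_sum_def using b D by simp
  then show ?thesis by (rule that)
qed

lemma disc_sum_path:
  assumes J: "is_disc_sum M J \<iota> p" and ij: "i \<le> j" and "j \<le> m" "m < j + int N"
  shows "Comp B (cobj J i) (cobj J j) (M m) (p j m) (dpath J i j)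
      = (if m < i + int N then p i m else zero_mor B (cobj J i) (M m))"
  using ij assms(3,4)
proof (induction arbitrary: m rule: int_ge_induct)
  case base
  then show ?case using disc_sumD(1)[OF J] disc_sum_in[OF J] by simp
next
  case (step j)
  note [simp] = disc_sumD(1)[OF J] disc_sum_obj[OF J] disc_sum_in(2,3)[OF J]
  show ?case
    using step.hyps step.prems step.IH[of m]
    by (simp add: disc_sumD(3)[OF J] Comp_eq_Comp[OF disc_sumD(3)[OF J]] dpath_step)
qed

lemma disc_sum_inclusion_path:
  assumes J: "is_disc_sum M J \<iota> p" and "i \<le> j" "j \<le> m" "m < i + int N"
  shows "Comp B (M m) (cobj J i) (cobj J j) (dpath J i j) (\<iota> i m) = \<iota> j m"
proof (rule finite_biproduct_in_eqI[OF disc_sumD(2)[OF J, of j], where W = "M m"])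
  note [simp] = disc_sumD(1)[OF J] disc_sum_obj[OF J] disc_sum_in(2,3)[OF J]
  fix l assume l: "l \<in> {j..<j + int N}"
  have "Comp B (M m) (cobj J j) (M l) (p j l) (Comp B (M m) (cobj J i) (cobj J j) (dpath J i j) (\<iota> i m))
      = Comp B (M m) (cobj J i) (M l) (if l < i + int N then p i l else zero_mor B (cobj J i) (M l)) (\<iota> i m)"
    using l assms(2-4) by (simp add: Comp_eq_Comp[OF disc_sum_path[OF J]])
  then show "Comp B (M m) (cobj J j) (M l) (p j l) (Comp B (M m) (cobj J i) (cobj J j) (dpath J i j) (\<iota> i m))
    = Comp B (M m) (cobj J j) (M l) (p j l) (\<iota> j m)"
    using l assms(2-4) by (auto simp add: disc_sum_delta[OF J])
qed (use assms disc_sumD(1)[OF J] disc_sum_obj[OF J] disc_sum_in(2,3)[OF J] in simp_all)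

lemma disc_sum_inclusion_first:
  assumes J: "is_disc_sum M J \<iota> p"
  shows "Comp B (M i) (cobj J i) (cobj J (i + 1)) (cdiff J i) (\<iota> i i) = zero_mor B (M i) (cobj J (i + 1))"
proof (rule finite_biproduct_in_eqI[OF disc_sumD(2)[OF J, of "i + 1"], where W = "M i"])
  note [simp] = disc_sumD(1)[OF J] disc_sum_obj[OF J] disc_sum_in(2,3)[OF J] N_pos Suc_leI[OF N_pos]
  fix l assume l: "l \<in> {i + 1..<i + 1 + int N}"
  then show "Comp B (M i) (cobj J (i + 1)) (M l) (p (i + 1) l)
      (Comp B (M i) (cobj J i) (cobj J (i + 1)) (cdiff J i) (\<iota> i i))
    = Comp B (M i) (cobj J (i + 1)) (M l) (p (i + 1) l) (zero_mor B (M i) (cobj J (i + 1)))"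
    by (auto simp add: disc_sum_delta[OF J] Comp_eq_Comp[OF disc_sumD(3)[OF J]])
qed (use assms disc_sumD(1)[OF J] disc_sum_obj[OF J] disc_sum_in(2,3)[OF J] N_pos in simp_all)

text \<open>
  A chain map from X into a disc is determined by its component at the last degree of the disc, and this
  component is arbitrary: the others arise by precomposition with differentials of X, and the condition
  just before the first degree of the disc holds since N-fold composites of differentials vanish.
\<close>

lemma disc_sum_map_in:
  assumes J: "is_disc_sum M J \<iota> p" and X [simp]: "is_ncomplex N B X"
    and u [simp]: "\<And>m. u m \<in> mor B (cobj X m) (M m)"
  obtains h where "is_chain_map B X J h"
    "\<And>i m. i \<le> m \<Longrightarrow> m < i + int N \<Longrightarrow>
      Comp B (cobj X i) (cobj J i) (M m) (p i m) (h i) = Comp B (cobj X i) (cobj X m) (M m) (u m) (dpath X i m)"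
proof -
  note [simp] = disc_sumD(1)[OF J] disc_sum_obj[OF J] disc_sum_in(2,3)[OF J] N_pos Suc_leI[OF N_pos]
  have "\<exists>h. h \<in> mor B (cobj X i) (cobj J i) \<and> (\<forall>m\<in>{i..<i + int N}.
      Comp B (cobj X i) (cobj J i) (M m) (p i m) h = Comp B (cobj X i) (cobj X m) (M m) (u m) (dpath X i m))" for i
    by (rule finite_biproduct_in[OF disc_sumD(2)[OF J, of i], of "cobj X i"
          "\<lambda>m. Comp B (cobj X i) (cobj X m) (M m) (u m) (dpath X i m)"]) (simp, simp, blast)
  then obtain h where h: "\<And>i. h i \<in> mor B (cobj X i) (cobj J i)"
    "\<And>i m. i \<le> m \<Longrightarrow> m < i + int N \<Longrightarrow> Comp B (cobj X i) (cobj J i) (M m) (p i m) (h i)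
      = Comp B (cobj X i) (cobj X m) (M m) (u m) (dpath X i m)"
    by (metis atLeastLessThan_iff)
  have "is_chain_map B X J h"
  proof (rule chain_mapI)
    fix i
    show "Comp B (cobj X i) (cobj X (i + 1)) (cobj J (i + 1)) (h (i + 1)) (cdiff X i)
      = Comp B (cobj X i) (cobj J i) (cobj J (i + 1)) (cdiff J i) (h i)"
    proof (rule finite_biproduct_in_eqI[OF disc_sumD(2)[OF J, of "i + 1"], where W = "cobj X i"])
      fix m assume m: "m \<in> {i + 1..<i + 1 + int N}"
      have z: "dpath X i m = zero_mor B (cobj X i) (cobj X m)" if "\<not> m < i + int N"
        using that by (intro dpath_zero) simp_all
      show "Comp B (cobj X i) (cobj J (i + 1)) (M m) (p (i + 1) m)
          (Comp B (cobj X i) (cobj X (i + 1)) (cobj J (i + 1)) (h (i + 1)) (cdiff X i))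
        = Comp B (cobj X i) (cobj J (i + 1)) (M m) (p (i + 1) m)
          (Comp B (cobj X i) (cobj J i) (cobj J (i + 1)) (cdiff J i) (h i))"
        using m by (simp add: h z Comp_eq_Comp[OF h(2)] Comp_eq_Comp[OF disc_sumD(3)[OF J]] dpath_step')
    qed (simp_all add: h)
  qed (simp add: h)
  then show ?thesis using h(2) by (rule that)
qed

lemma disc_sum_map_in_component:
  assumes J: "is_disc_sum M J \<iota> p" and X [simp]: "is_ncomplex N B X" and h [simp]: "is_chain_map B X J h"
    and m: "i \<le> m" "m < i + int N"
  shows "Comp B (cobj X i) (cobj J i) (M m) (p i m) (h i)
    = Comp B (cobj X i) (cobj X m) (M m) (Comp B (cobj X m) (cobj J m) (M m) (p m m) (h m)) (dpath X i m)"
proof -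
  note [simp] = disc_sumD(1)[OF J] disc_sum_obj[OF J] disc_sum_in(2,3)[OF J] N_pos Suc_leI[OF N_pos]
  have "p i m = Comp B (cobj J i) (cobj J m) (M m) (p m m) (dpath J i m)"
    using m by (simp add: disc_sum_path[OF J])
  then show ?thesis
    using m by (simp add: chain_map_dpath[where Y = J])
qed

text \<open>
  The component in degree i of the chain map to Y, on the disc ending in degree m, that is v m in the
  first degree m - N + 1 of this disc.
\<close>

abbreviation disc_out ::
    "(int \<Rightarrow> 'o) \<Rightarrow> ('o, 'm) ncomplex \<Rightarrow> (int \<Rightarrow> 'm) \<Rightarrow> int \<Rightarrow> int \<Rightarrow> 'm" where
  "disc_out M Y v i m \<equiv>
     Comp B (M m) (cobj Y (m - int N + 1)) (cobj Y i) (dpath Y (m - int N + 1) i) (v m)"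

text \<open>
  Dually, a chain map from a disc is determined by its component at the first degree of the disc, and
  this component is arbitrary.
\<close>

lemma disc_sum_map_out:
  assumes J: "is_disc_sum M J \<iota> p" and Y [simp]: "is_ncomplex N B Y"
    and v [simp]: "\<And>m. v m \<in> mor B (M m) (cobj Y (m - int N + 1))"
  obtains h where "is_chain_map B J Y h"
    "\<And>i m. i \<le> m \<Longrightarrow> m < i + int N \<Longrightarrow> Comp B (M m) (cobj J i) (cobj Y i) (h i) (\<iota> i m)
      = disc_out M Y v i m"
proof -
  note [simp] = disc_sumD(1)[OF J] disc_sum_obj[OF J] disc_sum_in(2,3)[OF J] N_pos Suc_leI[OF N_pos]
  have "\<exists>h. h \<in> mor B (cobj J i) (cobj Y i) \<and> (\<forall>m\<in>{i..<i + int N}.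
      Comp B (M m) (cobj J i) (cobj Y i) h (\<iota> i m)
      = disc_out M Y v i m)" for i
    by (rule finite_biproduct_out[OF disc_sumD(2)[OF J, of i], of "cobj Y i"
          "\<lambda>m. disc_out M Y v i m"])
      (simp, simp, blast)
  then obtain h where h: "\<And>i. h i \<in> mor B (cobj J i) (cobj Y i)"
    "\<And>i m. i \<le> m \<Longrightarrow> m < i + int N \<Longrightarrow> Comp B (M m) (cobj J i) (cobj Y i) (h i) (\<iota> i m)
      = disc_out M Y v i m"
    by (metis atLeastLessThan_iff)
  have "is_chain_map B J Y h"
  proof (rule chain_mapI)
    fix i
    show "Comp B (cobj J i) (cobj J (i + 1)) (cobj Y (i + 1)) (h (i + 1)) (cdiff J i)
      = Comp B (cobj J i) (cobj Y i) (cobj Y (i + 1)) (cdiff Y i) (h i)"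
    proof (rule finite_biproduct_out_eqI[OF disc_sumD(2)[OF J, of i], where W = "cobj Y (i + 1)"])
      fix m assume m: "m \<in> {i..<i + int N}"
      have d: "Comp B (M m) (cobj J i) (cobj J (i + 1)) (cdiff J i) (\<iota> i m)
          = (if m = i then zero_mor B (M m) (cobj J (i + 1)) else \<iota> (i + 1) m)"
        using m disc_sum_inclusion_first[OF J, of i] disc_sum_inclusion_path[OF J, of i "i + 1" m]
        by (auto simp: dpath_step)
      have z: "dpath Y (i - int N + 1) (i + 1) = zero_mor B (cobj Y (i - int N + 1)) (cobj Y (i + 1))"
        by (intro dpath_zero) simp_all
      have s: "Comp B (M m) (cobj Y i) (cobj Y (i + 1)) (cdiff Y i)
          (disc_out M Y v i m)
        = Comp B (M m) (cobj Y (m - int N + 1)) (cobj Y (i + 1)) (dpath Y (m - int N + 1) (i + 1)) (v m)"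
        using m by (simp add: dpath_step)
      show "Comp B (M m) (cobj J i) (cobj Y (i + 1))
          (Comp B (cobj J i) (cobj J (i + 1)) (cobj Y (i + 1)) (h (i + 1)) (cdiff J i)) (\<iota> i m)
        = Comp B (M m) (cobj J i) (cobj Y (i + 1))
          (Comp B (cobj J i) (cobj Y i) (cobj Y (i + 1)) (cdiff Y i) (h i)) (\<iota> i m)"
      proof (cases "m = i")
        case True
        show ?thesis using d s unfolding True by (simp add: h z)
      next
        case False
        then show ?thesis using m by (simp add: h s d)
      qed
    qed (simp_all add: h)
  qed (simp add: h)
  then show ?thesis using h(2) by (rule that)
qed

lemma disc_sum_map_out_component:
  assumes J: "is_disc_sum M J \<iota> p" and Y [simp]: "is_ncomplex N B Y" and h [simp]: "is_chain_map B J Y h"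
    and m: "i \<le> m" "m < i + int N"
  shows "Comp B (M m) (cobj J i) (cobj Y i) (h i) (\<iota> i m)
    = Comp B (M m) (cobj Y (m - int N + 1)) (cobj Y i) (dpath Y (m - int N + 1) i)
        (Comp B (M m) (cobj J (m - int N + 1)) (cobj Y (m - int N + 1)) (h (m - int N + 1)) (\<iota> (m - int N + 1) m))"
proof -
  note [simp] = disc_sumD(1)[OF J] disc_sum_obj[OF J] disc_sum_in(2,3)[OF J] N_pos Suc_leI[OF N_pos]
  have "\<iota> i m = Comp B (M m) (cobj J (m - int N + 1)) (cobj J i) (dpath J (m - int N + 1) i) (\<iota> (m - int N + 1) m)"
    using m by (simp add: disc_sum_inclusion_path[OF J])
  then show ?thesis
    using m by (simp add: Comp_eq_Comp[OF chain_map_dpath[OF h]])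
qed

text \<open>
  By the description of chain maps into a disc sum, an extension along f : X --> Y is found by composing
  the determining components with degreewise retractions of f, which need not be compatible with the
  differentials.
\<close>

lemma disc_sum_injective:
  assumes J: "is_disc_sum M J \<iota> p"
  shows "injective CN SN J"
  unfolding injective_def
proof (intro conjI allI impI ballI)
  note [simp] = disc_sumD(1)[OF J] disc_sum_obj[OF J] disc_sum_in(2,3)[OF J] N_pos Suc_leI[OF N_pos]
  show "J \<in> Obj CN" by simp
  fix X Y f h assume f: "admissible_mono SN X Y f" and "h \<in> mor CN X J"
  then have h [simp]: "is_chain_map B X J h" by simp
  obtain Z s r g where XY [simp]: "is_ncomplex N B X" "is_ncomplex N B Y" and f' [simp]: "is_chain_map B X Y f"
    and b: "\<And>i. is_biproduct B (cobj X i) (Z i) (cobj Y i) (f i) (s i) (r i) (g i)"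
    by (rule admissible_monoE[OF f]) (rule that)
  note [simp] = biproductD[OF b] biproduct_reassoc[OF b]
  obtain k where k [simp]: "is_chain_map B Y J k" and k_p: "\<And>i m. i \<le> m \<Longrightarrow> m < i + int N \<Longrightarrow>
      Comp B (cobj Y i) (cobj J i) (M m) (p i m) (k i) = Comp B (cobj Y i) (cobj Y m) (M m)
        (Comp B (cobj Y m) (cobj X m) (M m) (Comp B (cobj X m) (cobj J m) (M m) (p m m) (h m)) (r m)) (dpath Y i m)"
    by (rule disc_sum_map_in[OF J XY(2), of "\<lambda>m. Comp B (cobj Y m) (cobj X m) (M m)
          (Comp B (cobj X m) (cobj J m) (M m) (p m m) (h m)) (r m)"]) (simp, rule that)
  have "Comp B (cobj X i) (cobj Y i) (cobj J i) (k i) (f i) = h i" for i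
  proof (rule finite_biproduct_in_eqI[OF disc_sumD(2)[OF J, of i], where W = "cobj X i"])
    fix m assume "m \<in> {i..<i + int N}"
    then have m [simp]: "i \<le> m" "m < i + int N" by simp_all
    show "Comp B (cobj X i) (cobj J i) (M m) (p i m) (Comp B (cobj X i) (cobj Y i) (cobj J i) (k i) (f i))
        = Comp B (cobj X i) (cobj J i) (M m) (p i m) (h i)"
      by (simp add: Comp_eq_Comp[OF k_p] disc_sum_map_in_component[OF J XY(1) h m]
          flip: chain_map_dpath[OF f'])
  qed simp_all
  then show "\<exists>k\<in>mor CN Y J. Comp CN X Y J k f = h"
    by (intro bexI[of _ k]) auto
qed

text \<open>
  Dually, the determining components of a lift are composites with degreewise sections.
\<close>

lemma disc_sum_projective:
  assumes J: "is_disc_sum M J \<iota> p"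
  shows "projective CN SN J"
  unfolding projective_def
proof (intro conjI allI impI ballI)
  note [simp] = disc_sumD(1)[OF J] disc_sum_obj[OF J] disc_sum_in(2,3)[OF J] N_pos Suc_leI[OF N_pos]
  show "J \<in> Obj CN" by simp
  fix Y Z g h assume g: "admissible_epi SN Y Z g" and "h \<in> mor CN J Z"
  then have h [simp]: "is_chain_map B J Z h" by simp
  obtain K f s r where YZ [simp]: "is_ncomplex N B Y" "is_ncomplex N B Z" and g' [simp]: "is_chain_map B Y Z g"
    and b: "\<And>i. is_biproduct B (K i) (cobj Z i) (cobj Y i) (f i) (s i) (r i) (g i)"
    by (rule admissible_epiE[OF g]) (rule that)
  note [simp] = biproductD[OF b] biproduct_reassoc[OF b]
  define v where "v m = Comp B (M m) (cobj Z (m - int N + 1)) (cobj Y (m - int N + 1)) (s (m - int N + 1))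
      (Comp B (M m) (cobj J (m - int N + 1)) (cobj Z (m - int N + 1)) (h (m - int N + 1)) (\<iota> (m - int N + 1) m))" for m
  have v [simp]: "v m \<in> mor B (M m) (cobj Y (m - int N + 1))" for m
    by (simp add: v_def)
  obtain k where k [simp]: "is_chain_map B J Y k" and k_\<iota>: "\<And>i m. i \<le> m \<Longrightarrow> m < i + int N \<Longrightarrow>
      Comp B (M m) (cobj J i) (cobj Y i) (k i) (\<iota> i m)
      = disc_out M Y v i m"
    by (rule disc_sum_map_out[OF J YZ(1), of v]) (rule v, rule that)
  have "Comp B (cobj J i) (cobj Y i) (cobj Z i) (g i) (k i) = h i" for i
  proof (rule finite_biproduct_out_eqI[OF disc_sumD(2)[OF J, of i], where W = "cobj Z i"])
    fix m assume "m \<in> {i..<i + int N}"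
    then have m [simp]: "i \<le> m" "m < i + int N" by simp_all
    show "Comp B (M m) (cobj J i) (cobj Z i) (Comp B (cobj J i) (cobj Y i) (cobj Z i) (g i) (k i)) (\<iota> i m)
        = Comp B (M m) (cobj J i) (cobj Z i) (h i) (\<iota> i m)"
    proof -
      have ij: "m - int N + 1 \<le> i" using m by linarith
      have "Comp B (M m) (cobj J i) (cobj Z i) (h i) (\<iota> i m)
        = Comp B (M m) (cobj Z (m - int N + 1)) (cobj Z i) (dpath Z (m - int N + 1) i)
          (Comp B (M m) (cobj Y (m - int N + 1)) (cobj Z (m - int N + 1)) (g (m - int N + 1)) (v m))"
        by (simp add: disc_sum_map_out_component[OF J YZ(2) h m], simp add: v_def)
      also have "\<dots> = Comp B (M m) (cobj Y i) (cobj Z i) (g i)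
          (disc_out M Y v i m)"
        using Comp_eq_Comp[OF chain_map_dpath[OF g' _ _ ij], of "M m" "v m"] ij by simp
      finally show ?thesis by (simp add: k_\<iota>)
    qed
  qed simp_all
  then show "\<exists>k\<in>mor CN J Y. Comp CN J Y Z g k = h"
    by (intro bexI[of _ k]) auto
qed

text \<open>
  The map that corresponds to the identities of the objects X m. Its component in the summand X i of
  degree i is the identity, so that biproduct_change_mono provides the splitting.
\<close>

lemma embedding_into_disc_sum:
  assumes X [simp]: "is_ncomplex N B X"
  obtains J \<iota> p \<epsilon> where "is_disc_sum (cobj X) J \<iota> p" "admissible_mono SN X J \<epsilon>"
    "\<And>i m. i \<le> m \<Longrightarrow> m < i + int N \<Longrightarrow> Comp B (cobj X i) (cobj J i) (cobj X m) (p i m) (\<epsilon> i) = dpath X i m"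
proof -
  obtain J \<iota> p where J: "is_disc_sum (cobj X) J \<iota> p"
    by (rule disc_sum_exists[of "cobj X"]) simp_all
  note [simp] = disc_sumD(1)[OF J] disc_sum_in(2,3)[OF J] N_pos Suc_leI[OF N_pos]
  obtain \<epsilon> where e [simp]: "is_chain_map B X J \<epsilon>" and "\<And>i m. i \<le> m \<Longrightarrow> m < i + int N \<Longrightarrow>
      Comp B (cobj X i) (cobj J i) (cobj X m) (p i m) (\<epsilon> i)
      = Comp B (cobj X i) (cobj X m) (cobj X m) (Ident B (cobj X m)) (dpath X i m)"
    by (rule disc_sum_map_in[OF J X, of "\<lambda>m. Ident B (cobj X m)"]) (simp, rule that)
  then have pe: "Comp B (cobj X i) (cobj J i) (cobj X m) (p i m) (\<epsilon> i) = dpath X i m"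
    if "i \<le> m" "m < i + int N" for i m
    using that by simp
  have "admissible_mono SN X J \<epsilon>"
  proof (rule admissible_monoI)
    fix i
    obtain W s g where b: "is_biproduct B (cobj X i) W (cobj J i) (\<iota> i i) s (p i i) g"
      by (rule finite_biproduct_summand[OF disc_sumD(2)[OF J, of i], of i]) (simp, rule that)
    show "\<exists>Z s r g. is_biproduct B (cobj X i) Z (cobj J i) (\<epsilon> i) s r g"
      using biproduct_change_mono[OF b chain_map_in[OF e]] pe[of i i] by auto
  qed simp_all
  then show ?thesis using that J pe by blast
qed

text \<open>
  Dually, X is covered by the sum of the discs that begin with the objects of X. Here the summand with
  the largest index i + N - 1 in degree i is a copy of X i.
\<close>

lemma cover_by_disc_sum:
  assumes X [simp]: "is_ncomplex N B X"
  obtains M J \<iota> p \<epsilon> where "is_disc_sum M J \<iota> p" "admissible_epi SN J X \<epsilon>"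
proof -
  define M where "M m = cobj X (m - int N + 1)" for m
  obtain J \<iota> p where J: "is_disc_sum M J \<iota> p"
    by (rule disc_sum_exists[of M]) (simp_all add: M_def)
  note [simp] = disc_sumD(1)[OF J] disc_sum_in(2,3)[OF J] N_pos Suc_leI[OF N_pos]
  obtain \<epsilon> where e [simp]: "is_chain_map B J X \<epsilon>" and e\<iota>: "\<And>i m. i \<le> m \<Longrightarrow> m < i + int N \<Longrightarrow>
      Comp B (M m) (cobj J i) (cobj X i) (\<epsilon> i) (\<iota> i m)
      = Comp B (M m) (cobj X (m - int N + 1)) (cobj X i) (dpath X (m - int N + 1) i) (Ident B (M m))"
    by (rule disc_sum_map_out[OF J X, of "\<lambda>m. Ident B (M m)"]) (simp add: M_def, rule that)
  have "admissible_epi SN J X \<epsilon>"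
  proof (rule admissible_epiI)
    fix i
    have Mi: "M (i + int N - 1) = cobj X i" by (simp add: M_def)
    have k: "i + int N - 1 \<in> {i..<i + int N}" using N_pos by simp
    obtain W s g where b: "is_biproduct B (M (i + int N - 1)) W (cobj J i) (\<iota> i (i + int N - 1)) s (p i (i + int N - 1)) g"
      by (rule finite_biproduct_summand[OF disc_sumD(2)[OF J, of i] k]) (rule that)
    have "Comp B (M (i + int N - 1)) (cobj J i) (cobj X i) (\<epsilon> i) (\<iota> i (i + int N - 1)) = Ident B (cobj X i)"
      using e\<iota>[of i "i + int N - 1"] by (simp add: Mi)
    then show "\<exists>K f s r. is_biproduct B K (cobj X i) (cobj J i) f s r (\<epsilon> i)"
      using biproduct_change_epi[OF biproduct_swap[OF b[unfolded Mi]] chain_map_in[OF e]] unfolding Mi by blast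
  qed simp_all
  then show ?thesis using that J by blast
qed

end

section \<open>The Frobenius property and null-homotopic maps\<close>

context exact_category
begin

lemma admissible_monoD:
  assumes "admissible_mono S X Y f"
  shows "X \<in> Obj C" "Y \<in> Obj C" "f \<in> mor C X Y"
  using assms conflation unfolding admissible_mono_def kernel_cokernel_pair_def is_kernel_def by fast+

lemma admissible_epiD:
  assumes "admissible_epi S X Y f"
  shows "X \<in> Obj C" "Y \<in> Obj C" "f \<in> mor C X Y"
  using assms conflation unfolding admissible_epi_def kernel_cokernel_pair_def is_kernel_def by fast+

lemma injective_retract:
  assumes I: "injective C S I" and P: "P \<in> Obj C" and i: "i \<in> mor C P I" and r: "r \<in> mor C I P"
    and ri: "Comp C P I P r i = Ident C P"
  shows "injective C S P"
  unfolding injective_def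
proof (intro conjI allI impI ballI P)
  fix X Y f h assume f: "admissible_mono S X Y f" and h: "h \<in> mor C X P"
  have I': "I \<in> Obj C" using I by (simp add: injective_def)
  note [simp] = admissible_monoD[OF f] h P i r I' Comp_eq_Comp[OF ri]
  have "Comp C X P I i h \<in> mor C X I" by simp
  then obtain k where k [simp]: "k \<in> mor C Y I" and kf: "Comp C X Y I k f = Comp C X P I i h"
    using I f unfolding injective_def by blast
  show "\<exists>k\<in>mor C Y P. Comp C X Y P k f = h"
    by (rule bexI[of _ "Comp C Y I P r k"]) (simp_all add: kf)
qed

lemma projective_retract:
  assumes I: "projective C S I" and P: "P \<in> Obj C" and i: "i \<in> mor C P I" and r: "r \<in> mor C I P"
    and ri: "Comp C P I P r i = Ident C P"
  shows "projective C S P"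
  unfolding projective_def
proof (intro conjI allI impI ballI P)
  fix Y Z g h assume g: "admissible_epi S Y Z g" and h: "h \<in> mor C P Z"
  have I': "I \<in> Obj C" using I by (simp add: projective_def)
  note [simp] = admissible_epiD[OF g] h P i r I' ri
  have "Comp C I P Z h r \<in> mor C I Z" by simp
  then obtain k where k [simp]: "k \<in> mor C I Y" and gk: "Comp C I Y Z g k = Comp C I P Z h r"
    using I g unfolding projective_def by blast
  show "\<exists>k\<in>mor C P Y. Comp C P Y Z g k = h"
    by (rule bexI[of _ "Comp C P I Y k i"]) (simp_all add: Comp_eq_Comp[OF gk])
qed

text \<open>
  If objects that are both projective and injective suffice on both sides, then every projective and
  every injective is a retract of such an object, and hence has both properties.
\<close>

lemma frobenius_categoryI:
  assumes inj: "\<And>X. X \<in> Obj C \<Longrightarrow> \<exists>J f. projective C S J \<and> injective C S J \<and> admissible_mono S X J f"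
    and proj: "\<And>X. X \<in> Obj C \<Longrightarrow> \<exists>J g. projective C S J \<and> injective C S J \<and> admissible_epi S J X g"
  shows "frobenius_category C S"
proof (intro frobenius_category.intro frobenius_category_axioms.intro)
  show "exact_category C S" by (rule exact_category_axioms)
  show "\<exists>P g. projective C S P \<and> admissible_epi S P X g" if "X \<in> Obj C" for X
    using proj[OF that] by blast
  show "\<exists>I f. injective C S I \<and> admissible_mono S X I f" if "X \<in> Obj C" for X
    using inj[OF that] by blast
  show "projective C S P \<longleftrightarrow> injective C S P" for P
  proof
    assume P: "projective C S P"
    then have P': "P \<in> Obj C" by (simp add: projective_def)
    obtain J g where J: "injective C S J" "admissible_epi S J P g"
      using proj[OF P'] by blast
    then obtain k where "k \<in> mor C P J" "Comp C P J P g k = Ident C P"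
      using P Ident_in[OF P'] unfolding projective_def by blast
    then show "injective C S P"
      by (rule injective_retract[OF J(1) P' _ admissible_epiD(3)[OF J(2)]])
  next
    assume P: "injective C S P"
    then have P': "P \<in> Obj C" by (simp add: injective_def)
    obtain J f where J: "projective C S J" "admissible_mono S P J f"
      using inj[OF P'] by blast
    then obtain k where "k \<in> mor C J P" "Comp C P J P k f = Ident C P"
      using P Ident_in[OF P'] unfolding injective_def by blast
    then show "projective C S P"
      by (rule projective_retract[OF J(1) P' admissible_monoD(3)[OF J(2)]])
  qed
qed

end

context additive_complexes
begin

lemma frobenius_CN: "frobenius_category CN SN"
proof (rule exact_category.frobenius_categoryI[OF exact_CN])
  fix X assume "X \<in> Obj CN"
  then have X: "is_ncomplex N B X" by simp
  show "\<exists>J f. projective CN SN J \<and> injective CN SN J \<and> admissible_mono SN X J f"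
    using embedding_into_disc_sum[OF X] disc_sum_projective disc_sum_injective by metis
  show "\<exists>J g. projective CN SN J \<and> injective CN SN J \<and> admissible_epi SN J X g"
    using cover_by_disc_sum[OF X] disc_sum_projective disc_sum_injective by metis
qed

abbreviation homotopy_sum ::
    "('o, 'm) ncomplex \<Rightarrow> ('o, 'm) ncomplex \<Rightarrow> (int \<Rightarrow> 'm) \<Rightarrow> int \<Rightarrow> 'm" where
  "homotopy_sum X Y s i \<equiv> finprod (Hom B (cobj X i) (cobj Y i))
     (\<lambda>m. Comp B (cobj X i) (cobj X m) (cobj Y i) (disc_out (cobj X) Y s i m) (dpath X i m))
     {i..<i + int N}"

text \<open>
  The sum over j in the definition of a null-homotopy, indexed by the degree m = i + j - 1 that the
  homotopy is applied in.
\<close>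

lemma null_homotopic_alt:
  assumes X: "is_ncomplex N B X" and Y: "is_ncomplex N B Y"
  shows "null_homotopic N B X Y f \<longleftrightarrow>
    (\<exists>s. (\<forall>m. s m \<in> mor B (cobj X m) (cobj Y (m - int N + 1))) \<and>
      (\<forall>i. f i = homotopy_sum X Y s i))"
proof -
  note [simp] = X Y
  have "homotopy_sum X Y s i
      = (\<Otimes>\<^bsub>Hom B (cobj X i) (cobj Y i)\<^esub>j\<in>{1..N}.
           Comp B (cobj X i) (cobj Y (i - int N + int j)) (cobj Y i)
             (cdiff_pow B Y (i - int N + int j) (N - j))
             (Comp B (cobj X i) (cobj X (i + int j - 1)) (cobj Y (i - int N + int j))
                (s (i + int j - 1))
                (cdiff_pow B X i (j - 1))))" (is "finprod ?H ?F _ = finprod _ ?G _")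
    if s: "\<And>m. s m \<in> mor B (cobj X m) (cobj Y (m - int N + 1))" for s i
  proof -
    interpret comm_group ?H by (rule Hom_group) simp_all
    have FG: "?F (i + int j - 1) = ?G j" if "j \<in> {1..N}" for j
    proof -
      have i: "i + int j - 1 - int N + 1 = i - int N + int j" by simp
      have "nat (i - (i - int N + int j)) = N - j" "nat (i + int j - 1 - i) = j - 1"
        using that by auto
      then have d: "cdiff_pow B Y (i - int N + int j) (N - j) = dpath Y (i - int N + int j) i"
        "cdiff_pow B X i (j - 1) = dpath X i (i + int j - 1)"
        by (simp_all add: dpath_def)
      show ?thesis
        unfolding i d using that s[of "i + int j - 1", unfolded i] by simp
    qed
    have F: "?F m \<in> carrier ?H" if "m \<in> {i..<i + int N}" for m
      using that s by simp
    have G: "?G j \<in> carrier ?H" if "j \<in> {1..N}" for j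
      unfolding FG[OF that, symmetric] by (rule F) (use that in auto)
    have im: "(\<lambda>j. i + int j - 1) ` {1..N} = {i..<i + int N}"
    proof (intro equalityI subsetI)
      fix m assume "m \<in> {i..<i + int N}"
      then show "m \<in> (\<lambda>j. i + int j - 1) ` {1..N}"
        by (intro image_eqI[of _ _ "nat (m - i + 1)"]) auto
    qed auto
    have "finprod ?H ?F {i..<i + int N} = finprod ?H (\<lambda>j. ?F (i + int j - 1)) {1..N}"
      unfolding im[symmetric] by (rule finprod_reindex) (use F im in \<open>auto simp: inj_on_def\<close>)
    also have "\<dots> = finprod ?H ?G {1..N}"
      by (intro finprod_cong' refl Pi_I G FG)
    finally show ?thesis .
  qed
  note eq = this
  show ?thesis
    unfolding null_homotopic_def
    by (intro ex_cong1 conj_cong refl all_cong1) (subst eq, blast, rule refl)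
qed

text \<open>
  A chain map h from the disc sum on X to Y is the same as a family s m : X m --> Y (m - N + 1), by its
  components at the first degrees of the discs. Expanding h after the embedding of X along the summands
  of the disc sum yields exactly the homotopy formula for s.
\<close>

lemma null_homotopic_iff_factors:
  assumes X: "is_ncomplex N B X" and Y: "is_ncomplex N B Y"
    and J: "is_disc_sum (cobj X) J \<iota> p" and e: "is_chain_map B X J \<epsilon>"
    and pe: "\<And>i m. i \<le> m \<Longrightarrow> m < i + int N \<Longrightarrow>
      Comp B (cobj X i) (cobj J i) (cobj X m) (p i m) (\<epsilon> i) = dpath X i m"
  shows "null_homotopic N B X Y f \<longleftrightarrow> (\<exists>h. is_chain_map B J Y h \<and> f = Comp CN X J Y h \<epsilon>)"
proof -
  note [simp] = X Y e disc_sumD(1)[OF J] disc_sum_in(2,3)[OF J] N_pos Suc_leI[OF N_pos]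
  have expand: "Comp CN X J Y h \<epsilon> i = homotopy_sum X Y s i"
    if h [simp]: "is_chain_map B J Y h" and s [simp]: "\<And>m. s m \<in> mor B (cobj X m) (cobj Y (m - int N + 1))"
      and hs: "\<And>m. i \<le> m \<Longrightarrow> m < i + int N \<Longrightarrow> Comp B (cobj X m) (cobj J i) (cobj Y i) (h i) (\<iota> i m)
      = disc_out (cobj X) Y s i m" for h s i
  proof -
    have "Comp CN X J Y h \<epsilon> i = finprod (Hom B (cobj X i) (cobj Y i))
        (\<lambda>m. Comp B (cobj X i) (cobj X m) (cobj Y i)
          (Comp B (cobj X m) (cobj J i) (cobj Y i) (h i) (\<iota> i m))
          (Comp B (cobj X i) (cobj J i) (cobj X m) (p i m) (\<epsilon> i))) {i..<i + int N}"
      unfolding CN_simps by (rule finite_biproduct_expand[OF disc_sumD(2)[OF J]]) simp_all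
    also have "\<dots> = homotopy_sum X Y s i"
      by (rule finprod_eqI) (simp_all add: pe hs)
    finally show ?thesis .
  qed
  show ?thesis
  proof
    assume "null_homotopic N B X Y f"
    then obtain s where s: "\<And>m. s m \<in> mor B (cobj X m) (cobj Y (m - int N + 1))"
      and f: "\<And>i. f i = homotopy_sum X Y s i"
      unfolding null_homotopic_alt[OF X Y] by blast
    obtain h where h: "is_chain_map B J Y h" "\<And>i m. i \<le> m \<Longrightarrow> m < i + int N \<Longrightarrow>
      Comp B (cobj X m) (cobj J i) (cobj Y i) (h i) (\<iota> i m)
      = disc_out (cobj X) Y s i m"
      by (rule disc_sum_map_out[OF J Y s]) (rule that)
    have "f = Comp CN X J Y h \<epsilon>"
    proof (rule ext)
      show "f i = Comp CN X J Y h \<epsilon> i" for i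
        unfolding f by (rule expand[symmetric]) (simp_all only: h s)
    qed
    then show "\<exists>h. is_chain_map B J Y h \<and> f = Comp CN X J Y h \<epsilon>"
      using h(1) by blast
  next
    assume "\<exists>h. is_chain_map B J Y h \<and> f = Comp CN X J Y h \<epsilon>"
    then obtain h where h [simp]: "is_chain_map B J Y h" and f: "f = Comp CN X J Y h \<epsilon>" by blast
    define s where "s m = Comp B (cobj X m) (cobj J (m - int N + 1)) (cobj Y (m - int N + 1))
      (h (m - int N + 1)) (\<iota> (m - int N + 1) m)" for m
    have s: "s m \<in> mor B (cobj X m) (cobj Y (m - int N + 1))" for m
      by (simp add: s_def)
    show "null_homotopic N B X Y f"
      unfolding null_homotopic_alt[OF X Y]
    proof (intro exI[of _ s] conjI allI s)
      fix i
      show "f i = homotopy_sum X Y s i"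
        unfolding f
        by (rule expand[OF h s]) (unfold s_def, rule disc_sum_map_out_component[OF J Y h])
    qed
  qed
qed

text \<open>
  A map that factors through some injective also factors through the disc sum that X embeds into, since
  the first factor extends along the embedding.
\<close>

lemma stable_ideal_CN:
  assumes X: "X \<in> Obj CN" and Y: "Y \<in> Obj CN"
  shows "stable_ideal CN SN X Y = {f \<in> mor CN X Y. null_homotopic N B X Y f}"
proof -
  have X': "is_ncomplex N B X" and Y': "is_ncomplex N B Y" using X Y by simp_all
  obtain J \<iota> p \<epsilon> where J: "is_disc_sum (cobj X) J \<iota> p" and e: "admissible_mono SN X J \<epsilon>"
    and pe: "\<And>i m. i \<le> m \<Longrightarrow> m < i + int N \<Longrightarrow>
      Comp B (cobj X i) (cobj J i) (cobj X m) (p i m) (\<epsilon> i) = dpath X i m"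
    by (rule embedding_into_disc_sum[OF X']) (rule that)
  interpret E: exact_category CN SN by (rule exact_CN)
  have J': "J \<in> Obj CN" and e': "\<epsilon> \<in> mor CN X J" "is_chain_map B X J \<epsilon>"
    using E.admissible_monoD[OF e] by simp_all
  note nh = null_homotopic_iff_factors[OF X' Y' J e'(2) pe]
  show ?thesis
  proof (intro equalityI subsetI)
    fix f assume "f \<in> stable_ideal CN SN X Y"
    then obtain P a b where f: "f \<in> mor CN X Y" "f = Comp CN X P Y b a"
      and P: "injective CN SN P" and ab: "a \<in> mor CN X P" "b \<in> mor CN P Y"
      unfolding stable_ideal_def by blast
    have P': "P \<in> Obj CN" using P by (simp add: injective_def)
    obtain k where k: "k \<in> mor CN J P" "Comp CN X J P k \<epsilon> = a"
      using P e ab(1) unfolding injective_def by blast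
    have "Comp CN J P Y b k \<in> mor CN J Y"
      by (rule CN.Comp_in[OF J' P' Y k(1) ab(2)])
    moreover have "f = Comp CN X J Y (Comp CN J P Y b k) \<epsilon>"
      unfolding f(2) k(2)[symmetric] by (rule CN.Comp_assoc[OF X J' P' Y e'(1) k(1) ab(2), symmetric])
    ultimately show "f \<in> {f \<in> mor CN X Y. null_homotopic N B X Y f}"
      using f(1) nh by auto
  next
    fix f assume "f \<in> {f \<in> mor CN X Y. null_homotopic N B X Y f}"
    then obtain h where "f \<in> mor CN X Y" "h \<in> mor CN J Y" "f = Comp CN X J Y h \<epsilon>"
      using nh by auto
    then show "f \<in> stable_ideal CN SN X Y"
      unfolding stable_ideal_def using disc_sum_projective[OF J] disc_sum_injective[OF J] e'(1) by blast
  qed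
qed

end

section \<open>Triangles in a category with a shift\<close>

context category
begin

lemma is_iso_left_right:
  assumes ob: "X \<in> Obj C" "Y \<in> Obj C" and f: "f \<in> mor C X Y" and gh: "g \<in> mor C Y X" "h \<in> mor C Y X"
    and "is_iso C X X (Comp C X Y X g f)" "is_iso C Y Y (Comp C Y X Y f h)"
  shows "is_iso C X Y f"
proof -
  obtain p where p: "p \<in> mor C X X" "Comp C X X X p (Comp C X Y X g f) = Ident C X"
    using assms(6) by (rule is_isoE)
  obtain q where q: "q \<in> mor C Y Y" "Comp C Y Y Y (Comp C Y X Y f h) q = Ident C Y"
    using assms(7) by (rule is_isoE)
  note [simp] = ob f gh p(1) q(1)
  have l: "Comp C X Y X (Comp C Y X X p g) f = Ident C X" using p(2) by simp
  have r: "Comp C Y X Y f (Comp C Y Y X h q) = Ident C Y" using q(2) by simp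
  have "Comp C Y X X p g = Comp C Y Y X (Comp C Y X X p g) (Comp C Y X Y f (Comp C Y Y X h q))"
    unfolding r by simp
  also have "\<dots> = Comp C Y X X (Comp C X Y X (Comp C Y X X p g) f) (Comp C Y Y X h q)"
    by simp
  also have "\<dots> = Comp C Y Y X h q"
    unfolding l by simp
  finally have e: "Comp C Y X X p g = Comp C Y Y X h q" .
  show ?thesis
    by (rule is_isoI[where g = "Comp C Y X X p g"]) (use l r in \<open>simp_all add: e del: Comp_assoc\<close>)
qed

lemma square_inverse:
  assumes ob: "X \<in> Obj C" "Y \<in> Obj C" "X' \<in> Obj C" "Y' \<in> Obj C"
    and u: "u \<in> mor C X Y" "u' \<in> mor C X' Y'" and a: "a \<in> mor C X X'" "a' \<in> mor C X' X"
    and b: "b \<in> mor C Y Y'" "b' \<in> mor C Y' Y"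
    and aa': "Comp C X' X X' a a' = Ident C X'" and b'b: "Comp C Y Y' Y b' b = Ident C Y"
    and sq: "Comp C X Y Y' b u = Comp C X X' Y' u' a"
  shows "Comp C X' Y' Y b' u' = Comp C X' X Y u a'"
proof -
  note [simp] = ob u a b
  have "Comp C X' Y' Y b' u' = Comp C X' Y' Y b' (Comp C X' X' Y' u' (Comp C X' X X' a a'))"
    unfolding aa' by simp
  also have "\<dots> = Comp C X' Y' Y b' (Comp C X' X Y' (Comp C X X' Y' u' a) a')"
    by simp
  also have "\<dots> = Comp C X' X Y u a'"
    unfolding sq[symmetric] by (simp add: Comp_eq_Comp[OF b'b])
  finally show ?thesis .
qed

end

text \<open>
  The quasi-inverse sends A to a chosen object whose image is isomorphic to A, and a morphism to the
  unique preimage of its conjugate under the chosen isomorphisms.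
\<close>

lemma equivalence_if_fully_faithful_essentially_surjective:
  assumes C: "category C" and D: "category D" and F: "is_functor C D F"
    and faithful: "\<And>X Y f g. \<lbrakk>X \<in> Obj C; Y \<in> Obj C; f \<in> mor C X Y; g \<in> mor C X Y; FMor F X Y f = FMor F X Y g\<rbrakk> \<Longrightarrow> f = g"
    and full: "\<And>X Y h. \<lbrakk>X \<in> Obj C; Y \<in> Obj C; h \<in> mor D (FObj F X) (FObj F Y)\<rbrakk> \<Longrightarrow> \<exists>f\<in>mor C X Y. FMor F X Y f = h"
    and surj: "\<And>A. A \<in> Obj D \<Longrightarrow> \<exists>X\<in>Obj C. \<exists>e. is_iso D (FObj F X) A e"
  shows "is_equivalence C D F"
proof -
  interpret C: category C by (rule C)
  interpret D: category D by (rule D)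
  have F_obj [simp]: "FObj F X \<in> Obj D" if "X \<in> Obj C" for X
    using F that unfolding is_functor_def by blast
  have F_in [simp]: "FMor F X Y f \<in> mor D (FObj F X) (FObj F Y)"
    if "X \<in> Obj C" "Y \<in> Obj C" "f \<in> mor C X Y" for X Y f
    using F that unfolding is_functor_def by blast
  have F_Ident [simp]: "FMor F X X (Ident C X) = Ident D (FObj F X)" if "X \<in> Obj C" for X
    using F that unfolding is_functor_def by blast
  have F_Comp [simp]: "FMor F X Z (Comp C X Y Z g f)
      = Comp D (FObj F X) (FObj F Y) (FObj F Z) (FMor F Y Z g) (FMor F X Y f)"
    if "X \<in> Obj C" "Y \<in> Obj C" "Z \<in> Obj C" "f \<in> mor C X Y" "g \<in> mor C Y Z" for X Y Z f g
    using F that unfolding is_functor_def by blast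
  have "\<exists>X e e'. A \<in> Obj D \<longrightarrow> X \<in> Obj C \<and> e \<in> mor D (FObj F X) A \<and> e' \<in> mor D A (FObj F X) \<and>
      Comp D (FObj F X) A (FObj F X) e' e = Ident D (FObj F X) \<and> Comp D A (FObj F X) A e e' = Ident D A" for A
    using surj unfolding is_iso_def by blast
  then obtain G e e' where Gee: "\<And>A. A \<in> Obj D \<Longrightarrow> G A \<in> Obj C \<and> e A \<in> mor D (FObj F (G A)) A \<and> e' A \<in> mor D A (FObj F (G A)) \<and>
      Comp D (FObj F (G A)) A (FObj F (G A)) (e' A) (e A) = Ident D (FObj F (G A)) \<and>
      Comp D A (FObj F (G A)) A (e A) (e' A) = Ident D A"
    by metis
  then have G [simp]: "G A \<in> Obj C" and e [simp]: "e A \<in> mor D (FObj F (G A)) A"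
    and e' [simp]: "e' A \<in> mor D A (FObj F (G A))"
    and e'e [simp]: "Comp D (FObj F (G A)) A (FObj F (G A)) (e' A) (e A) = Ident D (FObj F (G A))"
    and ee' [simp]: "Comp D A (FObj F (G A)) A (e A) (e' A) = Ident D A" if "A \<in> Obj D" for A
    using that by blast+
  have e'e_Comp [simp]: "Comp D W A (FObj F (G A)) (e' A) (Comp D W (FObj F (G A)) A (e A) k) = k"
    if "A \<in> Obj D" "W \<in> Obj D" "k \<in> mor D W (FObj F (G A))" for A W k
    using D.Comp_eq_Comp[OF e'e[OF that(1)]] that by simp
  have ee'_Comp [simp]: "Comp D W (FObj F (G A)) A (e A) (Comp D W A (FObj F (G A)) (e' A) k) = k"
    if "A \<in> Obj D" "W \<in> Obj D" "k \<in> mor D W A" for A W k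
    using D.Comp_eq_Comp[OF ee'[OF that(1)]] that by simp
  define pre where "pre X Y h = (SOME f. f \<in> mor C X Y \<and> FMor F X Y f = h)" for X Y h
  have pre [simp]: "pre X Y h \<in> mor C X Y" "FMor F X Y (pre X Y h) = h"
    if "X \<in> Obj C" "Y \<in> Obj C" "h \<in> mor D (FObj F X) (FObj F Y)" for X Y h
    using someI_ex[of "\<lambda>f. f \<in> mor C X Y \<and> FMor F X Y f = h"] full[OF that] unfolding pre_def by blast+
  define GF where "GF = \<lparr>FObj = G, FMor = (\<lambda>A A' h. pre (G A) (G A')
      (Comp D (FObj F (G A)) A' (FObj F (G A')) (e' A') (Comp D (FObj F (G A)) A A' h (e A))))\<rparr>"
  have GF [simp]: "FObj GF A = G A" "FMor GF A A' h = pre (G A) (G A')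
      (Comp D (FObj F (G A)) A' (FObj F (G A')) (e' A') (Comp D (FObj F (G A)) A A' h (e A)))" for A A' h
    by (simp_all add: GF_def)
  have functor_G: "is_functor D C GF"
    unfolding is_functor_def
  proof (intro conjI ballI)
    fix A assume [simp]: "A \<in> Obj D"
    show "FMor GF A A (Ident D A) = Ident C (FObj GF A)"
      by (rule faithful[of "G A" "G A"]) simp_all
  next
    fix A A' A'' f g
    assume [simp]: "A \<in> Obj D" "A' \<in> Obj D" "A'' \<in> Obj D" "f \<in> mor D A A'" "g \<in> mor D A' A''"
    show "FMor GF A A'' (Comp D A A' A'' g f)
      = Comp C (FObj GF A) (FObj GF A') (FObj GF A'') (FMor GF A' A'' g) (FMor GF A A' f)"
      by (rule faithful[of "G A" "G A''"]) simp_all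
  qed simp_all
  have [simp]: "FObj (comp_fctr GF F) X = G (FObj F X)" "FObj (comp_fctr F GF) A = FObj F (G A)"
    "FMor (comp_fctr GF F) X Y f = FMor GF (FObj F X) (FObj F Y) (FMor F X Y f)"
    "FMor (comp_fctr F GF) A A' h = FMor F (G A) (G A') (FMor GF A A' h)" for X Y f A A' h
    by (simp_all add: comp_fctr_def)
  have [simp]: "FObj id_fctr X = X" "FMor id_fctr X Y f = f" for X Y f
    by (simp_all add: id_fctr_def)
  have "naturally_isomorphic C C (comp_fctr GF F) id_fctr"
    unfolding naturally_isomorphic_def
  proof (intro exI[of _ "\<lambda>X. pre (G (FObj F X)) X (e (FObj F X))"] conjI ballI)
    fix X assume [simp]: "X \<in> Obj C"
    let ?G = "G (FObj F X)"
    have "Comp C ?G X ?G (pre X ?G (e' (FObj F X))) (pre ?G X (e (FObj F X))) = Ident C ?G"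
      by (rule faithful[of ?G ?G]) simp_all
    moreover have "Comp C X ?G X (pre ?G X (e (FObj F X))) (pre X ?G (e' (FObj F X))) = Ident C X"
      by (rule faithful[of X X]) simp_all
    ultimately have "is_iso C ?G X (pre ?G X (e (FObj F X)))"
      by (intro C.is_isoI[where g = "pre X ?G (e' (FObj F X))"]) simp_all
    then show "is_iso C (FObj (comp_fctr GF F) X) (FObj id_fctr X) (pre ?G X (e (FObj F X)))"
      by simp
  next
    fix X Y f assume [simp]: "X \<in> Obj C" "Y \<in> Obj C" "f \<in> mor C X Y"
    have "Comp C (G (FObj F X)) (G (FObj F Y)) Y (pre (G (FObj F Y)) Y (e (FObj F Y)))
        (FMor GF (FObj F X) (FObj F Y) (FMor F X Y f))
      = Comp C (G (FObj F X)) X Y f (pre (G (FObj F X)) X (e (FObj F X)))"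
      by (rule faithful[of "G (FObj F X)" Y]) simp_all
    then show "Comp C (FObj (comp_fctr GF F) X) (FObj (comp_fctr GF F) Y) (FObj id_fctr Y)
        (pre (G (FObj F Y)) Y (e (FObj F Y))) (FMor (comp_fctr GF F) X Y f)
      = Comp C (FObj (comp_fctr GF F) X) (FObj id_fctr X) (FObj id_fctr Y)
        (FMor id_fctr X Y f) (pre (G (FObj F X)) X (e (FObj F X)))"
      by simp
  qed
  moreover have "naturally_isomorphic D D (comp_fctr F GF) id_fctr"
    unfolding naturally_isomorphic_def
    by (intro exI[of _ e] conjI ballI) (simp_all add: D.is_isoI[OF e e' e'e ee'])
  ultimately show ?thesis
    unfolding is_equivalence_def using F functor_G by blast
qed

locale shifted_category = additive_category K for K :: "('o, 'm) precat" +
  fixes T :: "('o, 'm, 'o, 'm) fctr"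
  assumes T_additive: "additive_functor K K T"
begin

lemma T_functor: "is_functor K K T"
  using T_additive by (simp add: additive_functor_def)

lemma T_obj [simp]: "X \<in> Obj K \<Longrightarrow> FObj T X \<in> Obj K"
  using T_functor unfolding is_functor_def by blast

lemma T_in [simp]:
  "\<lbrakk>X \<in> Obj K; Y \<in> Obj K; f \<in> mor K X Y\<rbrakk> \<Longrightarrow> FMor T X Y f \<in> mor K (FObj T X) (FObj T Y)"
  using T_functor unfolding is_functor_def by blast

lemma T_Ident [simp]: "X \<in> Obj K \<Longrightarrow> FMor T X X (Ident K X) = Ident K (FObj T X)"
  using T_functor unfolding is_functor_def by blast

lemma T_Comp [simp]:
  "\<lbrakk>X \<in> Obj K; Y \<in> Obj K; Z \<in> Obj K; f \<in> mor K X Y; g \<in> mor K Y Z\<rbrakk> \<Longrightarrow>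
   FMor T X Z (Comp K X Y Z g f)
   = Comp K (FObj T X) (FObj T Y) (FObj T Z) (FMor T Y Z g) (FMor T X Y f)"
  using T_functor unfolding is_functor_def by blast

lemma T_add [simp]:
  "\<lbrakk>X \<in> Obj K; Y \<in> Obj K; f \<in> mor K X Y; g \<in> mor K X Y\<rbrakk> \<Longrightarrow>
   FMor T X Y (f \<otimes>\<^bsub>Hom K X Y\<^esub> g)
   = FMor T X Y f \<otimes>\<^bsub>Hom K (FObj T X) (FObj T Y)\<^esub> FMor T X Y g"
  using T_additive unfolding additive_functor_def hom_def by blast

lemma T_zero [simp]:
  assumes "X \<in> Obj K" "Y \<in> Obj K"
  shows "FMor T X Y (zero_mor K X Y) = zero_mor K (FObj T X) (FObj T Y)"
proof -
  let ?z = "FMor T X Y (zero_mor K X Y)"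
  have "?z \<otimes>\<^bsub>Hom K (FObj T X) (FObj T Y)\<^esub> ?z = ?z \<otimes>\<^bsub>Hom K (FObj T X) (FObj T Y)\<^esub> zero_mor K (FObj T X) (FObj T Y)"
    using assms by (simp flip: T_add)
  then show ?thesis
    using assms by (simp add: add_left_cancel del: add_zero_right)
qed

lemma T_neg [simp]:
  assumes "X \<in> Obj K" "Y \<in> Obj K" "f \<in> mor K X Y"
  shows "FMor T X Y (inv\<^bsub>Hom K X Y\<^esub> f) = inv\<^bsub>Hom K (FObj T X) (FObj T Y)\<^esub> (FMor T X Y f)"
  by (rule neg_eqI[symmetric]) (use assms in \<open>simp_all flip: T_add\<close>)

lemma is_triangleD:
  assumes "is_triangle K T (X, Y, Z, u, v, w)"
  shows "X \<in> Obj K" "Y \<in> Obj K" "Z \<in> Obj K" "u \<in> mor K X Y" "v \<in> mor K Y Z" "w \<in> mor K Z (FObj T X)"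
  using assms by (simp_all add: is_triangle_def)

lemma triangle_morphismD:
  assumes "triangle_morphism K T (X, Y, Z, u, v, w) (X', Y', Z', u', v', w') a b c"
  shows "a \<in> mor K X X'" "b \<in> mor K Y Y'" "c \<in> mor K Z Z'"
    "Comp K X Y Y' b u = Comp K X X' Y' u' a" "Comp K Y Z Z' c v = Comp K Y Y' Z' v' b"
    "Comp K Z (FObj T X) (FObj T X') (FMor T X X' a) w = Comp K Z Z' (FObj T X') w' c"
  using assms by (simp_all add: triangle_morphism_def)

lemma triangle_morphism_Comp:
  assumes t: "is_triangle K T (X, Y, Z, u, v, w)" and t': "is_triangle K T (X', Y', Z', u', v', w')"
    and t'': "is_triangle K T (X'', Y'', Z'', u'', v'', w'')"
    and m: "triangle_morphism K T (X, Y, Z, u, v, w) (X', Y', Z', u', v', w') a b c"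
    and m': "triangle_morphism K T (X', Y', Z', u', v', w') (X'', Y'', Z'', u'', v'', w'') a' b' c'"
  shows "triangle_morphism K T (X, Y, Z, u, v, w) (X'', Y'', Z'', u'', v'', w'')
    (Comp K X X' X'' a' a) (Comp K Y Y' Y'' b' b) (Comp K Z Z' Z'' c' c)"
proof -
  note d = is_triangleD[OF t] is_triangleD[OF t'] is_triangleD[OF t'']
  note e = triangle_morphismD[OF m] and e' = triangle_morphismD[OF m']
  note [simp] = d e(1-3) e'(1-3)
  show ?thesis
    unfolding triangle_morphism_def
    by (simp add: e(4-6) Comp_eq_Comp[OF e'(4)] Comp_eq_Comp[OF e'(5)] Comp_eq_Comp[OF e'(6)])
qed

lemma triangle_morphism_inverse:
  assumes t: "is_triangle K T (X, Y, Z, u, v, w)" and t': "is_triangle K T (X', Y', Z', u', v', w')"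
    and m: "triangle_morphism K T (X, Y, Z, u, v, w) (X', Y', Z', u', v', w') a b c"
    and a': "a' \<in> mor K X' X" "Comp K X X' X a' a = Ident K X" "Comp K X' X X' a a' = Ident K X'"
    and b': "b' \<in> mor K Y' Y" "Comp K Y Y' Y b' b = Ident K Y" "Comp K Y' Y Y' b b' = Ident K Y'"
    and c': "c' \<in> mor K Z' Z" "Comp K Z Z' Z c' c = Ident K Z" "Comp K Z' Z Z' c c' = Ident K Z'"
  shows "triangle_morphism K T (X', Y', Z', u', v', w') (X, Y, Z, u, v, w) a' b' c'"
proof -
  note d = is_triangleD[OF t] is_triangleD[OF t']
  note e = triangle_morphismD[OF m]
  note [simp] = d e(1-3) a'(1) b'(1) c'(1)
  have 1: "Comp K X' Y' Y b' u' = Comp K X' X Y u a'"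
    by (rule square_inverse[OF _ _ _ _ _ _ _ _ _ _ a'(3) b'(2) e(4)]) simp_all
  have 2: "Comp K Y' Z' Z c' v' = Comp K Y' Y Z v b'"
    by (rule square_inverse[OF _ _ _ _ _ _ _ _ _ _ b'(3) c'(2) e(5)]) simp_all
  have "Comp K (FObj T X) (FObj T X') (FObj T X) (FMor T X' X a') (FMor T X X' a) = Ident K (FObj T X)"
    using a'(2) by (simp flip: T_Comp)
  then have 3: "Comp K Z' (FObj T X') (FObj T X) (FMor T X' X a') w' = Comp K Z' Z (FObj T X) w c'"
    by (intro square_inverse[OF _ _ _ _ _ _ _ _ _ _ c'(3) _ e(6)]) simp_all
  show ?thesis
    unfolding triangle_morphism_def by (simp add: 1 2 3)
qed

lemma triangle_isoE:
  assumes "triangle_iso K T (X, Y, Z, u, v, w) (X', Y', Z', u', v', w')"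
    and "is_triangle K T (X, Y, Z, u, v, w)" "is_triangle K T (X', Y', Z', u', v', w')"
  obtains a b c a' b' c' where
    "triangle_morphism K T (X, Y, Z, u, v, w) (X', Y', Z', u', v', w') a b c"
    "triangle_morphism K T (X', Y', Z', u', v', w') (X, Y, Z, u, v, w) a' b' c'"
    "Comp K X X' X a' a = Ident K X" "Comp K X' X X' a a' = Ident K X'"
    "Comp K Y Y' Y b' b = Ident K Y" "Comp K Y' Y Y' b b' = Ident K Y'"
    "Comp K Z Z' Z c' c = Ident K Z" "Comp K Z' Z Z' c c' = Ident K Z'"
proof -
  obtain a b c where m: "triangle_morphism K T (X, Y, Z, u, v, w) (X', Y', Z', u', v', w') a b c"
    and i: "is_iso K X X' a" "is_iso K Y Y' b" "is_iso K Z Z' c"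
    using assms(1) unfolding triangle_iso_def by auto
  obtain a' where a': "a' \<in> mor K X' X" "Comp K X X' X a' a = Ident K X" "Comp K X' X X' a a' = Ident K X'"
    using i(1) by (rule is_isoE)
  obtain b' where b': "b' \<in> mor K Y' Y" "Comp K Y Y' Y b' b = Ident K Y" "Comp K Y' Y Y' b b' = Ident K Y'"
    using i(2) by (rule is_isoE)
  obtain c' where c': "c' \<in> mor K Z' Z" "Comp K Z Z' Z c' c = Ident K Z" "Comp K Z' Z Z' c c' = Ident K Z'"
    using i(3) by (rule is_isoE)
  show ?thesis
    by (rule that[OF m triangle_morphism_inverse[OF assms(2,3) m a' b' c']]) (fact a' b' c')+
qed

lemma triangle_isoI:
  assumes "triangle_morphism K T (X, Y, Z, u, v, w) (X', Y', Z', u', v', w') a b c"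
    and "is_iso K X X' a" "is_iso K Y Y' b" "is_iso K Z Z' c"
  shows "triangle_iso K T (X, Y, Z, u, v, w) (X', Y', Z', u', v', w')"
  using assms unfolding triangle_iso_def by auto

lemma triangle_iso_sym:
  assumes "triangle_iso K T (X, Y, Z, u, v, w) (X', Y', Z', u', v', w')"
    and "is_triangle K T (X, Y, Z, u, v, w)" "is_triangle K T (X', Y', Z', u', v', w')"
  shows "triangle_iso K T (X', Y', Z', u', v', w') (X, Y, Z, u, v, w)"
proof (rule triangle_isoE[OF assms])
  fix a b c a' b' c'
  assume 1: "triangle_morphism K T (X, Y, Z, u, v, w) (X', Y', Z', u', v', w') a b c"
    and 2: "triangle_morphism K T (X', Y', Z', u', v', w') (X, Y, Z, u, v, w) a' b' c'"
    and 3: "Comp K X X' X a' a = Ident K X" "Comp K X' X X' a a' = Ident K X'"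
    "Comp K Y Y' Y b' b = Ident K Y" "Comp K Y' Y Y' b b' = Ident K Y'"
    "Comp K Z Z' Z c' c = Ident K Z" "Comp K Z' Z Z' c c' = Ident K Z'"
  note d = triangle_morphismD(1-3)[OF 1] triangle_morphismD(1-3)[OF 2]
  show ?thesis
    by (rule triangle_isoI[OF 2 is_isoI[OF d(4,1) 3(2,1)] is_isoI[OF d(5,2) 3(4,3)] is_isoI[OF d(6,3) 3(6,5)]])
qed

lemma triangle_iso_trans:
  assumes i: "triangle_iso K T (X, Y, Z, u, v, w) (X', Y', Z', u', v', w')"
    and j: "triangle_iso K T (X', Y', Z', u', v', w') (X'', Y'', Z'', u'', v'', w'')"
    and t: "is_triangle K T (X, Y, Z, u, v, w)" and t': "is_triangle K T (X', Y', Z', u', v', w')"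
    and t'': "is_triangle K T (X'', Y'', Z'', u'', v'', w'')"
  shows "triangle_iso K T (X, Y, Z, u, v, w) (X'', Y'', Z'', u'', v'', w'')"
proof -
  note [simp] = is_triangleD(1-3)[OF t] is_triangleD(1-3)[OF t'] is_triangleD(1-3)[OF t'']
  obtain a b c where 1: "triangle_morphism K T (X, Y, Z, u, v, w) (X', Y', Z', u', v', w') a b c"
    "is_iso K X X' a" "is_iso K Y Y' b" "is_iso K Z Z' c"
    using i unfolding triangle_iso_def by auto
  obtain a' b' c' where 2: "triangle_morphism K T (X', Y', Z', u', v', w') (X'', Y'', Z'', u'', v'', w'') a' b' c'"
    "is_iso K X' X'' a'" "is_iso K Y' Y'' b'" "is_iso K Z' Z'' c'"
    using j unfolding triangle_iso_def by auto
  show ?thesis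
    by (rule triangle_isoI[OF triangle_morphism_Comp[OF t t' t'' 1(1) 2(1)]])
      (use 1(2-4) 2(2-4) in \<open>simp_all add: is_iso_Comp\<close>)
qed

lemma triangle_morphism_Ident:
  assumes "is_triangle K T (X, Y, Z, u, v, w)"
  shows "triangle_morphism K T (X, Y, Z, u, v, w) (X, Y, Z, u, v, w) (Ident K X) (Ident K Y) (Ident K Z)"
  using is_triangleD[OF assms] by (simp add: triangle_morphism_def)

end

section \<open>A criterion for triangulations\<close>

text \<open>
  Sufficient conditions for a triangulation that are easier to verify than the axioms: the rotation is
  required in one direction only, and the octahedron only for one choice of the three cones of a
  composable pair. The additional weak cokernel property is what makes cones unique up to isomorphism,
  and this uniqueness yields the other direction and all other octahedra.
\<close>

locale triangulation_criterion = shifted_category K T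
  for K :: "('o, 'm) precat" and T :: "('o, 'm, 'o, 'm) fctr" +
  fixes \<Delta> :: "('o, 'm) triangle set"
  assumes T_faithful: "\<lbrakk>X \<in> Obj K; Y \<in> Obj K; f \<in> mor K X Y; g \<in> mor K X Y; FMor T X Y f = FMor T X Y g\<rbrakk> \<Longrightarrow> f = g"
    and T_full: "\<lbrakk>X \<in> Obj K; Y \<in> Obj K; h \<in> mor K (FObj T X) (FObj T Y)\<rbrakk> \<Longrightarrow> \<exists>f\<in>mor K X Y. FMor T X Y f = h"
    and T_surj: "Y \<in> Obj K \<Longrightarrow> \<exists>X\<in>Obj K. \<exists>e. is_iso K (FObj T X) Y e"
    and \<Delta>_triangle: "t \<in> \<Delta> \<Longrightarrow> is_triangle K T t"
    and \<Delta>_iso: "\<lbrakk>t \<in> \<Delta>; is_triangle K T t'; triangle_iso K T t t'\<rbrakk> \<Longrightarrow> t' \<in> \<Delta>"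
    and \<Delta>_Ident: "\<lbrakk>X \<in> Obj K; is_zero_object K Z\<rbrakk>
      \<Longrightarrow> (X, X, Z, Ident K X, zero_mor K X Z, zero_mor K Z (FObj T X)) \<in> \<Delta>"
    and \<Delta>_rotate: "(X, Y, Z, u, v, w) \<in> \<Delta> \<Longrightarrow>
      (Y, Z, FObj T X, v, w, inv\<^bsub>Hom K (FObj T X) (FObj T Y)\<^esub> (FMor T X Y u)) \<in> \<Delta>"
    and \<Delta>_morphism: "\<lbrakk>(X, Y, Z, u, v, w) \<in> \<Delta>; (X', Y', Z', u', v', w') \<in> \<Delta>;
        a \<in> mor K X X'; b \<in> mor K Y Y'; Comp K X Y Y' b u = Comp K X X' Y' u' a\<rbrakk>
      \<Longrightarrow> \<exists>c. triangle_morphism K T (X, Y, Z, u, v, w) (X', Y', Z', u', v', w') a b c"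
    and \<Delta>_weak_cokernel: "\<lbrakk>(X, Y, Z, u, v, w) \<in> \<Delta>; W \<in> Obj K; n \<in> mor K Z W;
        Comp K Y Z W n v = zero_mor K Y W\<rbrakk>
      \<Longrightarrow> \<exists>m\<in>mor K (FObj T X) W. n = Comp K Z (FObj T X) W m w"
    and \<Delta>_octahedron: "\<lbrakk>X \<in> Obj K; Y \<in> Obj K; Z \<in> Obj K; u \<in> mor K X Y; v \<in> mor K Y Z\<rbrakk>
      \<Longrightarrow> \<exists>Z' i i' X' j j' Y' k k' f g.
        (X, Y, Z', u, i, i') \<in> \<Delta> \<and> (Y, Z, X', v, j, j') \<in> \<Delta> \<and>
        (X, Z, Y', Comp K X Y Z v u, k, k') \<in> \<Delta> \<and>
        triangle_morphism K T (X, Y, Z', u, i, i') (X, Z, Y', Comp K X Y Z v u, k, k')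
          (Ident K X) v f \<and>
        triangle_morphism K T (X, Z, Y', Comp K X Y Z v u, k, k') (Y, Z, X', v, j, j')
          u (Ident K Z) g \<and>
        (Z', Y', X', f, g, Comp K X' (FObj T Y) (FObj T Z') (FMor T Y Z' i) j') \<in> \<Delta>"
begin

text \<open>
  Put n = e - 1. Then n v = 0, so that n = k w for some k, and w n = 0; hence n n = k w n = 0, and 1 - n is
  inverse to e = 1 + n.
\<close>

lemma endomorphism_of_cone_is_iso:
  assumes t: "(X, Y, Z, u, v, w) \<in> \<Delta>"
    and m: "triangle_morphism K T (X, Y, Z, u, v, w) (X, Y, Z, u, v, w) (Ident K X) (Ident K Y) e"
  shows "is_iso K Z Z e"
proof -
  note d = is_triangleD[OF \<Delta>_triangle[OF t]] and md = triangle_morphismD[OF m]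
  note [simp] = d md(3)
  define n where "n = diff Z Z e (Ident K Z)"
  have n [simp]: "n \<in> mor K Z Z" by (simp add: n_def)
  have e: "e = n \<otimes>\<^bsub>Hom K Z Z\<^esub> Ident K Z" by (simp add: n_def)
  have "Comp K Y Z Z n v = zero_mor K Y Z"
    using md(5) by (simp add: n_def)
  then obtain k where k [simp]: "k \<in> mor K (FObj T X) Z" and nk: "n = Comp K Z (FObj T X) Z k w"
    using \<Delta>_weak_cokernel[OF t d(3) n] by blast
  have "Comp K Z Z (FObj T X) w n = zero_mor K Z (FObj T X)"
    using md(6) by (simp add: n_def)
  then have nn: "Comp K Z Z Z n n = zero_mor K Z Z"
    by (subst (1) nk) simp
  show ?thesis
    by (rule is_isoI[where g = "diff Z Z (Ident K Z) n"]) (simp_all add: e nn)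
qed

text \<open>
  The five lemma. A morphism in the opposite direction extends the inverses of a and b; both composites
  are endomorphisms of cones over identities.
\<close>

lemma cone_morphism_is_iso:
  assumes t: "(X, Y, Z, u, v, w) \<in> \<Delta>" and t': "(X', Y', Z', u', v', w') \<in> \<Delta>"
    and m: "triangle_morphism K T (X, Y, Z, u, v, w) (X', Y', Z', u', v', w') a b c"
    and a: "is_iso K X X' a" and b: "is_iso K Y Y' b"
  shows "is_iso K Z Z' c"
proof -
  note tt = \<Delta>_triangle[OF t] and tt' = \<Delta>_triangle[OF t']
  note d = is_triangleD[OF tt] is_triangleD[OF tt'] and md = triangle_morphismD[OF m]
  note [simp] = d md(1-3)
  obtain a' where a': "a' \<in> mor K X' X" "Comp K X X' X a' a = Ident K X" "Comp K X' X X' a a' = Ident K X'"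
    using a by (rule is_isoE)
  obtain b' where b': "b' \<in> mor K Y' Y" "Comp K Y Y' Y b' b = Ident K Y" "Comp K Y' Y Y' b b' = Ident K Y'"
    using b by (rule is_isoE)
  have "Comp K X' Y' Y b' u' = Comp K X' X Y u a'"
    by (rule square_inverse[OF _ _ _ _ _ _ _ _ _ _ a'(3) b'(2) md(4)]) (simp_all add: a' b')
  then obtain c' where m': "triangle_morphism K T (X', Y', Z', u', v', w') (X, Y, Z, u, v, w) a' b' c'"
    using \<Delta>_morphism[OF t' t a'(1) b'(1)] by blast
  note c' = triangle_morphismD(3)[OF m']
  have "is_iso K Z Z (Comp K Z Z' Z c' c)"
    using triangle_morphism_Comp[OF tt tt' tt m m'] unfolding a'(2) b'(2)
    by (rule endomorphism_of_cone_is_iso[OF t])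
  moreover have "is_iso K Z' Z' (Comp K Z' Z Z' c c')"
    using triangle_morphism_Comp[OF tt' tt tt' m' m] unfolding a'(3) b'(3)
    by (rule endomorphism_of_cone_is_iso[OF t'])
  ultimately show ?thesis
    by (intro is_iso_left_right[of Z Z' c c' c'] c' md(3) d)
qed

lemma comparison_of_cones:
  assumes t: "(X, Y, Z, u, v, w) \<in> \<Delta>" and t': "(X, Y, Z', u, v', w') \<in> \<Delta>"
  obtains c c' where
    "triangle_morphism K T (X, Y, Z, u, v, w) (X, Y, Z', u, v', w') (Ident K X) (Ident K Y) c"
    "triangle_morphism K T (X, Y, Z', u, v', w') (X, Y, Z, u, v, w) (Ident K X) (Ident K Y) c'"
    "Comp K Z Z' Z c' c = Ident K Z" "Comp K Z' Z Z' c c' = Ident K Z'"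
proof -
  note tt = \<Delta>_triangle[OF t] and tt' = \<Delta>_triangle[OF t']
  note [simp] = is_triangleD[OF tt] is_triangleD[OF tt']
  have "\<exists>c. triangle_morphism K T (X, Y, Z, u, v, w) (X, Y, Z', u, v', w') (Ident K X) (Ident K Y) c"
    by (rule \<Delta>_morphism[OF t t']) simp_all
  then obtain c where m: "triangle_morphism K T (X, Y, Z, u, v, w) (X, Y, Z', u, v', w') (Ident K X) (Ident K Y) c"
    by blast
  have "is_iso K Z Z' c"
    by (rule cone_morphism_is_iso[OF t t' m]) simp_all
  then obtain c' where c': "c' \<in> mor K Z' Z" "Comp K Z Z' Z c' c = Ident K Z" "Comp K Z' Z Z' c c' = Ident K Z'"
    by (rule is_isoE)
  have "triangle_morphism K T (X, Y, Z', u, v', w') (X, Y, Z, u, v, w) (Ident K X) (Ident K Y) c'"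
    by (rule triangle_morphism_inverse[OF tt tt' m _ _ _ _ _ _ c']) simp_all
  from that[OF m this c'(2,3)] show ?thesis .
qed

lemma T_reflects_iso:
  assumes [simp]: "X \<in> Obj K" "Y \<in> Obj K" "f \<in> mor K X Y" and "is_iso K (FObj T X) (FObj T Y) (FMor T X Y f)"
  shows "is_iso K X Y f"
proof -
  obtain h where h: "h \<in> mor K (FObj T Y) (FObj T X)"
    "Comp K (FObj T X) (FObj T Y) (FObj T X) h (FMor T X Y f) = Ident K (FObj T X)"
    "Comp K (FObj T Y) (FObj T X) (FObj T Y) (FMor T X Y f) h = Ident K (FObj T Y)"
    using assms(4) by (rule is_isoE)
  obtain g where g [simp]: "g \<in> mor K Y X" and Tg: "FMor T Y X g = h"
    using T_full[OF _ _ h(1)] by auto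
  show ?thesis
  proof (rule is_isoI[where g = g])
    show "Comp K X Y X g f = Ident K X"
      by (rule T_faithful[of X X]) (simp_all add: Tg h)
    show "Comp K Y X Y f g = Ident K Y"
      by (rule T_faithful[of Y Y]) (simp_all add: Tg h)
  qed simp_all
qed

text \<open>
  Compare the given triangle with a distinguished one on the same u. After three rotations both become
  distinguished triangles on - T u, hence isomorphic; the isomorphism T Z' --> T Z of the cones comes
  from an isomorphism Z' --> Z because T is fully faithful.
\<close>

lemma rotate_back:
  assumes t: "is_triangle K T (X, Y, Z, u, v, w)"
    and r: "(Y, Z, FObj T X, v, w, inv\<^bsub>Hom K (FObj T X) (FObj T Y)\<^esub> (FMor T X Y u)) \<in> \<Delta>"
  shows "(X, Y, Z, u, v, w) \<in> \<Delta>"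
proof -
  note d [simp] = is_triangleD[OF t]
  obtain Z' i i' where c: "(X, Y, Z', u, i, i') \<in> \<Delta>"
    using \<Delta>_octahedron[OF d(1,2,2,4) Ident_in[OF d(2)]] by blast
  note [simp] = is_triangleD[OF \<Delta>_triangle[OF c]]
  let ?n = "\<lambda>X Y f. inv\<^bsub>Hom K (FObj T X) (FObj T Y)\<^esub> (FMor T X Y f)"
  have r3: "(FObj T X, FObj T Y, FObj T Z, ?n X Y u, ?n Y Z v, ?n Z (FObj T X) w) \<in> \<Delta>"
    by (rule \<Delta>_rotate[OF \<Delta>_rotate[OF r]])
  have c3: "(FObj T X, FObj T Y, FObj T Z', ?n X Y u, ?n Y Z' i, ?n Z' (FObj T X) i') \<in> \<Delta>"
    by (rule \<Delta>_rotate[OF \<Delta>_rotate[OF \<Delta>_rotate[OF c]]])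
  obtain e e' where
    m: "triangle_morphism K T (FObj T X, FObj T Y, FObj T Z', ?n X Y u, ?n Y Z' i, ?n Z' (FObj T X) i')
      (FObj T X, FObj T Y, FObj T Z, ?n X Y u, ?n Y Z v, ?n Z (FObj T X) w)
      (Ident K (FObj T X)) (Ident K (FObj T Y)) e"
    and m': "triangle_morphism K T (FObj T X, FObj T Y, FObj T Z, ?n X Y u, ?n Y Z v, ?n Z (FObj T X) w)
      (FObj T X, FObj T Y, FObj T Z', ?n X Y u, ?n Y Z' i, ?n Z' (FObj T X) i')
      (Ident K (FObj T X)) (Ident K (FObj T Y)) e'"
    and ee: "Comp K (FObj T Z') (FObj T Z) (FObj T Z') e' e = Ident K (FObj T Z')"
      "Comp K (FObj T Z) (FObj T Z') (FObj T Z) e e' = Ident K (FObj T Z)"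
    by (rule comparison_of_cones[OF c3 r3])
  note md = triangle_morphismD[OF m] and md' = triangle_morphismD[OF m']
  obtain p where p [simp]: "p \<in> mor K Z' Z" and Tp: "FMor T Z' Z p = e"
    using T_full[OF _ _ md(3)] by auto
  have iso: "is_iso K Z' Z p"
    by (rule T_reflects_iso) (simp_all add: Tp is_isoI[OF md(3) md'(3) ee])
  note [simp] = md(3)
  have "inv\<^bsub>Hom K (FObj T Y) (FObj T Z)\<^esub> (Comp K (FObj T Y) (FObj T Z') (FObj T Z) e (FMor T Y Z' i))
      = inv\<^bsub>Hom K (FObj T Y) (FObj T Z)\<^esub> (FMor T Y Z v)"
    using md(5) by simp
  from arg_cong[OF this, of "\<lambda>f. inv\<^bsub>Hom K (FObj T Y) (FObj T Z)\<^esub> f"]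
  have Tv: "Comp K (FObj T Y) (FObj T Z') (FObj T Z) e (FMor T Y Z' i) = FMor T Y Z v"
    by simp
  have pi: "Comp K Y Z' Z p i = v"
    by (rule T_faithful[of Y Z]) (simp_all add: Tp Tv)
  have "inv\<^bsub>Hom K (FObj T Z') (FObj T (FObj T X))\<^esub> (Comp K (FObj T Z') (FObj T Z) (FObj T (FObj T X)) (FMor T Z (FObj T X) w) e)
      = inv\<^bsub>Hom K (FObj T Z') (FObj T (FObj T X))\<^esub> (FMor T Z' (FObj T X) i')"
    using md(6) by simp
  from arg_cong[OF this, of "\<lambda>f. inv\<^bsub>Hom K (FObj T Z') (FObj T (FObj T X))\<^esub> f"]
  have Tw: "Comp K (FObj T Z') (FObj T Z) (FObj T (FObj T X)) (FMor T Z (FObj T X) w) e = FMor T Z' (FObj T X) i'"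
    by simp
  have wp: "Comp K Z' Z (FObj T X) w p = i'"
    by (rule T_faithful[of Z' "FObj T X"]) (simp_all add: Tp Tw)
  have "triangle_morphism K T (X, Y, Z', u, i, i') (X, Y, Z, u, v, w) (Ident K X) (Ident K Y) p"
    unfolding triangle_morphism_def by (simp add: pi wp)
  then have "triangle_iso K T (X, Y, Z', u, i, i') (X, Y, Z, u, v, w)"
    by (rule triangle_isoI) (simp_all add: iso)
  then show ?thesis by (rule \<Delta>_iso[OF c t])
qed

text \<open>
  The maps f and g of the octahedron that exists are conjugated with the comparison isomorphisms of the
  three pairs of cones.
\<close>

lemma octahedron:
  assumes tu: "(X, Y, Z', u, i, i') \<in> \<Delta>" and tv: "(Y, Z, X', v, j, j') \<in> \<Delta>"
    and tvu: "(X, Z, Y', Comp K X Y Z v u, k, k') \<in> \<Delta>"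
  shows "\<exists>f g.
        triangle_morphism K T (X, Y, Z', u, i, i') (X, Z, Y', Comp K X Y Z v u, k, k')
          (Ident K X) v f \<and>
        triangle_morphism K T (X, Z, Y', Comp K X Y Z v u, k, k') (Y, Z, X', v, j, j')
          u (Ident K Z) g \<and>
        (Z', Y', X', f, g, Comp K X' (FObj T Y) (FObj T Z') (FMor T Y Z' i) j') \<in> \<Delta>"
proof -
  note du = is_triangleD[OF \<Delta>_triangle[OF tu]] and dv = is_triangleD[OF \<Delta>_triangle[OF tv]]
  note dvu = is_triangleD[OF \<Delta>_triangle[OF tvu]]
  note [simp] = du dv dvu
  obtain A i0 i0' B j0 j0' D k0 k0' f0 g0 where
    su: "(X, Y, A, u, i0, i0') \<in> \<Delta>" and sv: "(Y, Z, B, v, j0, j0') \<in> \<Delta>"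
    and svu: "(X, Z, D, Comp K X Y Z v u, k0, k0') \<in> \<Delta>"
    and f0: "triangle_morphism K T (X, Y, A, u, i0, i0') (X, Z, D, Comp K X Y Z v u, k0, k0') (Ident K X) v f0"
    and g0: "triangle_morphism K T (X, Z, D, Comp K X Y Z v u, k0, k0') (Y, Z, B, v, j0, j0') u (Ident K Z) g0"
    and s: "(A, D, B, f0, g0, Comp K B (FObj T Y) (FObj T A) (FMor T Y A i0) j0') \<in> \<Delta>"
    using \<Delta>_octahedron[OF du(1,2) dv(2) du(4) dv(4)] by blast
  note Su = \<Delta>_triangle[OF su] and Sv = \<Delta>_triangle[OF sv] and Svu = \<Delta>_triangle[OF svu]
  note Tu = \<Delta>_triangle[OF tu] and Tv = \<Delta>_triangle[OF tv] and Tvu = \<Delta>_triangle[OF tvu]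
  note [simp] = is_triangleD[OF Su] is_triangleD[OF Sv] is_triangleD[OF Svu]
    triangle_morphismD(3)[OF f0] triangle_morphismD(3)[OF g0]
  obtain \<alpha> \<alpha>' where al: "triangle_morphism K T (X, Y, Z', u, i, i') (X, Y, A, u, i0, i0') (Ident K X) (Ident K Y) \<alpha>"
    and al': "triangle_morphism K T (X, Y, A, u, i0, i0') (X, Y, Z', u, i, i') (Ident K X) (Ident K Y) \<alpha>'"
    and ale: "Comp K Z' A Z' \<alpha>' \<alpha> = Ident K Z'" "Comp K A Z' A \<alpha> \<alpha>' = Ident K A"
    by (rule comparison_of_cones[OF tu su])
  obtain \<beta> \<beta>' where be: "triangle_morphism K T (Y, Z, X', v, j, j') (Y, Z, B, v, j0, j0') (Ident K Y) (Ident K Z) \<beta>"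
    and be': "triangle_morphism K T (Y, Z, B, v, j0, j0') (Y, Z, X', v, j, j') (Ident K Y) (Ident K Z) \<beta>'"
    and bee: "Comp K X' B X' \<beta>' \<beta> = Ident K X'" "Comp K B X' B \<beta> \<beta>' = Ident K B"
    by (rule comparison_of_cones[OF tv sv])
  obtain \<gamma> \<gamma>' where ga: "triangle_morphism K T (X, Z, Y', Comp K X Y Z v u, k, k')
      (X, Z, D, Comp K X Y Z v u, k0, k0') (Ident K X) (Ident K Z) \<gamma>"
    and ga': "triangle_morphism K T (X, Z, D, Comp K X Y Z v u, k0, k0')
      (X, Z, Y', Comp K X Y Z v u, k, k') (Ident K X) (Ident K Z) \<gamma>'"
    and gae: "Comp K Y' D Y' \<gamma>' \<gamma> = Ident K Y'" "Comp K D Y' D \<gamma> \<gamma>' = Ident K D"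
    by (rule comparison_of_cones[OF tvu svu])
  note [simp] = triangle_morphismD(3)[OF al] triangle_morphismD(3)[OF al'] triangle_morphismD(3)[OF be]
    triangle_morphismD(3)[OF be'] triangle_morphismD(3)[OF ga] triangle_morphismD(3)[OF ga']
  define f where "f = Comp K Z' D Y' \<gamma>' (Comp K Z' A D f0 \<alpha>)"
  define g where "g = Comp K Y' B X' \<beta>' (Comp K Y' D B g0 \<gamma>)"
  have fg [simp]: "f \<in> mor K Z' Y'" "g \<in> mor K Y' X'" by (simp_all add: f_def g_def)
  have 1: "triangle_morphism K T (X, Y, Z', u, i, i') (X, Z, Y', Comp K X Y Z v u, k, k') (Ident K X) v f"
    using triangle_morphism_Comp[OF Tu Svu Tvu triangle_morphism_Comp[OF Tu Su Svu al f0] ga']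
    by (simp add: f_def)
  have 2: "triangle_morphism K T (X, Z, Y', Comp K X Y Z v u, k, k') (Y, Z, X', v, j, j') u (Ident K Z) g"
    using triangle_morphism_Comp[OF Tvu Sv Tv triangle_morphism_Comp[OF Tvu Svu Sv ga g0] be']
    by (simp add: g_def)
  let ?w = "Comp K X' (FObj T Y) (FObj T Z') (FMor T Y Z' i) j'"
  let ?wS = "Comp K B (FObj T Y) (FObj T A) (FMor T Y A i0) j0'"
  have ai: "Comp K Y Z' A \<alpha> i = i0" using triangle_morphismD(5)[OF al] by simp
  have Tai: "Comp K (FObj T Y) (FObj T Z') (FObj T A) (FMor T Z' A \<alpha>) (FMor T Y Z' i) = FMor T Y A i0"
    by (simp add: ai flip: T_Comp)
  have jb: "Comp K X' B (FObj T Y) j0' \<beta> = j'"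
    using triangle_morphismD(6)[OF be] by simp
  have "triangle_morphism K T (Z', Y', X', f, g, ?w) (A, D, B, f0, g0, ?wS) \<alpha> \<gamma> \<beta>"
    unfolding triangle_morphism_def
    by (simp add: f_def g_def Comp_eq_Comp[OF gae(2)] Comp_eq_Comp[OF bee(2)] Comp_eq_Comp[OF Tai] jb)
  moreover have "is_iso K Z' A \<alpha>" "is_iso K Y' D \<gamma>" "is_iso K X' B \<beta>"
    by (rule is_isoI[OF _ _ ale] is_isoI[OF _ _ gae] is_isoI[OF _ _ bee]; simp)+
  ultimately have "triangle_iso K T (Z', Y', X', f, g, ?w) (A, D, B, f0, g0, ?wS)"
    by (rule triangle_isoI)
  moreover have t: "is_triangle K T (Z', Y', X', f, g, ?w)"
    unfolding is_triangle_def by simp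
  ultimately have "triangle_iso K T (A, D, B, f0, g0, ?wS) (Z', Y', X', f, g, ?w)"
    using triangle_iso_sym \<Delta>_triangle[OF s] by blast
  then have "(Z', Y', X', f, g, ?w) \<in> \<Delta>"
    by (rule \<Delta>_iso[OF s t])
  with 1 2 show ?thesis by blast
qed

theorem triangulated: "triangulated_category K T \<Delta>"
proof (intro triangulated_category.intro triangulated_category_axioms.intro)
  show "additive_category K" by (rule additive_category_axioms)
  show "additive_functor K K T" by (rule T_additive)
  show "is_equivalence K K T"
    by (rule equivalence_if_fully_faithful_essentially_surjective[OF category_axioms category_axioms T_functor])
      (fact T_faithful T_full T_surj)+
  fix X Y u assume X: "X \<in> Obj K" and Y: "Y \<in> Obj K" and u: "u \<in> mor K X Y"
  show "\<exists>Z v w. (X, Y, Z, u, v, w) \<in> \<Delta>"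
    using \<Delta>_octahedron[OF X Y Y u Ident_in[OF Y]] by blast
next
  fix X Y Z u v w assume "is_triangle K T (X, Y, Z, u, v, w)"
  then show "(X, Y, Z, u, v, w) \<in> \<Delta> \<longleftrightarrow>
      (Y, Z, FObj T X, v, w, inv\<^bsub>Hom K (FObj T X) (FObj T Y)\<^esub> (FMor T X Y u)) \<in> \<Delta>"
    using \<Delta>_rotate rotate_back by blast
qed (fact \<Delta>_triangle \<Delta>_iso \<Delta>_Ident \<Delta>_morphism octahedron)+

end

section \<open>The stable category of a Frobenius category\<close>

context exact_category
begin

lemma conflationD:
  assumes "(X, f, Y, g, Z) \<in> S"
  shows "X \<in> Obj C" "Y \<in> Obj C" "Z \<in> Obj C" "f \<in> mor C X Y" "g \<in> mor C Y Z"
    "Comp C X Y Z g f = zero_mor C X Z" "admissible_mono S X Y f" "admissible_epi S Y Z g"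
  using conflation[OF assms] assms
  unfolding kernel_cokernel_pair_def is_kernel_def admissible_mono_def admissible_epi_def by auto

lemma conflation_lift_unique:
  assumes "(X, f, Y, g, Z) \<in> S" "W \<in> Obj C" "h \<in> mor C W Y" "Comp C W Y Z g h = zero_mor C W Z"
  shows "\<exists>!k. k \<in> mor C W X \<and> Comp C W X Y f k = h"
  using conflation[OF assms(1)] assms(2-4) unfolding kernel_cokernel_pair_def is_kernel_def by blast

lemma conflation_lift:
  assumes "(X, f, Y, g, Z) \<in> S" "W \<in> Obj C" "h \<in> mor C W Y" "Comp C W Y Z g h = zero_mor C W Z"
  obtains k where "k \<in> mor C W X" "Comp C W X Y f k = h"
  using conflation_lift_unique[OF assms] by blast

lemma conflation_extend_unique:
  assumes "(X, f, Y, g, Z) \<in> S" "W \<in> Obj C" "h \<in> mor C Y W" "Comp C X Y W h f = zero_mor C X W"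
  shows "\<exists>!k. k \<in> mor C Z W \<and> Comp C Y Z W k g = h"
  using conflation[OF assms(1)] assms(2-4) unfolding kernel_cokernel_pair_def is_cokernel_def by blast

lemma conflation_extend:
  assumes "(X, f, Y, g, Z) \<in> S" "W \<in> Obj C" "h \<in> mor C Y W" "Comp C X Y W h f = zero_mor C X W"
  obtains k where "k \<in> mor C Z W" "Comp C Y Z W k g = h"
  using conflation_extend_unique[OF assms] by blast

lemma conflation_epi:
  assumes c: "(X, f, Y, g, Z) \<in> S" and W: "W \<in> Obj C" and hk: "h \<in> mor C Z W" "k \<in> mor C Z W"
    and e: "Comp C Y Z W h g = Comp C Y Z W k g"
  shows "h = k"
proof -
  note [simp] = conflationD(1-6)[OF c] W hk
  have "Comp C X Y W (Comp C Y Z W h g) f = zero_mor C X W" by simp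
  then have "\<exists>!l. l \<in> mor C Z W \<and> Comp C Y Z W l g = Comp C Y Z W h g"
    by (intro conflation_extend_unique[OF c W]) simp_all
  then obtain l where u: "\<And>y. y \<in> mor C Z W \<Longrightarrow> Comp C Y Z W y g = Comp C Y Z W h g \<Longrightarrow> y = l"
    by blast
  show ?thesis using u[OF hk(1) refl] u[OF hk(2) e[symmetric]] by simp
qed

lemma conflation_mono:
  assumes c: "(X, f, Y, g, Z) \<in> S" and W: "W \<in> Obj C" and hk: "h \<in> mor C W X" "k \<in> mor C W X"
    and e: "Comp C W X Y f h = Comp C W X Y f k"
  shows "h = k"
proof -
  note [simp] = conflationD(1-6)[OF c] W hk Comp_eq_Comp[OF conflationD(6)[OF c]]
  have "Comp C W Y Z g (Comp C W X Y f h) = zero_mor C W Z" by simp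
  then have "\<exists>!l. l \<in> mor C W X \<and> Comp C W X Y f l = Comp C W X Y f h"
    by (intro conflation_lift_unique[OF c W]) simp_all
  then obtain l where u: "\<And>y. y \<in> mor C W X \<Longrightarrow> Comp C W X Y f y = Comp C W X Y f h \<Longrightarrow> y = l"
    by blast
  show ?thesis using u[OF hk(1) refl] u[OF hk(2) e[symmetric]] by simp
qed

lemma injective_extend:
  assumes "injective C S A" "admissible_mono S X Y f" "h \<in> mor C X A"
  obtains k where "k \<in> mor C Y A" "Comp C X Y A k f = h"
  using assms unfolding injective_def by blast

lemma projective_lift:
  assumes "projective C S P" "admissible_epi S Y Z g" "h \<in> mor C P Z"
  obtains k where "k \<in> mor C P Y" "Comp C P Y Z g k = h"
  using assms unfolding projective_def by blast

text \<open>
  The cokernel of the map parallel to j in a pushout is the cokernel of j.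
\<close>

lemma pushout_cokernel:
  assumes c: "(X, j, A, q, M) \<in> S" and p: "is_pushout C X A Y P j f e g"
    and t: "t \<in> mor C P M" "Comp C A P M t e = q" "Comp C Y P M t g = zero_mor C Y M"
    and W: "W \<in> Obj C" and r: "r \<in> mor C P W" "Comp C Y P W r g = zero_mor C Y W"
  obtains z where "z \<in> mor C M W" "r = Comp C P M W z t"
proof -
  note [simp] = conflationD(1-6)[OF c] pushoutD(1-8)[OF p] t W r
  have "Comp C X A W (Comp C A P W r e) j = Comp C X Y W (Comp C Y P W r g) f"
    using pushoutD(9)[OF p] by (simp del: r(2))
  then have "Comp C X A W (Comp C A P W r e) j = zero_mor C X W"
    by simp
  then obtain z where z [simp]: "z \<in> mor C M W" and zq: "Comp C A M W z q = Comp C A P W r e"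
    by (rule conflation_extend[OF c W Comp_in[OF pushoutD(2,4)[OF p] W pushoutD(7)[OF p] r(1)]])
  have "r = Comp C P M W z t"
    by (rule pushout_eqI[OF p W]) (simp_all add: zq)
  then show ?thesis by (rule that[OF z])
qed

end

context frobenius_category
begin

lemma stable_idealI:
  assumes "X \<in> Obj C" "Y \<in> Obj C" "injective C S P" "a \<in> mor C X P" "b \<in> mor C P Y"
  shows "Comp C X P Y b a \<in> stable_ideal C S X Y"
  using assms Comp_in[of X P Y a b] projective_iff_injective
  unfolding stable_ideal_def injective_def by blast

lemma stable_ideal_iff:
  assumes j: "admissible_mono S X A j" and A: "injective C S A" and Y: "Y \<in> Obj C"
  shows "f \<in> stable_ideal C S X Y \<longleftrightarrow> (\<exists>k\<in>mor C A Y. f = Comp C X A Y k j)"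
proof -
  note [simp] = admissible_monoD[OF j] Y
  show ?thesis
  proof
    assume "f \<in> stable_ideal C S X Y"
    then obtain P a b where P: "injective C S P" and ab [simp]: "a \<in> mor C X P" "b \<in> mor C P Y"
      and f: "f = Comp C X P Y b a"
      unfolding stable_ideal_def by blast
    have [simp]: "P \<in> Obj C" using P by (simp add: injective_def)
    obtain k where k: "k \<in> mor C A P" "Comp C X A P k j = a"
      by (rule injective_extend[OF P j ab(1)])
    show "\<exists>k\<in>mor C A Y. f = Comp C X A Y k j"
      by (rule bexI[of _ "Comp C A P Y b k"]) (simp_all add: f k)
  next
    assume "\<exists>k\<in>mor C A Y. f = Comp C X A Y k j"
    then show "f \<in> stable_ideal C S X Y"
      using stable_idealI[OF _ Y A, of X j] by auto
  qed
qed

lemma stable_ideal_is_ideal: "additive_hom_ideal C (stable_ideal C S)"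
proof (intro additive_hom_ideal.intro hom_ideal.intro hom_ideal_axioms.intro
    additive_category_axioms preadditive_category_axioms)
  fix X Y assume [simp]: "X \<in> Obj C" "Y \<in> Obj C"
  interpret XY: comm_group "Hom C X Y" by (rule Hom_group) simp_all
  obtain A j where A: "injective C S A" and j: "admissible_mono S X A j"
    using enough_injectives[of X] by auto
  note [simp] = admissible_monoD[OF j]
  note si = stable_ideal_iff[OF j A \<open>Y \<in> Obj C\<close>]
  show "subgroup (stable_ideal C S X Y) (Hom C X Y)"
  proof (rule XY.subgroupI)
    show "stable_ideal C S X Y \<subseteq> mor C X Y" by (auto simp: stable_ideal_def)
    show "stable_ideal C S X Y \<noteq> {}"
      using si[of "Comp C X A Y (zero_mor C A Y) j"] zero_in[of A Y] by (metis \<open>Y \<in> Obj C\<close> admissible_monoD(2)[OF j] empty_iff)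
    show "inv\<^bsub>Hom C X Y\<^esub> f \<in> stable_ideal C S X Y" if f: "f \<in> stable_ideal C S X Y" for f
    proof -
      obtain k where k: "k \<in> mor C A Y" "f = Comp C X A Y k j" using f si by blast
      then have "inv\<^bsub>Hom C X Y\<^esub> f = Comp C X A Y (inv\<^bsub>Hom C A Y\<^esub> k) j" by simp
      with k(1) show ?thesis
        unfolding si by (intro bexI[of _ "inv\<^bsub>Hom C A Y\<^esub> k"]) simp_all
    qed
    show "f \<otimes>\<^bsub>Hom C X Y\<^esub> f' \<in> stable_ideal C S X Y"
      if f: "f \<in> stable_ideal C S X Y" "f' \<in> stable_ideal C S X Y" for f f'
    proof -
      obtain k where k: "k \<in> mor C A Y" "f = Comp C X A Y k j" using f(1) si by blast
      obtain k' where k': "k' \<in> mor C A Y" "f' = Comp C X A Y k' j" using f(2) si by blast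
      have "f \<otimes>\<^bsub>Hom C X Y\<^esub> f' = Comp C X A Y (k \<otimes>\<^bsub>Hom C A Y\<^esub> k') j" using k k' by simp
      with k(1) k'(1) show ?thesis
        unfolding si by (intro bexI[of _ "k \<otimes>\<^bsub>Hom C A Y\<^esub> k'"]) simp_all
    qed
  qed
next
  fix X Y Z f g
  assume [simp]: "X \<in> Obj C" "Y \<in> Obj C" "Z \<in> Obj C" "g \<in> mor C Y Z" and f: "f \<in> stable_ideal C S X Y"
  obtain P a b where P: "injective C S P" and [simp]: "P \<in> Obj C" "a \<in> mor C X P" "b \<in> mor C P Y"
    and f: "f = Comp C X P Y b a"
    using f unfolding stable_ideal_def injective_def by blast
  have "Comp C X P Z (Comp C P Y Z g b) a \<in> stable_ideal C S X Z"
    by (rule stable_idealI[OF _ _ P]) simp_all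
  then show "Comp C X Y Z g f \<in> stable_ideal C S X Z"
    by (simp add: f)
next
  fix X Y Z f g
  assume [simp]: "X \<in> Obj C" "Y \<in> Obj C" "Z \<in> Obj C" "f \<in> mor C X Y" and g: "g \<in> stable_ideal C S Y Z"
  obtain P a b where P: "injective C S P" and [simp]: "P \<in> Obj C" "a \<in> mor C Y P" "b \<in> mor C P Z"
    and g: "g = Comp C Y P Z b a"
    using g unfolding stable_ideal_def injective_def by blast
  have "Comp C X P Z b (Comp C X Y P a f) \<in> stable_ideal C S X Z"
    by (rule stable_idealI[OF _ _ P]) simp_all
  then show "Comp C X Y Z g f \<in> stable_ideal C S X Z"
    by (simp add: g)
qed

text \<open>
  Let (f, g, h) be a morphism of conflations with injective middle terms. If f = k j, then g - j' k
  vanishes on j, and dividing it by q shows that h factors through A'. If conversely h factors through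
  a projective, it factors as q' r, and g - r q has a lift k to X', for which f = k j. The two directions
  give that the shift is well defined and faithful.
\<close>

lemma conflation_map_ideal:
  assumes c: "(X, j, A, q, M) \<in> S" and c': "(X', j', A', q', M') \<in> S"
    and A: "injective C S A" and A': "injective C S A'"
    and f: "f \<in> mor C X X'" and g: "g \<in> mor C A A'" and h: "h \<in> mor C M M'"
    and gj: "Comp C X A A' g j = Comp C X X' A' j' f" and hq: "Comp C A M M' h q = Comp C A A' M' q' g"
  shows "f \<in> stable_ideal C S X X' \<longleftrightarrow> h \<in> stable_ideal C S M M'"
proof
  note d [simp] = conflationD(1-6)[OF c] conflationD(1-6)[OF c']
  note [simp] = f g h
  show "h \<in> stable_ideal C S M M'" if fJ: "f \<in> stable_ideal C S X X'"
  proof -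
    obtain k where k [simp]: "k \<in> mor C A X'" and fk: "f = Comp C X A X' k j"
      using fJ unfolding stable_ideal_iff[OF conflationD(7)[OF c] A conflationD(1)[OF c']] by blast
    have "Comp C X A A' (diff A A' g (Comp C A X' A' j' k)) j = zero_mor C X A'"
      by (simp add: gj, simp add: fk)
    then obtain r where r [simp]: "r \<in> mor C M A'" and rq: "Comp C A M A' r q = diff A A' g (Comp C A X' A' j' k)"
      by (rule conflation_extend[OF c conflationD(2)[OF c'] diff_in[OF conflationD(2)[OF c] conflationD(2)[OF c'] g
            Comp_in[OF conflationD(2)[OF c] conflationD(1,2)[OF c'] k conflationD(4)[OF c']]]])
    have "h = Comp C M A' M' q' r"
      by (rule conflation_epi[OF c, of M']) (simp_all add: rq hq Comp_eq_Comp[OF conflationD(6)[OF c']])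
    then show ?thesis
      using stable_idealI[OF _ _ A' r, of M' q'] by simp
  qed
  show "f \<in> stable_ideal C S X X'" if hJ: "h \<in> stable_ideal C S M M'"
  proof -
    obtain P a b where P: "projective C S P" and ab [simp]: "a \<in> mor C M P" "b \<in> mor C P M'"
      and hab: "h = Comp C M P M' b a"
      using hJ unfolding stable_ideal_def by blast
    have [simp]: "P \<in> Obj C" using P by (simp add: projective_def)
    obtain b' where b' [simp]: "b' \<in> mor C P A'" and qb': "Comp C P A' M' q' b' = b"
      by (rule projective_lift[OF P conflationD(8)[OF c'] ab(2)])
    let ?r = "Comp C M P A' b' a"
    have qr: "Comp C M A' M' q' ?r = h" by (simp add: Comp_eq_Comp[OF qb'] hab)
    have "Comp C A A' M' q' (diff A A' g (Comp C A M A' ?r q)) = zero_mor C A M'"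
      using hq by (simp add: Comp_eq_Comp[OF qb'] hab)
    then obtain k where k [simp]: "k \<in> mor C A X'" and jk: "Comp C A X' A' j' k = diff A A' g (Comp C A M A' ?r q)"
      by (rule conflation_lift[OF c', of A, rotated 2]) simp_all
    have "f = Comp C X A X' k j"
      by (rule conflation_mono[OF c', of X]) (simp_all add: Comp_eq_Comp[OF jk] gj)
    then show ?thesis
      using stable_idealI[OF _ _ A, of X X' j k] by simp
  qed
qed

lemma conflation_map_exists:
  assumes c: "(X, j, A, q, M) \<in> S" and c': "(X', j', A', q', M') \<in> S"
    and A': "injective C S A'" and f: "f \<in> mor C X X'"
  obtains g h where "g \<in> mor C A A'" "h \<in> mor C M M'"
    "Comp C X A A' g j = Comp C X X' A' j' f" "Comp C A M M' h q = Comp C A A' M' q' g"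
proof -
  note [simp] = conflationD(1-6)[OF c] conflationD(1-6)[OF c'] f
  have "Comp C X X' A' j' f \<in> mor C X A'" by simp
  then obtain g where g [simp]: "g \<in> mor C A A'" and gj: "Comp C X A A' g j = Comp C X X' A' j' f"
    by (rule injective_extend[OF A' conflationD(7)[OF c]])
  have "Comp C X A M' (Comp C A A' M' q' g) j = zero_mor C X M'"
    by (simp add: gj Comp_eq_Comp[OF conflationD(6)[OF c']])
  then obtain h where "h \<in> mor C M M'" "Comp C A M M' h q = Comp C A A' M' q' g"
    by (rule conflation_extend[OF c, of M', rotated 2]) simp_all
  with g gj show ?thesis by (intro that)
qed

text \<open>
  The value of T on a class is chosen via some representative with a lift to the injectives. By
  conflation_map_ideal, applied to differences of such data, it does not depend on these choices.
\<close>

lemma stable_shift_exists: "\<exists>I \<iota> \<pi> T. stable_shift C S I \<iota> \<pi> T"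
proof -
  have "\<exists>A j q M. X \<in> Obj C \<longrightarrow> injective C S A \<and> (X, j, A, q, M) \<in> S" for X
    using enough_injectives[of X] unfolding admissible_mono_def by blast
  then obtain I \<iota> \<pi> T where c: "\<And>X. X \<in> Obj C \<Longrightarrow> injective C S (I X) \<and> (X, \<iota> X, I X, \<pi> X, T X) \<in> S"
    by metis
  interpret additive_hom_ideal C "stable_ideal C S" by (rule stable_ideal_is_ideal)
  let ?sq = "\<lambda>X Y f g h. f \<in> mor C X Y \<and> g \<in> mor C (I X) (I Y) \<and> h \<in> mor C (T X) (T Y) \<and>
      Comp C X (I X) (I Y) g (\<iota> X) = Comp C X Y (I Y) (\<iota> Y) f \<and>
      Comp C (I X) (T X) (T Y) h (\<pi> X) = Comp C (I X) (I Y) (T Y) (\<pi> Y) g"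
  \<comment> \<open>The choice is made among the data of all representatives f of the class F.\<close>
  define TM where "TM X Y F = (SOME H. \<exists>f g h. F = cls X Y f \<and> ?sq X Y f g h \<and> H = cls (T X) (T Y) h)" for X Y F
  have "TM X Y (cls X Y f) = cls (T X) (T Y) h"
    if X: "X \<in> Obj C" and Y: "Y \<in> Obj C" and sq: "?sq X Y f g h" for X Y f g h
  proof -
    have "\<exists>H f' g' h'. cls X Y f = cls X Y f' \<and> ?sq X Y f' g' h' \<and> H = cls (T X) (T Y) h'"
      using sq by blast
    from someI_ex[OF this] obtain f' g' h' where cl: "cls X Y f = cls X Y f'" and sq': "?sq X Y f' g' h'"
      and TM: "TM X Y (cls X Y f) = cls (T X) (T Y) h'"
      unfolding TM_def by blast
    note cX = conjunct2[OF c[OF X]] and cY = conjunct2[OF c[OF Y]]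
    note [simp] = conflationD(1-5)[OF cX] conflationD(1-5)[OF cY]
    have m [simp]: "f \<in> mor C X Y" "f' \<in> mor C X Y" "g \<in> mor C (I X) (I Y)" "g' \<in> mor C (I X) (I Y)"
      "h \<in> mor C (T X) (T Y)" "h' \<in> mor C (T X) (T Y)"
      using sq sq' by blast+
    have e: "Comp C X (I X) (I Y) g (\<iota> X) = Comp C X Y (I Y) (\<iota> Y) f"
      "Comp C X (I X) (I Y) g' (\<iota> X) = Comp C X Y (I Y) (\<iota> Y) f'"
      "Comp C (I X) (T X) (T Y) h (\<pi> X) = Comp C (I X) (I Y) (T Y) (\<pi> Y) g"
      "Comp C (I X) (T X) (T Y) h' (\<pi> X) = Comp C (I X) (I Y) (T Y) (\<pi> Y) g'"
      using sq sq' by blast+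
    have "diff X Y f f' \<in> stable_ideal C S X Y"
      using cl by (simp add: cls_eq_iff)
    moreover have "diff X Y f f' \<in> stable_ideal C S X Y \<longleftrightarrow> diff (T X) (T Y) h h' \<in> stable_ideal C S (T X) (T Y)"
      by (rule conflation_map_ideal[OF cX cY conjunct1[OF c[OF X]] conjunct1[OF c[OF Y]],
            where g = "diff (I X) (I Y) g g'"]) (simp_all add: e)
    ultimately have "cls (T X) (T Y) h = cls (T X) (T Y) h'"
      by (simp add: cls_eq_iff)
    then show ?thesis using TM by simp
  qed
  then have "stable_shift C S I \<iota> \<pi> \<lparr>FObj = T, FMor = TM\<rparr>"
    unfolding stable_shift_def using c by auto
  then show ?thesis by blast
qed

end

text \<open>
  The ideal J is only required to agree with the stable ideal on objects, so that the results apply to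
  the homotopy category as it is defined, without transport along an equality of categories.
\<close>

locale happel_shift = frobenius_category C S
  for C :: "('o, 'm) precat" and S :: "('o, 'm) ses set" +
  fixes J :: "'o \<Rightarrow> 'o \<Rightarrow> 'm set"
    and I :: "'o \<Rightarrow> 'o" and \<iota> :: "'o \<Rightarrow> 'm" and \<pi> :: "'o \<Rightarrow> 'm" and T :: "('o, 'm set, 'o, 'm set) fctr"
  assumes J_stable: "X \<in> Obj C \<Longrightarrow> Y \<in> Obj C \<Longrightarrow> J X Y = stable_ideal C S X Y"
    and shift: "stable_shift C S I \<iota> \<pi> T"
begin

lemma J_ideal: "additive_hom_ideal C J"
proof -
  interpret st: additive_hom_ideal C "stable_ideal C S" by (rule stable_ideal_is_ideal)
  show ?thesis
    by (intro additive_hom_ideal.intro hom_ideal.intro hom_ideal_axioms.intro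
        additive_category_axioms preadditive_category_axioms)
      (simp_all add: J_stable st.ideal_subgroup st.ideal_Comp_left st.ideal_Comp_right)
qed

sublocale additive_hom_ideal C J
  by (rule J_ideal)

lemma JI:
  assumes "X \<in> Obj C" "Y \<in> Obj C" "injective C S P" "a \<in> mor C X P" "b \<in> mor C P Y" "f = Comp C X P Y b a"
  shows "f \<in> J X Y"
  using stable_idealI[OF assms(1-5)] assms(1,2,6) by (simp add: J_stable)

lemma injective_I: "X \<in> Obj C \<Longrightarrow> injective C S (I X)"
  using shift unfolding stable_shift_def by blast

lemma shift_conflation: "X \<in> Obj C \<Longrightarrow> (X, \<iota> X, I X, \<pi> X, FObj T X) \<in> S"
  using shift unfolding stable_shift_def by blast

lemma shift_in [simp]:
  assumes "X \<in> Obj C"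
  shows "I X \<in> Obj C" "FObj T X \<in> Obj C" "\<iota> X \<in> mor C X (I X)" "\<pi> X \<in> mor C (I X) (FObj T X)"
    "Comp C X (I X) (FObj T X) (\<pi> X) (\<iota> X) = zero_mor C X (FObj T X)"
    "W \<in> Obj C \<Longrightarrow> k \<in> mor C W X \<Longrightarrow>
      Comp C W (I X) (FObj T X) (\<pi> X) (Comp C W X (I X) (\<iota> X) k) = zero_mor C W (FObj T X)"
  using conflationD(1-6)[OF shift_conflation[OF assms]]
    Comp_eq_Comp[OF conflationD(6)[OF shift_conflation[OF assms]]] assms by simp_all

lemmas \<iota>_mono = conflationD(7)[OF shift_conflation]
lemmas \<pi>_epi = conflationD(8)[OF shift_conflation]

lemma J_iff:
  assumes "X \<in> Obj C" "Y \<in> Obj C"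
  shows "f \<in> J X Y \<longleftrightarrow> (\<exists>k\<in>mor C (I X) Y. f = Comp C X (I X) Y k (\<iota> X))"
  unfolding J_stable[OF assms] by (rule stable_ideal_iff[OF \<iota>_mono[OF assms(1)] injective_I[OF assms(1)] assms(2)])

lemma mor_class_stable:
  "X \<in> Obj C \<Longrightarrow> Y \<in> Obj C \<Longrightarrow> mor_class C (stable_ideal C S) X Y f = cls X Y f"
  by (simp add: mor_class_def J_stable)

lemma T_cls:
  assumes "X \<in> Obj C" "Y \<in> Obj C" "f \<in> mor C X Y" "g \<in> mor C (I X) (I Y)" "h \<in> mor C (FObj T X) (FObj T Y)"
    and "Comp C X (I X) (I Y) g (\<iota> X) = Comp C X Y (I Y) (\<iota> Y) f"
    and "Comp C (I X) (FObj T X) (FObj T Y) h (\<pi> X) = Comp C (I X) (I Y) (FObj T Y) (\<pi> Y) g"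
  shows "FMor T X Y (cls X Y f) = cls (FObj T X) (FObj T Y) h"
  using shift assms unfolding stable_shift_def by (simp add: mor_class_stable)

lemma T_clsE:
  assumes X: "X \<in> Obj C" and Y: "Y \<in> Obj C" and f: "f \<in> mor C X Y"
  obtains g h where "g \<in> mor C (I X) (I Y)" "h \<in> mor C (FObj T X) (FObj T Y)"
    "Comp C X (I X) (I Y) g (\<iota> X) = Comp C X Y (I Y) (\<iota> Y) f"
    "Comp C (I X) (FObj T X) (FObj T Y) h (\<pi> X) = Comp C (I X) (I Y) (FObj T Y) (\<pi> Y) g"
    "FMor T X Y (cls X Y f) = cls (FObj T X) (FObj T Y) h"
proof -
  obtain g h where gh: "g \<in> mor C (I X) (I Y)" "h \<in> mor C (FObj T X) (FObj T Y)"
    "Comp C X (I X) (I Y) g (\<iota> X) = Comp C X Y (I Y) (\<iota> Y) f"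
    "Comp C (I X) (FObj T X) (FObj T Y) h (\<pi> X) = Comp C (I X) (I Y) (FObj T Y) (\<pi> Y) g"
    by (rule conflation_map_exists[OF shift_conflation[OF X] shift_conflation[OF Y] injective_I[OF Y] f])
  from that[OF this T_cls[OF X Y f this]] show ?thesis .
qed

lemma T_additive_functor: "additive_functor Q Q T"
  unfolding additive_functor_def is_functor_def
proof (intro conjI ballI)
  fix X assume "X \<in> Obj Q"
  then have [simp]: "X \<in> Obj C" by simp
  show "FObj T X \<in> Obj Q" by simp
  show "FMor T X X (Ident Q X) = Ident Q (FObj T X)"
    unfolding Ident_quotient by (rule T_cls[where g = "Ident C (I X)"]) simp_all
next
  fix X Y F assume XY: "X \<in> Obj Q" "Y \<in> Obj Q" and "F \<in> mor Q X Y"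
  then have [simp]: "X \<in> Obj C" "Y \<in> Obj C" by simp_all
  obtain f where f: "f \<in> mor C X Y" and F: "F = cls X Y f"
    using \<open>F \<in> mor Q X Y\<close> by (rule mor_quotientE)
  obtain g h where "h \<in> mor C (FObj T X) (FObj T Y)" "FMor T X Y (cls X Y f) = cls (FObj T X) (FObj T Y) h"
    by (rule T_clsE[OF _ _ f]) simp_all
  then show "FMor T X Y F \<in> mor Q (FObj T X) (FObj T Y)"
    by (simp add: F)
next
  fix X Y Z F G assume XYZ: "X \<in> Obj Q" "Y \<in> Obj Q" "Z \<in> Obj Q" and F: "F \<in> mor Q X Y" and G: "G \<in> mor Q Y Z"
  then have [simp]: "X \<in> Obj C" "Y \<in> Obj C" "Z \<in> Obj C" by simp_all
  obtain f where f [simp]: "f \<in> mor C X Y" and F: "F = cls X Y f" using F by (rule mor_quotientE)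
  obtain g where g [simp]: "g \<in> mor C Y Z" and G: "G = cls Y Z g" using G by (rule mor_quotientE)
  obtain a h where f': "a \<in> mor C (I X) (I Y)" "h \<in> mor C (FObj T X) (FObj T Y)"
    "Comp C X (I X) (I Y) a (\<iota> X) = Comp C X Y (I Y) (\<iota> Y) f"
    "Comp C (I X) (FObj T X) (FObj T Y) h (\<pi> X) = Comp C (I X) (I Y) (FObj T Y) (\<pi> Y) a"
    "FMor T X Y (cls X Y f) = cls (FObj T X) (FObj T Y) h"
    by (rule T_clsE[OF _ _ f]) simp_all
  obtain b k where g': "b \<in> mor C (I Y) (I Z)" "k \<in> mor C (FObj T Y) (FObj T Z)"
    "Comp C Y (I Y) (I Z) b (\<iota> Y) = Comp C Y Z (I Z) (\<iota> Z) g"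
    "Comp C (I Y) (FObj T Y) (FObj T Z) k (\<pi> Y) = Comp C (I Y) (I Z) (FObj T Z) (\<pi> Z) b"
    "FMor T Y Z (cls Y Z g) = cls (FObj T Y) (FObj T Z) k"
    by (rule T_clsE[OF _ _ g]) simp_all
  note [simp] = f'(1,2) g'(1,2)
  have "FMor T X Z (cls X Z (Comp C X Y Z g f)) = cls (FObj T X) (FObj T Z) (Comp C (FObj T X) (FObj T Y) (FObj T Z) k h)"
    by (rule T_cls[where g = "Comp C (I X) (I Y) (I Z) b a"])
      (simp_all add: f'(3,4) Comp_eq_Comp[OF g'(3)] Comp_eq_Comp[OF g'(4)])
  then show "FMor T X Z (Comp Q X Y Z G F)
    = Comp Q (FObj T X) (FObj T Y) (FObj T Z) (FMor T Y Z G) (FMor T X Y F)"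
    by (simp add: F G f'(5) g'(5))
next
  fix X Y assume XY: "X \<in> Obj Q" "Y \<in> Obj Q"
  then have [simp]: "X \<in> Obj C" "Y \<in> Obj C" by simp_all
  show "FMor T X Y \<in> hom (Hom Q X Y) (Hom Q (FObj T X) (FObj T Y))"
  proof (rule homI)
    fix F assume F: "F \<in> mor Q X Y"
    obtain f where f [simp]: "f \<in> mor C X Y" and F: "F = cls X Y f" using F by (rule mor_quotientE)
    obtain a h where f': "a \<in> mor C (I X) (I Y)" "h \<in> mor C (FObj T X) (FObj T Y)"
      "Comp C X (I X) (I Y) a (\<iota> X) = Comp C X Y (I Y) (\<iota> Y) f"
      "Comp C (I X) (FObj T X) (FObj T Y) h (\<pi> X) = Comp C (I X) (I Y) (FObj T Y) (\<pi> Y) a"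
      "FMor T X Y (cls X Y f) = cls (FObj T X) (FObj T Y) h"
      by (rule T_clsE[OF _ _ f]) simp_all
    show "FMor T X Y F \<in> mor Q (FObj T X) (FObj T Y)"
      using f'(2) by (simp add: F f'(5))
    fix G assume G: "G \<in> mor Q X Y"
    obtain g where g [simp]: "g \<in> mor C X Y" and G: "G = cls X Y g" using G by (rule mor_quotientE)
    obtain b k where g': "b \<in> mor C (I X) (I Y)" "k \<in> mor C (FObj T X) (FObj T Y)"
      "Comp C X (I X) (I Y) b (\<iota> X) = Comp C X Y (I Y) (\<iota> Y) g"
      "Comp C (I X) (FObj T X) (FObj T Y) k (\<pi> X) = Comp C (I X) (I Y) (FObj T Y) (\<pi> Y) b"
      "FMor T X Y (cls X Y g) = cls (FObj T X) (FObj T Y) k"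
      by (rule T_clsE[OF _ _ g]) simp_all
    note [simp] = f'(1,2) g'(1,2)
    have "FMor T X Y (cls X Y (f \<otimes>\<^bsub>Hom C X Y\<^esub> g)) = cls (FObj T X) (FObj T Y) (h \<otimes>\<^bsub>Hom C (FObj T X) (FObj T Y)\<^esub> k)"
      by (rule T_cls[where g = "a \<otimes>\<^bsub>Hom C (I X) (I Y)\<^esub> b"]) (simp_all add: f'(3,4) g'(3,4))
    then show "FMor T X Y (F \<otimes>\<^bsub>Hom Q X Y\<^esub> G)
      = FMor T X Y F \<otimes>\<^bsub>Hom Q (FObj T X) (FObj T Y)\<^esub> FMor T X Y G"
      by (simp add: F G f'(5) g'(5))
  qed
qed

sublocale shifted_category Q T
  by (intro shifted_category.intro shifted_category_axioms.intro Q.additive_category_axioms T_additive_functor)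

lemma T_faithful:
  assumes "X \<in> Obj Q" "Y \<in> Obj Q" and F: "F \<in> mor Q X Y" and G: "G \<in> mor Q X Y"
    and eq: "FMor T X Y F = FMor T X Y G"
  shows "F = G"
proof -
  have X [simp]: "X \<in> Obj C" and Y [simp]: "Y \<in> Obj C" using assms(1,2) by simp_all
  obtain f where f [simp]: "f \<in> mor C X Y" and F: "F = cls X Y f" using F by (rule mor_quotientE)
  obtain a h where f': "a \<in> mor C (I X) (I Y)" "h \<in> mor C (FObj T X) (FObj T Y)"
    "Comp C X (I X) (I Y) a (\<iota> X) = Comp C X Y (I Y) (\<iota> Y) f"
    "Comp C (I X) (FObj T X) (FObj T Y) h (\<pi> X) = Comp C (I X) (I Y) (FObj T Y) (\<pi> Y) a"
    "FMor T X Y (cls X Y f) = cls (FObj T X) (FObj T Y) h"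
    by (rule T_clsE[OF _ _ f]) simp_all
  obtain g where g [simp]: "g \<in> mor C X Y" and G: "G = cls X Y g" using G by (rule mor_quotientE)
  obtain b k where g': "b \<in> mor C (I X) (I Y)" "k \<in> mor C (FObj T X) (FObj T Y)"
    "Comp C X (I X) (I Y) b (\<iota> X) = Comp C X Y (I Y) (\<iota> Y) g"
    "Comp C (I X) (FObj T X) (FObj T Y) k (\<pi> X) = Comp C (I X) (I Y) (FObj T Y) (\<pi> Y) b"
    "FMor T X Y (cls X Y g) = cls (FObj T X) (FObj T Y) k"
    by (rule T_clsE[OF _ _ g]) simp_all
  note [simp] = f'(1,2) g'(1,2)
  have "diff (FObj T X) (FObj T Y) h k \<in> J (FObj T X) (FObj T Y)"
    using eq by (simp add: F G f'(5) g'(5) cls_eq_iff)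
  moreover have "diff X Y f g \<in> stable_ideal C S X Y
      \<longleftrightarrow> diff (FObj T X) (FObj T Y) h k \<in> stable_ideal C S (FObj T X) (FObj T Y)"
    by (rule conflation_map_ideal[OF shift_conflation[OF X] shift_conflation[OF Y] injective_I[OF X] injective_I[OF Y],
          where g = "diff (I X) (I Y) a b"]) (simp_all add: f'(3,4) g'(3,4))
  ultimately show ?thesis
    by (simp add: F G cls_eq_iff J_stable)
qed

text \<open>
  A map h of the shifts lifts to the injectives, since these are also projective, and then restricts to
  the kernels.
\<close>

lemma T_full:
  assumes "X \<in> Obj Q" "Y \<in> Obj Q" and H: "H \<in> mor Q (FObj T X) (FObj T Y)"
  shows "\<exists>F\<in>mor Q X Y. FMor T X Y F = H"
proof -
  have X [simp]: "X \<in> Obj C" and Y [simp]: "Y \<in> Obj C" using assms(1,2) by simp_all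
  obtain h where h [simp]: "h \<in> mor C (FObj T X) (FObj T Y)" and H: "H = cls (FObj T X) (FObj T Y) h"
    using H by (rule mor_quotientE)
  have P: "projective C S (I X)" using injective_I[OF X] projective_iff_injective by blast
  have "Comp C (I X) (FObj T X) (FObj T Y) h (\<pi> X) \<in> mor C (I X) (FObj T Y)" by simp
  then obtain g where g [simp]: "g \<in> mor C (I X) (I Y)"
    and pg: "Comp C (I X) (I Y) (FObj T Y) (\<pi> Y) g = Comp C (I X) (FObj T X) (FObj T Y) h (\<pi> X)"
    by (rule projective_lift[OF P \<pi>_epi[OF Y]])
  have "Comp C X (I Y) (FObj T Y) (\<pi> Y) (Comp C X (I X) (I Y) g (\<iota> X)) = zero_mor C X (FObj T Y)"
    by (simp add: Comp_eq_Comp[OF pg])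
  then obtain f where f: "f \<in> mor C X Y" "Comp C X Y (I Y) (\<iota> Y) f = Comp C X (I X) (I Y) g (\<iota> X)"
    by (rule conflation_lift[OF shift_conflation[OF Y], of X, rotated 2]) simp_all
  have "FMor T X Y (cls X Y f) = H"
    unfolding H by (rule T_cls[OF X Y f(1) g h]) (simp_all add: f pg)
  with f(1) show ?thesis by (intro bexI[of _ "cls X Y f"]) simp_all
qed

text \<open>
  Take the kernel X of an admissible epimorphism q from a projective P. Since P is injective, X --> P --> Y is a second
  conflation that computes the shift of X, so that T X and Y are stably isomorphic.
\<close>

lemma T_surj:
  assumes "Y \<in> Obj Q"
  shows "\<exists>X\<in>Obj Q. \<exists>e. is_iso Q (FObj T X) Y e"
proof -
  have Y [simp]: "Y \<in> Obj C" using assms by simp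
  obtain P q where P: "injective C S P" and "admissible_epi S P Y q"
    using enough_projectives[OF Y] projective_iff_injective by blast
  then obtain X j where c: "(X, j, P, q, Y) \<in> S"
    unfolding admissible_epi_def by blast
  note d [simp] = conflationD(1-5)[OF c]
  note c' = shift_conflation[OF d(1)] and I' = injective_I[OF d(1)]
  obtain g h where gh: "g \<in> mor C (I X) P" "h \<in> mor C (FObj T X) Y"
    "Comp C X (I X) P g (\<iota> X) = Comp C X X P j (Ident C X)"
    "Comp C (I X) (FObj T X) Y h (\<pi> X) = Comp C (I X) P Y q g"
    by (rule conflation_map_exists[OF c' c P Ident_in[OF d(1)]])
  obtain g' h' where gh': "g' \<in> mor C P (I X)" "h' \<in> mor C Y (FObj T X)"
    "Comp C X P (I X) g' j = Comp C X X (I X) (\<iota> X) (Ident C X)"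
    "Comp C P Y (FObj T X) h' q = Comp C P (I X) (FObj T X) (\<pi> X) g'"
    by (rule conflation_map_exists[OF c c' I' Ident_in[OF d(1)]])
  note [simp] = gh(1,2) gh'(1,2)
  have 0: "zero_mor C X X \<in> stable_ideal C S X X"
    using ideal_zero[of X X] by (simp add: J_stable)
  have "zero_mor C X X \<in> stable_ideal C S X X \<longleftrightarrow>
      diff (FObj T X) (FObj T X) (Comp C (FObj T X) Y (FObj T X) h' h) (Ident C (FObj T X))
        \<in> stable_ideal C S (FObj T X) (FObj T X)"
    by (rule conflation_map_ideal[OF c' c' I' I', where g = "diff (I X) (I X) (Comp C (I X) P (I X) g' g) (Ident C (I X))"])
      (use gh(3) gh'(3) in \<open>simp_all add: gh(4) gh'(4) Comp_eq_Comp[OF gh'(4)]\<close>)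
  moreover have "zero_mor C X X \<in> stable_ideal C S X X \<longleftrightarrow>
      diff Y Y (Comp C Y (FObj T X) Y h h') (Ident C Y) \<in> stable_ideal C S Y Y"
    by (rule conflation_map_ideal[OF c c P P, where g = "diff P P (Comp C P (I X) P g g') (Ident C P)"])
      (use gh(3) gh'(3) in \<open>simp_all add: gh(4) gh'(4) Comp_eq_Comp[OF gh(4)]\<close>)
  ultimately have "is_iso Q (FObj T X) Y (cls (FObj T X) Y h)"
    using 0 by (intro is_iso_clsI[where g = h']) (simp_all add: J_stable)
  then show ?thesis by auto
qed

end

section \<open>Standard triangles\<close>

context shifted_category
begin

lemma rotate_iso:
  assumes i: "triangle_iso K T (X, Y, Z, u, v, w) (X', Y', Z', u', v', w')"
    and t: "is_triangle K T (X, Y, Z, u, v, w)" and t': "is_triangle K T (X', Y', Z', u', v', w')"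
  shows "triangle_iso K T
    (Y, Z, FObj T X, v, w, inv\<^bsub>Hom K (FObj T X) (FObj T Y)\<^esub> (FMor T X Y u))
    (Y', Z', FObj T X', v', w', inv\<^bsub>Hom K (FObj T X') (FObj T Y')\<^esub> (FMor T X' Y' u'))"
proof -
  note [simp] = is_triangleD[OF t] is_triangleD[OF t']
  obtain a b c where m: "triangle_morphism K T (X, Y, Z, u, v, w) (X', Y', Z', u', v', w') a b c"
    and isos: "is_iso K X X' a" "is_iso K Y Y' b" "is_iso K Z Z' c"
    using i unfolding triangle_iso_def by auto
  note md = triangle_morphismD[OF m]
  note [simp] = md(1-3)
  have "is_iso K (FObj T X) (FObj T X') (FMor T X X' a)"
  proof -
    obtain a' where a': "a' \<in> mor K X' X" "Comp K X X' X a' a = Ident K X" "Comp K X' X X' a a' = Ident K X'"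
      using isos(1) by (rule is_isoE)
    show ?thesis
      by (rule is_isoI[where g = "FMor T X' X a'"]) (simp_all add: a' flip: T_Comp)
  qed
  moreover have "Comp K (FObj T X) (FObj T Y) (FObj T Y') (FMor T Y Y' b) (FMor T X Y u)
      = Comp K (FObj T X) (FObj T X') (FObj T Y') (FMor T X' Y' u') (FMor T X X' a)"
    by (simp add: md(4) flip: T_Comp)
  then have "triangle_morphism K T
    (Y, Z, FObj T X, v, w, inv\<^bsub>Hom K (FObj T X) (FObj T Y)\<^esub> (FMor T X Y u))
    (Y', Z', FObj T X', v', w', inv\<^bsub>Hom K (FObj T X') (FObj T Y')\<^esub> (FMor T X' Y' u')) b c (FMor T X X' a)"
    unfolding triangle_morphism_def by (simp add: md(5,6))
  ultimately show ?thesis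
    using isos by (intro triangle_isoI)
qed

end

context happel_shift
begin

definition \<Delta> :: "('o, 'm set) triangle set" where
  "\<Delta> = {t. is_triangle Q T t \<and> (\<exists>s\<in>standard_triangles C S I \<iota> \<pi> T. triangle_iso Q T s t)}"

abbreviation triangle_of :: "'o \<Rightarrow> 'o \<Rightarrow> 'm \<Rightarrow> 'o \<Rightarrow> 'm \<Rightarrow> 'm \<Rightarrow> ('o, 'm set) triangle" where
  "triangle_of X Y f P g h \<equiv> (X, Y, P, cls X Y f, cls Y P g, cls P (FObj T X) h)"

text \<open>
  The data of a standard triangle: the pushout P of the inclusion X --> I X along f, and its map to T X.
\<close>

definition is_cone ::
    "'o \<Rightarrow> 'o \<Rightarrow> 'm \<Rightarrow> 'o \<Rightarrow> 'm \<Rightarrow> 'm \<Rightarrow> 'm \<Rightarrow> bool" where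
  "is_cone X Y f P e g h \<longleftrightarrow>
     is_pushout C X (I X) Y P (\<iota> X) f e g \<and> h \<in> mor C P (FObj T X) \<and>
     Comp C (I X) P (FObj T X) h e = \<pi> X \<and> Comp C Y P (FObj T X) h g = zero_mor C Y (FObj T X)"

lemma is_coneD:
  assumes "is_cone X Y f P e g h"
  shows "is_pushout C X (I X) Y P (\<iota> X) f e g" "X \<in> Obj C" "Y \<in> Obj C" "P \<in> Obj C"
    "f \<in> mor C X Y" "e \<in> mor C (I X) P" "g \<in> mor C Y P" "h \<in> mor C P (FObj T X)"
    "Comp C X (I X) P e (\<iota> X) = Comp C X Y P g f"
    "Comp C (I X) P (FObj T X) h e = \<pi> X" "Comp C Y P (FObj T X) h g = zero_mor C Y (FObj T X)"
  using assms pushoutD[of X "I X" Y P "\<iota> X" f e g] unfolding is_cone_def by auto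

lemma is_cone_reassoc:
  assumes "is_cone X Y f P e g h" "W \<in> Obj C"
  shows "k \<in> mor C W X \<Longrightarrow> Comp C W (I X) P e (Comp C W X (I X) (\<iota> X) k) = Comp C W Y P g (Comp C W X Y f k)"
    "k \<in> mor C W (I X) \<Longrightarrow> Comp C W P (FObj T X) h (Comp C W (I X) P e k) = Comp C W (I X) (FObj T X) (\<pi> X) k"
    "k \<in> mor C W Y \<Longrightarrow> Comp C W P (FObj T X) h (Comp C W Y P g k) = zero_mor C W (FObj T X)"
proof -
  note d = is_coneD[OF assms(1)]
  note [simp] = d(2-8) assms(2)
  show "k \<in> mor C W X \<Longrightarrow> Comp C W (I X) P e (Comp C W X (I X) (\<iota> X) k) = Comp C W Y P g (Comp C W X Y f k)"
    using Comp_eq_Comp[OF d(9), of W k] by simp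
  show "k \<in> mor C W (I X) \<Longrightarrow> Comp C W P (FObj T X) h (Comp C W (I X) P e k) = Comp C W (I X) (FObj T X) (\<pi> X) k"
    using Comp_eq_Comp[OF d(10), of W k] by simp
  show "k \<in> mor C W Y \<Longrightarrow> Comp C W P (FObj T X) h (Comp C W Y P g k) = zero_mor C W (FObj T X)"
    using Comp_eq_Comp[OF d(11), of W k] by simp
qed

lemma standard_triangles_iff:
  "s \<in> standard_triangles C S I \<iota> \<pi> T \<longleftrightarrow>
   (\<exists>X Y f P e g h. is_cone X Y f P e g h \<and>
      s = (triangle_of X Y f P g h))"
proof
  assume s: "s \<in> standard_triangles C S I \<iota> \<pi> T"
  obtain X0 Y0 P0 u v w where s_eq: "s = (X0, Y0, P0, u, v, w)" by (cases s)
  from s[unfolded s_eq] show "\<exists>X Y f P e g h. is_cone X Y f P e g h \<and>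
      s = (triangle_of X Y f P g h)"
  proof (cases rule: standard_triangles.cases)
    case (1 f e g h)
    then have c: "is_cone X0 Y0 f P0 e g h" by (simp add: is_cone_def)
    have "s = (triangle_of X0 Y0 f P0 g h)"
      using 1(1-3) is_coneD(2-4)[OF c] by (simp add: s_eq mor_class_stable)
    with c show ?thesis by blast
  qed
next
  assume "\<exists>X Y f P e g h. is_cone X Y f P e g h \<and>
      s = (triangle_of X Y f P g h)"
  then obtain X Y f P e g h where c: "is_cone X Y f P e g h"
    and s: "s = (triangle_of X Y f P g h)" by blast
  note d = is_coneD[OF c]
  have "(X, Y, P, mor_class C (stable_ideal C S) X Y f, mor_class C (stable_ideal C S) Y P g,
      mor_class C (stable_ideal C S) P (FObj T X) h) \<in> standard_triangles C S I \<iota> \<pi> T"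
    by (rule standard_triangles.intros) (fact d)+
  then show "s \<in> standard_triangles C S I \<iota> \<pi> T"
    using d(2-4) by (simp add: s mor_class_stable)
qed

lemma cone_triangle:
  "is_cone X Y f P e g h \<Longrightarrow> is_triangle Q T (triangle_of X Y f P g h)"
  using is_coneD(2-8)[of X Y f P e g h] by (simp add: is_triangle_def)

lemma \<Delta>E:
  assumes "t \<in> \<Delta>"
  obtains X Y f P e g h where "is_cone X Y f P e g h"
    "triangle_iso Q T (triangle_of X Y f P g h) t" "is_triangle Q T t"
proof -
  obtain s where s: "s \<in> standard_triangles C S I \<iota> \<pi> T" "triangle_iso Q T s t" and t: "is_triangle Q T t"
    using assms unfolding \<Delta>_def by blast
  obtain X Y f P e g h where "is_cone X Y f P e g h"
    and "s = (triangle_of X Y f P g h)"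
    using s(1) unfolding standard_triangles_iff by blast
  with s(2) t show ?thesis by (intro that) simp_all
qed

lemma \<Delta>I:
  assumes "is_cone X Y f P e g h" "is_triangle Q T t"
    "triangle_iso Q T (triangle_of X Y f P g h) t"
  shows "t \<in> \<Delta>"
proof -
  have "(triangle_of X Y f P g h) \<in> standard_triangles C S I \<iota> \<pi> T"
    unfolding standard_triangles_iff using assms(1) by blast
  then show ?thesis unfolding \<Delta>_def using assms(2,3) by blast
qed

lemma is_iso_cls_Ident: "X \<in> Obj C \<Longrightarrow> is_iso Q X X (cls X X (Ident C X))"
  using Q.is_iso_Ident[of X] by simp

lemma cone_in_\<Delta>:
  assumes "is_cone X Y f P e g h"
  shows "(triangle_of X Y f P g h) \<in> \<Delta>"
  by (rule \<Delta>I[OF assms cone_triangle[OF assms]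
        triangle_isoI[OF triangle_morphism_Ident[OF cone_triangle[OF assms]]]])
    (use is_coneD(2-4)[OF assms] Q.is_iso_Ident in simp_all)

lemma \<Delta>_iso:
  assumes t: "t \<in> \<Delta>" and t': "is_triangle Q T t'" and i: "triangle_iso Q T t t'"
  shows "t' \<in> \<Delta>"
proof -
  obtain X Y f P e g h where c: "is_cone X Y f P e g h"
    and j: "triangle_iso Q T (triangle_of X Y f P g h) t" and tt: "is_triangle Q T t"
    by (rule \<Delta>E[OF t])
  obtain X1 Y1 Z1 u v w where t_eq: "t = (X1, Y1, Z1, u, v, w)" by (cases t)
  obtain X2 Y2 Z2 u' v' w' where t'_eq: "t' = (X2, Y2, Z2, u', v', w')" by (cases t')
  show ?thesis
    using triangle_iso_trans[OF j[unfolded t_eq] i[unfolded t_eq t'_eq] cone_triangle[OF c] tt[unfolded t_eq] t'[unfolded t'_eq]]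
    unfolding t'_eq by (rule \<Delta>I[OF c t'[unfolded t'_eq]])
qed

lemma cone_exists:
  assumes X: "X \<in> Obj C" and Y: "Y \<in> Obj C" and f: "f \<in> mor C X Y"
  obtains P e g h where "is_cone X Y f P e g h" "admissible_mono S Y P g"
proof -
  obtain P e g where p: "is_pushout C X (I X) Y P (\<iota> X) f e g" and g: "admissible_mono S Y P g"
    using pushout_mono[OF \<iota>_mono[OF X] Y f] by blast
  note [simp] = X Y f
  obtain h where "h \<in> mor C P (FObj T X)" "Comp C (I X) P (FObj T X) h e = \<pi> X"
    "Comp C Y P (FObj T X) h g = zero_mor C Y (FObj T X)"
    by (rule pushout_ex[OF p, of "FObj T X" "\<pi> X" "zero_mor C Y (FObj T X)"]) simp_all
  then have "is_cone X Y f P e g h" using p by (simp add: is_cone_def)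
  then show ?thesis using g by (rule that)
qed

lemma cone_extend:
  assumes c: "is_cone X Y f P e g h" and k: "k \<in> mor C Y W" "W \<in> Obj C" and l: "l \<in> mor C (I X) W"
    and "Comp C X (I X) W l (\<iota> X) = Comp C X Y W k f"
  obtains m where "m \<in> mor C P W" "Comp C (I X) P W m e = l" "Comp C Y P W m g = k"
  using pushout_ex[OF is_coneD(1)[OF c] k(2) l k(1)] assms(5) by blast

text \<open>
  A lift a of f to the injectives extends the inclusion Y --> I Y over the cone of f.
\<close>

lemma cone_to_injective:
  assumes c: "is_cone X Y f P e g h" and a: "a \<in> mor C (I X) (I Y)"
    and ai: "Comp C X (I X) (I Y) a (\<iota> X) = Comp C X Y (I Y) (\<iota> Y) f"
  obtains m where "m \<in> mor C P (I Y)" "Comp C (I X) P (I Y) m e = a" "Comp C Y P (I Y) m g = \<iota> Y"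
proof -
  note [simp] = is_coneD(2-8)[OF c] a
  show ?thesis
    by (rule cone_extend[OF c, of "\<iota> Y" "I Y" a]) (simp_all add: ai, rule that)
qed

text \<open>
  If n g = k \<iota> with \<iota> : Y --> I Y, extend \<iota> to a map m on the cone. Then n - k m vanishes on g and is
  therefore a multiple of h, while k m is stably zero.
\<close>

lemma cone_weak_cokernel:
  assumes c: "is_cone X Y f P e g h" and W: "W \<in> Obj C" and n: "n \<in> mor C P W"
    and ng: "Comp C Y P W n g \<in> J Y W"
  obtains z where "z \<in> mor C (FObj T X) W" "cls P W n = cls P W (Comp C P (FObj T X) W z h)"
proof -
  note d = is_coneD[OF c]
  note [simp] = d(2-8) W n
  obtain k where k [simp]: "k \<in> mor C (I Y) W" and nk: "Comp C Y P W n g = Comp C Y (I Y) W k (\<iota> Y)"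
    using ng J_iff[OF d(3) W] by blast
  obtain a where a: "a \<in> mor C (I X) (I Y)" "Comp C X (I X) (I Y) a (\<iota> X) = Comp C X Y (I Y) (\<iota> Y) f"
    by (rule T_clsE[OF d(2,3,5)])
  obtain m where m [simp]: "m \<in> mor C P (I Y)" and mg: "Comp C Y P (I Y) m g = \<iota> Y"
    by (rule cone_to_injective[OF c a])
  let ?r = "diff P W n (Comp C P (I Y) W k m)"
  have r: "?r \<in> mor C P W" "Comp C Y P W ?r g = zero_mor C Y W"
    by (simp_all add: nk mg)
  obtain z where z: "z \<in> mor C (FObj T X) W" "?r = Comp C P (FObj T X) W z h"
    by (rule pushout_cokernel[OF shift_conflation[OF d(2)] d(1,8,10,11) W r])
  note [simp] = z(1)
  have "diff P W n (Comp C P (FObj T X) W z h) = Comp C P (I Y) W k m"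
    unfolding z(2)[symmetric] by simp
  then have "diff P W n (Comp C P (FObj T X) W z h) \<in> J P W"
    by (intro JI[OF d(4) W injective_I[OF d(3)] m k])
  then show ?thesis
    by (intro that[OF z(1)]) (simp add: cls_eq_iff)
qed

text \<open>
  If b f - f' a = r \<iota> with \<iota> : X --> I X, the map of cones is g' b on Y, and on I X it is the sum of e'
  after a lift of a and of the correction g' r.
\<close>

lemma cone_morphism:
  assumes c: "is_cone X Y f P e g h" and c': "is_cone X' Y' f' P' e' g' h'"
    and a: "a \<in> mor C X X'" and b: "b \<in> mor C Y Y'"
    and sq: "diff X Y' (Comp C X Y Y' b f) (Comp C X X' Y' f' a) \<in> J X Y'"
  obtains k where "triangle_morphism Q T (triangle_of X Y f P g h)
    (X', Y', P', cls X' Y' f', cls Y' P' g', cls P' (FObj T X') h') (cls X X' a) (cls Y Y' b) (cls P P' k)"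
proof -
  note d = is_coneD[OF c] and d' = is_coneD[OF c']
  note [simp] = d(2-8,11) d'(2-8,11) a b
  note [simp] = is_cone_reassoc[OF c] is_cone_reassoc[OF c']
  obtain r where r [simp]: "r \<in> mor C (I X) Y'"
    and rf: "diff X Y' (Comp C X Y Y' b f) (Comp C X X' Y' f' a) = Comp C X (I X) Y' r (\<iota> X)"
    using sq J_iff[OF d(2) d'(3)] by blast
  have bf: "Comp C X Y Y' b f = Comp C X X' Y' f' a \<otimes>\<^bsub>Hom C X Y'\<^esub> Comp C X (I X) Y' r (\<iota> X)"
    unfolding rf[symmetric] by simp
  obtain \<alpha> t where al: "\<alpha> \<in> mor C (I X) (I X')" "t \<in> mor C (FObj T X) (FObj T X')"
    "Comp C X (I X) (I X') \<alpha> (\<iota> X) = Comp C X X' (I X') (\<iota> X') a"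
    "Comp C (I X) (FObj T X) (FObj T X') t (\<pi> X) = Comp C (I X) (I X') (FObj T X') (\<pi> X') \<alpha>"
    "FMor T X X' (cls X X' a) = cls (FObj T X) (FObj T X') t"
    by (rule T_clsE[OF d(2) d'(2) a])
  note [simp] = al(1,2)
  let ?l = "Comp C (I X) (I X') P' e' \<alpha> \<otimes>\<^bsub>Hom C (I X) P'\<^esub> Comp C (I X) Y' P' g' r"
  obtain k where k: "k \<in> mor C P P'" "Comp C (I X) P P' k e = ?l" "Comp C Y P P' k g = Comp C Y Y' P' g' b"
  proof (rule cone_extend[OF c, of "Comp C Y Y' P' g' b" P' ?l])
    show "Comp C X (I X) P' ?l (\<iota> X) = Comp C X Y P' (Comp C Y Y' P' g' b) f"
      by (simp add: al(3) bf)
  qed simp_all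
  note [simp] = k(1)
  have "Comp C P P' (FObj T X') h' k = Comp C P (FObj T X) (FObj T X') t h"
    by (rule pushout_eqI[OF d(1), of "FObj T X'"])
      (simp_all add: k(2,3) d(10) al(4))
  then have "triangle_morphism Q T (triangle_of X Y f P g h)
    (X', Y', P', cls X' Y' f', cls Y' P' g', cls P' (FObj T X') h') (cls X X' a) (cls Y Y' b) (cls P P' k)"
    unfolding triangle_morphism_def by (simp add: al(5) k(3) cls_eq_iff sq)
  then show ?thesis by (rule that)
qed

text \<open>
  The cone of f may be computed with any conflation X --> A --> M with A injective. The maps b : A --> I X
  and b' : I X --> A over X induce maps s and s' between the two pushouts. Since b' b - 1 vanishes on X,
  it factors through q, and so s' s - 1 factors through A; symmetrically for s s' - 1.
\<close>

lemma cone_of_conflation_in_\<Delta>: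
  assumes k: "(X, j, A, q, M) \<in> S" and A: "injective C S A"
    and p: "is_pushout C X A Y P j f e g"
    and t: "t \<in> mor C P M" "Comp C A P M t e = q" "Comp C Y P M t g = zero_mor C Y M"
    and b: "b \<in> mor C A (I X)" "Comp C X A (I X) b j = \<iota> X"
    and m: "m \<in> mor C M (FObj T X)" "Comp C A M (FObj T X) m q = Comp C A (I X) (FObj T X) (\<pi> X) b"
  shows "(triangle_of X Y f P g (Comp C P M (FObj T X) m t)) \<in> \<Delta>"
proof -
  note kd = conflationD[OF k] and pd = pushoutD[OF p]
  note [simp] = kd(1-6) pd(1-8) t b(1) m(1)
  obtain P0 e0 g0 h0 where c: "is_cone X Y f P0 e0 g0 h0"
    by (rule cone_exists[OF kd(1) pd(3,6)])
  note d = is_coneD[OF c]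
  note [simp] = d(2-8,11) is_cone_reassoc[OF c]
  obtain b' where b' [simp]: "b' \<in> mor C (I X) A" and b'\<iota>: "Comp C X (I X) A b' (\<iota> X) = j"
    by (rule injective_extend[OF A \<iota>_mono[OF kd(1)] kd(4)])
  obtain s where s: "s \<in> mor C P P0" "Comp C A P P0 s e = Comp C A (I X) P0 e0 b" "Comp C Y P P0 s g = g0"
    by (rule pushout_ex[OF p, of P0 "Comp C A (I X) P0 e0 b" g0]) (simp_all add: b(2) d(9))
  obtain s' where s': "s' \<in> mor C P0 P" "Comp C (I X) P0 P s' e0 = Comp C (I X) A P e b'" "Comp C Y P0 P s' g0 = g"
    by (rule cone_extend[OF c, of g P "Comp C (I X) A P e b'"]) (simp_all add: b'\<iota> pd(9))
  note [simp] = s(1) s'(1)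
  have hs: "Comp C P P0 (FObj T X) h0 s = Comp C P M (FObj T X) m t"
    by (rule pushout_eqI[OF p, of "FObj T X"]) (simp_all add: s(2,3) m(2))
  have "Comp C X A A (diff A A (Comp C A (I X) A b' b) (Ident C A)) j = zero_mor C X A"
    by (simp add: b(2) b'\<iota>)
  then obtain r where r [simp]: "r \<in> mor C M A" and rq: "Comp C A M A r q = diff A A (Comp C A (I X) A b' b) (Ident C A)"
    by (rule conflation_extend[OF k, of A, rotated 2]) simp_all
  have 1: "diff P P (Comp C P P0 P s' s) (Ident C P) = Comp C P A P e (Comp C P M A r t)"
    by (rule pushout_eqI[OF p, of P])
      (simp_all add: s(2,3) s'(3) rq Comp_eq_Comp[OF s'(2)])
  have "Comp C X (I X) (I X) (diff (I X) (I X) (Comp C (I X) A (I X) b b') (Ident C (I X))) (\<iota> X) = zero_mor C X (I X)"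
    by (simp add: b(2) b'\<iota>)
  then obtain r' where r' [simp]: "r' \<in> mor C (FObj T X) (I X)"
    and r'\<pi>: "Comp C (I X) (FObj T X) (I X) r' (\<pi> X) = diff (I X) (I X) (Comp C (I X) A (I X) b b') (Ident C (I X))"
    by (rule conflation_extend[OF shift_conflation[OF kd(1)], of "I X", rotated 2]) simp_all
  have 2: "diff P0 P0 (Comp C P0 P P0 s s') (Ident C P0) = Comp C P0 (I X) P0 e0 (Comp C P0 (FObj T X) (I X) r' h0)"
    by (rule pushout_eqI[OF d(1), of P0])
      (simp_all add: s'(2,3) s(3) d(10) r'\<pi> Comp_eq_Comp[OF s(2)])
  have "is_iso Q P P0 (cls P P0 s)"
    by (rule is_iso_clsI[where g = s'])
      (simp_all add: 1 2 JI[OF _ _ A _ _ refl] JI[OF _ _ injective_I[OF kd(1)] _ _ refl])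
  moreover have t: "is_triangle Q T (triangle_of X Y f P g (Comp C P M (FObj T X) m t))"
    by (simp add: is_triangle_def)
  moreover have "triangle_morphism Q T (triangle_of X Y f P g (Comp C P M (FObj T X) m t))
      (triangle_of X Y f P0 g0 h0) (Ident Q X) (Ident Q Y) (cls P P0 s)"
    unfolding triangle_morphism_def using T_Ident[of X] by (simp add: s(3) hs)
  ultimately have "triangle_iso Q T (triangle_of X Y f P g (Comp C P M (FObj T X) m t))
      (triangle_of X Y f P0 g0 h0)"
    using is_iso_cls_Ident[OF kd(1)] is_iso_cls_Ident[OF pd(3)] unfolding Ident_quotient
    by (intro triangle_isoI)
  from \<Delta>_iso[OF cone_in_\<Delta>[OF c] t triangle_iso_sym[OF this t cone_triangle[OF c]]] show ?thesis .
qed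

text \<open>
  Let P' be the cone of g : Y --> P. The extension m' of m : P --> I Y splits the inclusion e' of I Y into
  P', and the cokernel of e' is p : P' --> T X, extending h. Hence P' is I Y + T X, and p is a stable
  isomorphism. The sign in the rotation comes from h' + (T f) p = \<pi> m', a map through I Y.
\<close>

lemma cone_rotate:
  assumes c: "is_cone X Y f P e g h"
  shows "(Y, P, FObj T X, cls Y P g, cls P (FObj T X) h,
    inv\<^bsub>Hom Q (FObj T X) (FObj T Y)\<^esub> (FMor T X Y (cls X Y f))) \<in> \<Delta>"
proof -
  note d = is_coneD[OF c]
  note [simp] = d(2-8,11) is_cone_reassoc[OF c]
  obtain P' e' g' h' where c': "is_cone Y P g P' e' g' h'"
    by (rule cone_exists[OF d(3,4,7)])
  note d' = is_coneD[OF c']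
  note [simp] = d'(2-8,11) is_cone_reassoc[OF c']
  obtain p where p: "p \<in> mor C P' (FObj T X)"
    "Comp C (I Y) P' (FObj T X) p e' = zero_mor C (I Y) (FObj T X)" "Comp C P P' (FObj T X) p g' = h"
    by (rule cone_extend[OF c', of h "FObj T X" "zero_mor C (I Y) (FObj T X)"]) simp_all
  obtain a t where a: "a \<in> mor C (I X) (I Y)" "t \<in> mor C (FObj T X) (FObj T Y)"
    "Comp C X (I X) (I Y) a (\<iota> X) = Comp C X Y (I Y) (\<iota> Y) f"
    "Comp C (I X) (FObj T X) (FObj T Y) t (\<pi> X) = Comp C (I X) (I Y) (FObj T Y) (\<pi> Y) a"
    "FMor T X Y (cls X Y f) = cls (FObj T X) (FObj T Y) t"
    by (rule T_clsE[OF d(2,3,5)])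
  obtain m where m: "m \<in> mor C P (I Y)" "Comp C (I X) P (I Y) m e = a" "Comp C Y P (I Y) m g = \<iota> Y"
    by (rule cone_to_injective[OF c a(1,3)])
  obtain m' where m': "m' \<in> mor C P' (I Y)" "Comp C (I Y) P' (I Y) m' e' = Ident C (I Y)"
    "Comp C P P' (I Y) m' g' = m"
    by (rule cone_extend[OF c', of m "I Y" "Ident C (I Y)"]) (simp_all add: m)
  note [simp] = p(1) a(1,2) m(1) m'(1) Comp_eq_Comp[OF m'(2)] Comp_eq_Comp[OF p(2)]
  \<comment> \<open>The idempotent complementary to the splitting of e' by m'; it factors through p.\<close>
  let ?r = "diff P' P' (Ident C P') (Comp C P' (I Y) P' e' m')"
  have re: "Comp C (I Y) P' P' ?r e' = zero_mor C (I Y) P'"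
    by (simp add: m'(2))
  have "Comp C Y P P' (Comp C P P' P' ?r g') g = Comp C Y (I Y) P' (Comp C (I Y) P' P' ?r e') (\<iota> Y)"
    using d'(9) by (simp del: re)
  then have rg: "Comp C Y P P' (Comp C P P' P' ?r g') g = zero_mor C Y P'"
    unfolding re by simp
  obtain \<sigma> where s: "\<sigma> \<in> mor C (FObj T X) P'" "Comp C P P' P' ?r g' = Comp C P (FObj T X) P' \<sigma> h"
    by (rule pushout_cokernel[OF shift_conflation[OF d(2)] d(1,8,10,11) d'(4) _ rg]) (simp, rule that)
  note [simp] = s(1)
  have sp: "Comp C P' (FObj T X) P' \<sigma> p = ?r"
    by (rule pushout_eqI[OF d'(1), of P']) (use re s(2) in \<open>simp_all add: p(2,3)\<close>)
  have "Comp C P' P' (FObj T X) p ?r = p"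
    by (simp add: p(2))
  then have "Comp C P' (FObj T X) (FObj T X) (Comp C (FObj T X) P' (FObj T X) p \<sigma>) p = p"
    by (simp add: sp)
  from arg_cong[OF this, of "\<lambda>r. Comp C P P' (FObj T X) r g'"]
  have psh: "Comp C P (FObj T X) (FObj T X) (Comp C (FObj T X) P' (FObj T X) p \<sigma>) h = h"
    by (simp add: p(3))
  from arg_cong[OF this, of "\<lambda>r. Comp C (I X) P (FObj T X) r e"]
  have "Comp C (I X) (FObj T X) (FObj T X) (Comp C (FObj T X) P' (FObj T X) p \<sigma>) (\<pi> X)
      = Comp C (I X) (FObj T X) (FObj T X) (Ident C (FObj T X)) (\<pi> X)"
    by (simp add: d(10))
  from conflation_epi[OF shift_conflation[OF d(2)] _ _ _ this]
  have ps: "Comp C (FObj T X) P' (FObj T X) p \<sigma> = Ident C (FObj T X)"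
    by simp
  have "diff P' P' (Comp C P' (FObj T X) P' \<sigma> p) (Ident C P')
      = Comp C P' (I Y) P' e' (inv\<^bsub>Hom C P' (I Y)\<^esub> m')"
    unfolding sp by (simp add: diff_def add_ac)
  then have "diff P' P' (Comp C P' (FObj T X) P' \<sigma> p) (Ident C P') \<in> J P' P'"
    by (intro JI[OF _ _ injective_I[OF d(3)], of P' P' "inv\<^bsub>Hom C P' (I Y)\<^esub> m'" e']) simp_all
  then have iso: "is_iso Q P' (FObj T X) (cls P' (FObj T X) p)"
    by (intro is_iso_clsI[where g = \<sigma>]) (simp_all add: ps ideal_zero)
  have "h' \<otimes>\<^bsub>Hom C P' (FObj T Y)\<^esub> Comp C P' (FObj T X) (FObj T Y) t p = Comp C P' (I Y) (FObj T Y) (\<pi> Y) m'"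
  proof (rule pushout_eqI[OF d'(1), of "FObj T Y"])
    show "Comp C (I Y) P' (FObj T Y) (h' \<otimes>\<^bsub>Hom C P' (FObj T Y)\<^esub> Comp C P' (FObj T X) (FObj T Y) t p) e'
      = Comp C (I Y) P' (FObj T Y) (Comp C P' (I Y) (FObj T Y) (\<pi> Y) m') e'"
      by (simp add: d'(10) p(2) m'(2))
    have "Comp C P (FObj T X) (FObj T Y) t h = Comp C P (I Y) (FObj T Y) (\<pi> Y) m"
      by (rule pushout_eqI[OF d(1), of "FObj T Y"]) (simp_all add: d(10) m(2,3) a(4))
    then show "Comp C P P' (FObj T Y) (h' \<otimes>\<^bsub>Hom C P' (FObj T Y)\<^esub> Comp C P' (FObj T X) (FObj T Y) t p) g'
      = Comp C P P' (FObj T Y) (Comp C P' (I Y) (FObj T Y) (\<pi> Y) m') g'"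
      by (simp add: p(3) m'(3))
  qed simp_all
  then have "diff P' (FObj T Y) h' (inv\<^bsub>Hom C P' (FObj T Y)\<^esub> Comp C P' (FObj T X) (FObj T Y) t p)
      = Comp C P' (I Y) (FObj T Y) (\<pi> Y) m'"
    by (simp add: diff_def)
  then have w: "diff P' (FObj T Y) h' (inv\<^bsub>Hom C P' (FObj T Y)\<^esub> Comp C P' (FObj T X) (FObj T Y) t p) \<in> J P' (FObj T Y)"
    by (intro JI[OF _ _ injective_I[OF d(3)], of P' "FObj T Y" m' "\<pi> Y"]) simp_all
  let ?t = "(Y, P, FObj T X, cls Y P g, cls P (FObj T X) h,
    inv\<^bsub>Hom Q (FObj T X) (FObj T Y)\<^esub> (FMor T X Y (cls X Y f)))"
  have "triangle_morphism Q T (Y, P, P', cls Y P g, cls P P' g', cls P' (FObj T Y) h') ?t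
      (Ident Q Y) (Ident Q P) (cls P' (FObj T X) p)"
    unfolding triangle_morphism_def using T_Ident[of Y] by (simp add: p(3) a(5) cls_eq_iff w)
  then have i: "triangle_iso Q T (Y, P, P', cls Y P g, cls P P' g', cls P' (FObj T Y) h') ?t"
    using iso is_iso_cls_Ident[OF d(3)] is_iso_cls_Ident[OF d(4)] unfolding Ident_quotient
    by (intro triangle_isoI)
  have "is_triangle Q T ?t"
    unfolding is_triangle_def by (simp add: a(5))
  then show ?thesis
    by (rule \<Delta>I[OF c' _ i])
qed

lemma \<Delta>_rotate:
  assumes t: "(X, Y, Z, u, v, w) \<in> \<Delta>"
  shows "(Y, Z, FObj T X, v, w, inv\<^bsub>Hom Q (FObj T X) (FObj T Y)\<^esub> (FMor T X Y u)) \<in> \<Delta>"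
proof -
  obtain X0 Y0 f P e g h where c: "is_cone X0 Y0 f P e g h"
    and i: "triangle_iso Q T (triangle_of X0 Y0 f P g h) (X, Y, Z, u, v, w)"
    and tt: "is_triangle Q T (X, Y, Z, u, v, w)"
    by (rule \<Delta>E[OF t])
  note [simp] = is_triangleD[OF tt]
  show ?thesis
    by (rule \<Delta>_iso[OF cone_rotate[OF c] _ rotate_iso[OF i cone_triangle[OF c] tt]])
      (use is_triangleD[OF tt] in \<open>simp add: is_triangle_def\<close>)
qed

lemma \<Delta>_weak_cokernel:
  assumes t: "(X, Y, Z, u, v, w) \<in> \<Delta>" and W: "W \<in> Obj Q" and n: "n \<in> mor Q Z W"
    and nv: "Comp Q Y Z W n v = zero_mor Q Y W"
  shows "\<exists>m\<in>mor Q (FObj T X) W. n = Comp Q Z (FObj T X) W m w"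
proof -
  obtain X0 Y0 f P e g h where c: "is_cone X0 Y0 f P e g h"
    and i: "triangle_iso Q T (triangle_of X0 Y0 f P g h) (X, Y, Z, u, v, w)"
    and tt: "is_triangle Q T (X, Y, Z, u, v, w)"
    by (rule \<Delta>E[OF t])
  note ct = cone_triangle[OF c]
  obtain \<alpha> \<beta> \<gamma> \<alpha>' \<beta>' \<gamma>' where
    m: "triangle_morphism Q T (triangle_of X0 Y0 f P g h) (X, Y, Z, u, v, w) \<alpha> \<beta> \<gamma>"
    and m': "triangle_morphism Q T (X, Y, Z, u, v, w) (triangle_of X0 Y0 f P g h) \<alpha>' \<beta>' \<gamma>'"
    and gg: "Comp Q Z P Z \<gamma> \<gamma>' = Ident Q Z"
    by (rule triangle_isoE[OF i ct tt])
  note md = triangle_morphismD[OF m] and md' = triangle_morphismD[OF m']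
  note ob = is_triangleD[OF tt] is_triangleD[OF ct]
  have W' [simp]: "W \<in> Obj C" using W by simp
  note d = is_coneD[OF c]
  note [simp] = d(2-8)
  have nga: "Comp Q P Z W n \<gamma> \<in> mor Q P W"
    by (rule Q.Comp_in[OF ob(9,3) W md(3) n])
  obtain n0 where n0: "n0 \<in> mor C P W" and n0_eq: "Comp Q P Z W n \<gamma> = cls P W n0"
    by (rule mor_quotientE[OF nga])
  have "cls Y0 W (Comp C Y0 P W n0 g) = Comp Q Y0 P W (Comp Q P Z W n \<gamma>) (cls Y0 P g)"
    using n0 by (simp add: n0_eq)
  also have "\<dots> = Comp Q Y0 Z W n (Comp Q Y0 Y Z v \<beta>)"
    unfolding md(5)[symmetric] by (rule Q.Comp_assoc[OF ob(8,9,3) W ob(11) md(3) n])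
  also have "\<dots> = Comp Q Y0 Y W (Comp Q Y Z W n v) \<beta>"
    by (rule Q.Comp_assoc[OF ob(8,2,3) W md(2) ob(5) n, symmetric])
  also have "\<dots> = zero_mor Q Y0 W"
    unfolding nv by (rule Q.Comp_zero_left[OF ob(8,2) W md(2)])
  finally have "Comp C Y0 P W n0 g \<in> J Y0 W"
    using n0 by (simp add: cls_eq_iff)
  then obtain z where z: "z \<in> mor C (FObj T X0) W" "cls P W n0 = cls P W (Comp C P (FObj T X0) W z h)"
    by (rule cone_weak_cokernel[OF c W' n0])
  have z': "cls (FObj T X0) W z \<in> mor Q (FObj T X0) W" using z(1) by simp
  have Ta: "FMor T X X0 \<alpha>' \<in> mor Q (FObj T X) (FObj T X0)"
    using md'(1) ob by (intro T_in)
  note TX = T_obj[OF ob(1)] and TX0 = T_obj[OF ob(7)]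
  have "n = Comp Q Z Z W n (Comp Q Z P Z \<gamma> \<gamma>')"
    unfolding gg by (rule Q.Ident_right[OF ob(3) W n, symmetric])
  also have "\<dots> = Comp Q Z P W (Comp Q P Z W n \<gamma>) \<gamma>'"
    by (rule Q.Comp_assoc[OF ob(3,9,3) W md'(3) md(3) n, symmetric])
  also have "Comp Q P Z W n \<gamma> = Comp Q P (FObj T X0) W (cls (FObj T X0) W z) (cls P (FObj T X0) h)"
    unfolding n0_eq z(2) using z(1) by simp
  also have "Comp Q Z P W \<dots> \<gamma>' = Comp Q Z (FObj T X0) W (cls (FObj T X0) W z)
      (Comp Q Z P (FObj T X0) (cls P (FObj T X0) h) \<gamma>')"
    by (rule Q.Comp_assoc[OF ob(3,9) TX0 W md'(3) ob(12) z'])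
  also have "\<dots> = Comp Q Z (FObj T X0) W (cls (FObj T X0) W z)
      (Comp Q Z (FObj T X) (FObj T X0) (FMor T X X0 \<alpha>') w)"
    unfolding md'(6) ..
  also have "\<dots> = Comp Q Z (FObj T X) W (Comp Q (FObj T X) (FObj T X0) W (cls (FObj T X0) W z) (FMor T X X0 \<alpha>')) w"
    by (rule Q.Comp_assoc[OF ob(3) TX TX0 W ob(6) Ta z', symmetric])
  finally show ?thesis
    using Q.Comp_in[OF TX TX0 W Ta z'] by blast
qed

lemma \<Delta>_morphism:
  assumes t: "(X, Y, Z, u, v, w) \<in> \<Delta>" and t': "(X', Y', Z', u', v', w') \<in> \<Delta>"
    and a: "a \<in> mor Q X X'" and b: "b \<in> mor Q Y Y'" and sq: "Comp Q X Y Y' b u = Comp Q X X' Y' u' a"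
  shows "\<exists>c. triangle_morphism Q T (X, Y, Z, u, v, w) (X', Y', Z', u', v', w') a b c"
proof -
  obtain X0 Y0 f P e g h where c: "is_cone X0 Y0 f P e g h"
    and i: "triangle_iso Q T (triangle_of X0 Y0 f P g h) (X, Y, Z, u, v, w)"
    and tt: "is_triangle Q T (X, Y, Z, u, v, w)"
    by (rule \<Delta>E[OF t])
  note ct = cone_triangle[OF c]
  obtain \<alpha> \<beta> \<gamma> \<alpha>' \<beta>' \<gamma>' where
    m: "triangle_morphism Q T (triangle_of X0 Y0 f P g h) (X, Y, Z, u, v, w) \<alpha> \<beta> \<gamma>"
    and m': "triangle_morphism Q T (X, Y, Z, u, v, w) (triangle_of X0 Y0 f P g h) \<alpha>' \<beta>' \<gamma>'"
    and aa: "Comp Q X X0 X \<alpha> \<alpha>' = Ident Q X" and bb: "Comp Q Y Y0 Y \<beta> \<beta>' = Ident Q Y"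
    by (rule triangle_isoE[OF i ct tt])
  obtain X1 Y1 f1 P1 e1 g1 h1 where c1: "is_cone X1 Y1 f1 P1 e1 g1 h1"
    and i1: "triangle_iso Q T (triangle_of X1 Y1 f1 P1 g1 h1) (X', Y', Z', u', v', w')"
    and tt1: "is_triangle Q T (X', Y', Z', u', v', w')"
    by (rule \<Delta>E[OF t'])
  note ct1 = cone_triangle[OF c1]
  obtain \<xi> \<eta> \<zeta> \<xi>' \<eta>' \<zeta>' where
    n: "triangle_morphism Q T (triangle_of X1 Y1 f1 P1 g1 h1) (X', Y', Z', u', v', w') \<xi> \<eta> \<zeta>"
    and n': "triangle_morphism Q T (X', Y', Z', u', v', w') (triangle_of X1 Y1 f1 P1 g1 h1) \<xi>' \<eta>' \<zeta>'"
    and xx: "Comp Q X' X1 X' \<xi> \<xi>' = Ident Q X'" and ee: "Comp Q Y' Y1 Y' \<eta> \<eta>' = Ident Q Y'"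
    by (rule triangle_isoE[OF i1 ct1 tt1])
  note md = triangle_morphismD[OF m] and md' = triangle_morphismD[OF m']
  note nd = triangle_morphismD[OF n] and nd' = triangle_morphismD[OF n']
  have ob: "X \<in> Obj C" "Y \<in> Obj C" "Z \<in> Obj C" "X' \<in> Obj C" "Y' \<in> Obj C" "Z' \<in> Obj C"
    using is_triangleD(1-3)[OF tt] is_triangleD(1-3)[OF tt1] by simp_all
  note [simp] = ob is_coneD(2-8)[OF c] is_coneD(2-8)[OF c1] is_triangleD(4-6)[OF tt] is_triangleD(4-6)[OF tt1]
    md(1-3) md'(1-3) nd(1-3) nd'(1-3) a b
  let ?a = "Comp Q X0 X' X1 \<xi>' (Comp Q X0 X X' a \<alpha>)"
  let ?b = "Comp Q Y0 Y' Y1 \<eta>' (Comp Q Y0 Y Y' b \<beta>)"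
  have ab: "?a \<in> mor Q X0 X1" "?b \<in> mor Q Y0 Y1" by simp_all
  obtain a0 where a0 [simp]: "a0 \<in> mor C X0 X1" and a0_eq: "?a = cls X0 X1 a0" by (rule mor_quotientE[OF ab(1)])
  obtain b0 where b0 [simp]: "b0 \<in> mor C Y0 Y1" and b0_eq: "?b = cls Y0 Y1 b0" by (rule mor_quotientE[OF ab(2)])
  have "Comp Q X0 Y0 Y1 ?b (cls X0 Y0 f) = Comp Q X0 X1 Y1 (cls X1 Y1 f1) ?a"
  proof -
    have "Comp Q X0 Y0 Y1 ?b (cls X0 Y0 f) = Comp Q X0 Y' Y1 \<eta>' (Comp Q X0 Y Y' b (Comp Q X0 Y0 Y \<beta> (cls X0 Y0 f)))"
      by simp
    also have "\<dots> = Comp Q X0 Y' Y1 \<eta>' (Comp Q X0 X Y' (Comp Q X Y Y' b u) \<alpha>)"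
      unfolding md(4) by simp
    also have "\<dots> = Comp Q X0 X' Y1 (Comp Q X' Y' Y1 \<eta>' u') (Comp Q X0 X X' a \<alpha>)"
      unfolding sq by simp
    also have "\<dots> = Comp Q X0 X1 Y1 (cls X1 Y1 f1) ?a"
      unfolding nd'(4) by simp
    finally show ?thesis .
  qed
  then have "diff X0 Y1 (Comp C X0 Y0 Y1 b0 f) (Comp C X0 X1 Y1 f1 a0) \<in> J X0 Y1"
    unfolding a0_eq b0_eq by (simp add: cls_eq_iff)
  then obtain k where k: "triangle_morphism Q T (triangle_of X0 Y0 f P g h)
    (triangle_of X1 Y1 f1 P1 g1 h1) ?a ?b (cls P P1 k)"
    unfolding a0_eq b0_eq by (rule cone_morphism[OF c c1 a0 b0])
  have "Comp Q X X1 X' \<xi> (Comp Q X X0 X1 ?a \<alpha>') = a"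
    by (simp add: aa Q.Comp_eq_Comp[OF xx] del: Ident_quotient)
  moreover have "Comp Q Y Y1 Y' \<eta> (Comp Q Y Y0 Y1 ?b \<beta>') = b"
    by (simp add: bb Q.Comp_eq_Comp[OF ee] del: Ident_quotient)
  ultimately show ?thesis
    using triangle_morphism_Comp[OF tt ct1 tt1 triangle_morphism_Comp[OF tt ct ct1 m' k] n] by auto
qed

lemma \<Delta>_Ident:
  assumes X: "X \<in> Obj Q" and Z: "is_zero_object Q Z"
  shows "(X, X, Z, Ident Q X, zero_mor Q X Z, zero_mor Q Z (FObj T X)) \<in> \<Delta>"
proof -
  have X' [simp]: "X \<in> Obj C" and Z' [simp]: "Z \<in> Obj C"
    using X Z by (simp_all add: is_zero_object_def)
  have "is_pushout C X (I X) X (I X) (\<iota> X) (Ident C X) (Ident C (I X)) (\<iota> X)"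
    unfolding is_pushout_def
  proof (intro conjI ballI impI)
    fix W s t assume [simp]: "W \<in> Obj C" "s \<in> mor C (I X) W" "t \<in> mor C X W"
      and e: "Comp C X (I X) W s (\<iota> X) = Comp C X X W t (Ident C X)"
    show "\<exists>!k. k \<in> mor C (I X) W \<and> Comp C (I X) (I X) W k (Ident C (I X)) = s \<and> Comp C X (I X) W k (\<iota> X) = t"
    proof (rule ex1I[of _ s])
      show "s \<in> mor C (I X) W \<and> Comp C (I X) (I X) W s (Ident C (I X)) = s \<and> Comp C X (I X) W s (\<iota> X) = t"
        using e by simp
      fix k assume k: "k \<in> mor C (I X) W \<and> Comp C (I X) (I X) W k (Ident C (I X)) = s \<and> Comp C X (I X) W k (\<iota> X) = t"
      then have "Comp C (I X) (I X) W k (Ident C (I X)) = k"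
        by (intro Ident_right) simp_all
      then show "k = s" using k by metis
    qed
  qed simp_all
  then have c: "is_cone X X (Ident C X) (I X) (Ident C (I X)) (\<iota> X) (\<pi> X)"
    unfolding is_cone_def by simp
  have "Ident C (I X) \<in> J (I X) (I X)"
    by (rule JI[OF _ _ injective_I[OF X'], of _ _ "Ident C (I X)" "Ident C (I X)"]) simp_all
  then have "is_zero_object Q (I X)"
    by (intro Q.zero_objectI) (simp_all add: cls_eq_iff)
  note IX0 = Q.zero_object_Ident[OF this]
  note Z0 = Q.zero_object_Ident[OF Z]
  have "\<pi> X \<in> J (I X) (FObj T X)"
    by (rule JI[OF _ _ injective_I[OF X'], of _ _ "Ident C (I X)" "\<pi> X"]) simp_all
  then have \<pi>0: "cls (I X) (FObj T X) (\<pi> X) = cls (I X) (FObj T X) (zero_mor C (I X) (FObj T X))"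
    by (simp add: cls_eq_iff)
  have iso: "is_iso Q (I X) Z (zero_mor Q (I X) Z)"
    by (rule Q.is_isoI[where g = "zero_mor Q Z (I X)"]) (use IX0 Z0 in simp_all)
  have "triangle_morphism Q T (X, X, I X, cls X X (Ident C X), cls X (I X) (\<iota> X), cls (I X) (FObj T X) (\<pi> X))
      (X, X, Z, Ident Q X, zero_mor Q X Z, zero_mor Q Z (FObj T X)) (Ident Q X) (Ident Q X) (zero_mor Q (I X) Z)"
    unfolding triangle_morphism_def using T_Ident[OF X] by (simp add: \<pi>0)
  then have i: "triangle_iso Q T (X, X, I X, cls X X (Ident C X), cls X (I X) (\<iota> X), cls (I X) (FObj T X) (\<pi> X))
      (X, X, Z, Ident Q X, zero_mor Q X Z, zero_mor Q Z (FObj T X))"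
    using iso Q.is_iso_Ident[OF X] by (intro triangle_isoI)
  have "is_triangle Q T (X, X, Z, Ident Q X, zero_mor Q X Z, zero_mor Q Z (FObj T X))"
    by (simp add: is_triangle_def)
  then show ?thesis by (rule \<Delta>I[OF c _ i])
qed

text \<open>
  Represent the morphisms by u and v and use the composite v u itself. Let A and D be the cones of u and
  v u, and let E be the cone of the induced map f : A --> D. Since A is a pushout, E is also the pushout
  along v of the composite Y --> A --> I A. This composite is an admissible monomorphism into an
  injective, so by cone_of_conflation_in_\<Delta> the object E is a cone of v as well, and the octahedron
  consists of the maps A --> D --> E.
\<close>

lemma \<Delta>_octahedron:
  assumes XYZ: "X \<in> Obj Q" "Y \<in> Obj Q" "Z \<in> Obj Q" and U: "U \<in> mor Q X Y" and V: "V \<in> mor Q Y Z"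
  shows "\<exists>Z' i i' X' j j' Y' k k' f g.
        (X, Y, Z', U, i, i') \<in> \<Delta> \<and> (Y, Z, X', V, j, j') \<in> \<Delta> \<and>
        (X, Z, Y', Comp Q X Y Z V U, k, k') \<in> \<Delta> \<and>
        triangle_morphism Q T (X, Y, Z', U, i, i') (X, Z, Y', Comp Q X Y Z V U, k, k')
          (Ident Q X) V f \<and>
        triangle_morphism Q T (X, Z, Y', Comp Q X Y Z V U, k, k') (Y, Z, X', V, j, j')
          U (Ident Q Z) g \<and>
        (Z', Y', X', f, g, Comp Q X' (FObj T Y) (FObj T Z') (FMor T Y Z' i) j') \<in> \<Delta>"
proof -
  have X [simp]: "X \<in> Obj C" and Y [simp]: "Y \<in> Obj C" and Z [simp]: "Z \<in> Obj C" using XYZ by simp_all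
  obtain u where u [simp]: "u \<in> mor C X Y" and U: "U = cls X Y u" using U by (rule mor_quotientE)
  obtain v where v [simp]: "v \<in> mor C Y Z" and V: "V = cls Y Z v" using V by (rule mor_quotientE)
  obtain A eu i hu where cu: "is_cone X Y u A eu i hu" and i_mono: "admissible_mono S Y A i"
    by (rule cone_exists[OF X Y u])
  note du = is_coneD[OF cu]
  note [simp] = du(4,6-8,11) is_cone_reassoc[OF cu]
  obtain D ed k hd where cd: "is_cone X Z (Comp C X Y Z v u) D ed k hd"
    by (rule cone_exists[OF X Z, of "Comp C X Y Z v u"]) simp_all
  note dd = is_coneD[OF cd]
  note [simp] = dd(4,6-8,11) is_cone_reassoc[OF cd]
  obtain f where f: "f \<in> mor C A D" "Comp C (I X) A D f eu = ed" "Comp C Y A D f i = Comp C Y Z D k v"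
    by (rule cone_extend[OF cu, of "Comp C Y Z D k v" D ed]) (simp_all add: dd(9))
  note [simp] = f(1)
  obtain E ee gE hE where cE: "is_cone A D f E ee gE hE"
    by (rule cone_exists[OF du(4) dd(4) f(1)])
  note dE = is_coneD[OF cE]
  note [simp] = dE(4,6-8,11) is_cone_reassoc[OF cE]
  let ?j = "Comp C Y A (I A) (\<iota> A) i"
  have "admissible_mono S Y (I A) ?j"
    by (rule Comp_mono[OF i_mono \<iota>_mono[OF du(4)]])
  then obtain M q where cf: "(Y, ?j, I A, q, M) \<in> S" unfolding admissible_mono_def by blast
  note df = conflationD[OF cf]
  note [simp] = df(3,5) Comp_eq_Comp[OF df(6)]
  \<comment> \<open>The cone of f is also the pushout of the inclusion Y --> I A along v.\<close>
  have po: "is_pushout C Y (I A) Z E ?j v ee (Comp C Z D E gE k)"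
    unfolding is_pushout_def
  proof (intro conjI ballI impI)
    show "Comp C Y (I A) E ee ?j = Comp C Y Z E (Comp C Z D E gE k) v"
      by (simp add: f(3))
    fix W s t assume W [simp]: "W \<in> Obj C" and s [simp]: "s \<in> mor C (I A) W" and t [simp]: "t \<in> mor C Z W"
      and st: "Comp C Y (I A) W s ?j = Comp C Y Z W t v"
    have st': "Comp C Y A W (Comp C A (I A) W s (\<iota> A)) i = Comp C Y Z W t v"
      using st by simp
    have "Comp C X (I X) W (Comp C (I X) A W (Comp C A (I A) W s (\<iota> A)) eu) (\<iota> X)
        = Comp C X Y W (Comp C Y A W (Comp C A (I A) W s (\<iota> A)) i) u"
      by (simp add: du(9))
    also have "\<dots> = Comp C X Z W t (Comp C X Y Z v u)"
      unfolding st' by simp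
    finally have sq: "Comp C X (I X) W (Comp C (I X) A W (Comp C A (I A) W s (\<iota> A)) eu) (\<iota> X)
        = Comp C X Z W t (Comp C X Y Z v u)" .
    have "Comp C (I X) A W (Comp C A (I A) W s (\<iota> A)) eu \<in> mor C (I X) W" by simp
    from cone_extend[OF cd t W this sq] obtain r where r: "r \<in> mor C D W" "Comp C (I X) D W r ed = Comp C (I X) A W (Comp C A (I A) W s (\<iota> A)) eu"
      "Comp C Z D W r k = t"
      by blast
    note [simp] = r(1)
    have rf: "Comp C A D W r f = Comp C A (I A) W s (\<iota> A)"
    proof (rule pushout_eqI[OF du(1) W])
      show "Comp C (I X) A W (Comp C A D W r f) eu = Comp C (I X) A W (Comp C A (I A) W s (\<iota> A)) eu"
        using r(2) by (simp add: f(2))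
      show "Comp C Y A W (Comp C A D W r f) i = Comp C Y A W (Comp C A (I A) W s (\<iota> A)) i"
        unfolding st' by (simp add: f(3) Comp_eq_Comp[OF r(3)])
    qed simp_all
    obtain l where l: "l \<in> mor C E W" "Comp C (I A) E W l ee = s" "Comp C D E W l gE = r"
      by (rule cone_extend[OF cE r(1) W s rf[symmetric]])
    show "\<exists>!l. l \<in> mor C E W \<and> Comp C (I A) E W l ee = s \<and> Comp C Z E W l (Comp C Z D E gE k) = t"
    proof (rule ex1I[of _ l])
      show "l \<in> mor C E W \<and> Comp C (I A) E W l ee = s \<and> Comp C Z E W l (Comp C Z D E gE k) = t"
        using l(1) by (simp add: l(2) Comp_eq_Comp[OF l(3)] r(3))
      fix l' assume l': "l' \<in> mor C E W \<and> Comp C (I A) E W l' ee = s \<and> Comp C Z E W l' (Comp C Z D E gE k) = t"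
      then have l'1 [simp]: "l' \<in> mor C E W" and l'2: "Comp C (I A) E W l' ee = s"
        and l'3: "Comp C Z E W l' (Comp C Z D E gE k) = t" by blast+
      have l'g: "Comp C D E W l' gE = r"
      proof (rule pushout_eqI[OF dd(1) W])
        have "Comp C (I X) D W (Comp C D E W l' gE) ed = Comp C (I X) D W (Comp C D E W l' gE) (Comp C (I X) A D f eu)"
          unfolding f(2) ..
        also have "\<dots> = Comp C (I X) A W (Comp C A (I A) W (Comp C (I A) E W l' ee) (\<iota> A)) eu"
          by simp
        also have "\<dots> = Comp C (I X) D W r ed"
          unfolding l'2 r(2) ..
        finally show "Comp C (I X) D W (Comp C D E W l' gE) ed = Comp C (I X) D W r ed" .
        show "Comp C Z D W (Comp C D E W l' gE) k = Comp C Z D W r k"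
          using l'3 r(3) by simp
      qed simp_all
      show "l' = l"
        by (rule pushout_eqI[OF dE(1) W l'1 l(1)]) (simp_all add: l'2 l'g l(2,3))
    qed
  qed simp_all
  obtain t where t: "t \<in> mor C E M" "Comp C (I A) E M t ee = q"
    "Comp C Z E M t (Comp C Z D E gE k) = zero_mor C Z M"
    by (rule pushout_ex[OF po df(3,5), of "zero_mor C Z M"]) (simp_all add: df(6))
  note [simp] = t(1)
  obtain b where b: "b \<in> mor C (I A) (I Y)" "Comp C Y (I A) (I Y) b ?j = \<iota> Y"
    by (rule injective_extend[OF injective_I[OF Y] df(7), of "\<iota> Y"]) simp_all
  note [simp] = b(1)
  obtain m where m: "m \<in> mor C M (FObj T Y)"
    "Comp C (I A) M (FObj T Y) m q = Comp C (I A) (I Y) (FObj T Y) (\<pi> Y) b"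
  proof (rule conflation_extend[OF cf, of "FObj T Y" "Comp C (I A) (I Y) (FObj T Y) (\<pi> Y) b"])
    show "Comp C Y (I A) (FObj T Y) (Comp C (I A) (I Y) (FObj T Y) (\<pi> Y) b) ?j = zero_mor C Y (FObj T Y)"
      using b(2) by simp
  qed simp_all
  note [simp] = m(1)
  have tri_v: "(triangle_of Y Z v E (Comp C Z D E gE k) (Comp C E M (FObj T Y) m t)) \<in> \<Delta>"
    by (rule cone_of_conflation_in_\<Delta>[OF cf injective_I[OF du(4)] po t b m])
  \<comment> \<open>The lift of u between the chosen injectives that makes the second square commute strictly.\<close>
  let ?a = "Comp C (I X) (I A) (I Y) b (Comp C (I X) A (I A) (\<iota> A) eu)"
  have a: "Comp C X (I X) (I Y) ?a (\<iota> X) = Comp C X Y (I Y) (\<iota> Y) u"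
    using b(2) by (simp add: du(9) flip: b(2))
  obtain h where h: "h \<in> mor C (FObj T X) (FObj T Y)"
    "Comp C (I X) (FObj T X) (FObj T Y) h (\<pi> X) = Comp C (I X) (I Y) (FObj T Y) (\<pi> Y) ?a"
  proof (rule conflation_extend[OF shift_conflation[OF X], of "FObj T Y" "Comp C (I X) (I Y) (FObj T Y) (\<pi> Y) ?a"])
    have "Comp C X (I X) (FObj T Y) (Comp C (I X) (I Y) (FObj T Y) (\<pi> Y) ?a) (\<iota> X)
      = Comp C X (I Y) (FObj T Y) (\<pi> Y) (Comp C X (I X) (I Y) ?a (\<iota> X))" by simp
    then show "Comp C X (I X) (FObj T Y) (Comp C (I X) (I Y) (FObj T Y) (\<pi> Y) ?a) (\<iota> X) = zero_mor C X (FObj T Y)"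
      unfolding a by simp
  qed simp_all
  note [simp] = h(1)
  have Tu: "FMor T X Y (cls X Y u) = cls (FObj T X) (FObj T Y) h"
    by (rule T_cls[OF X Y u _ h(1) a h(2)]) simp
  have hh: "Comp C D (FObj T X) (FObj T Y) h hd = Comp C D M (FObj T Y) m (Comp C D E M t gE)"
  proof (rule pushout_eqI[OF dd(1), of "FObj T Y"])
    have "Comp C (I X) D (FObj T Y) (Comp C D M (FObj T Y) m (Comp C D E M t gE)) (Comp C (I X) A D f eu)
        = Comp C (I X) M (FObj T Y) m (Comp C (I X) (I A) M q (Comp C (I X) A (I A) (\<iota> A) eu))"
      by (simp flip: Comp_eq_Comp[OF t(2)])
    also have "\<dots> = Comp C (I X) (I Y) (FObj T Y) (\<pi> Y) ?a"
      by (simp add: Comp_eq_Comp[OF m(2)])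
    finally show "Comp C (I X) D (FObj T Y) (Comp C D (FObj T X) (FObj T Y) h hd) ed
      = Comp C (I X) D (FObj T Y) (Comp C D M (FObj T Y) m (Comp C D E M t gE)) ed"
      unfolding f(2) by (simp add: dd(10) h(2))
    show "Comp C Z D (FObj T Y) (Comp C D (FObj T X) (FObj T Y) h hd) k
      = Comp C Z D (FObj T Y) (Comp C D M (FObj T Y) m (Comp C D E M t gE)) k"
      by (simp add: t(3))
  qed simp_all
  \<comment> \<open>The shift of i. The identity of I A differs from ai b by a map through q, so that the last square commutes up to a map through I A.\<close>
  obtain ai ti where ti: "ai \<in> mor C (I Y) (I A)" "ti \<in> mor C (FObj T Y) (FObj T A)"
    "Comp C Y (I Y) (I A) ai (\<iota> Y) = ?j"
    "Comp C (I Y) (FObj T Y) (FObj T A) ti (\<pi> Y) = Comp C (I Y) (I A) (FObj T A) (\<pi> A) ai"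
    "FMor T Y A (cls Y A i) = cls (FObj T Y) (FObj T A) ti"
    by (rule T_clsE[OF Y du(4,7)])
  note [simp] = ti(1,2)
  have "Comp C Y (I A) (I A) (diff (I A) (I A) (Ident C (I A)) (Comp C (I A) (I Y) (I A) ai b)) ?j = zero_mor C Y (I A)"
    using b(2) ti(3) by simp
  then obtain r where r [simp]: "r \<in> mor C M (I A)"
    and rq: "Comp C (I A) M (I A) r q = diff (I A) (I A) (Ident C (I A)) (Comp C (I A) (I Y) (I A) ai b)"
    by (rule conflation_extend[OF cf, of "I A", rotated 2]) simp_all
  have "diff E (FObj T A) hE (Comp C E (FObj T Y) (FObj T A) ti (Comp C E M (FObj T Y) m t))
      = Comp C E (I A) (FObj T A) (\<pi> A) (Comp C E M (I A) r t)"
    by (rule pushout_eqI[OF po, of "FObj T A"])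
      (simp_all add: t(2,3) dE(10) m(2) rq Comp_eq_Comp[OF ti(4)])
  then have "diff E (FObj T A) hE (Comp C E (FObj T Y) (FObj T A) ti (Comp C E M (FObj T Y) m t)) \<in> J E (FObj T A)"
    by (intro JI[OF _ _ injective_I[OF du(4)], of E "FObj T A" "Comp C E M (I A) r t" "\<pi> A"]) simp_all
  then have hE: "cls E (FObj T A) hE
      = Comp Q E (FObj T Y) (FObj T A) (FMor T Y A (cls Y A i)) (cls E (FObj T Y) (Comp C E M (FObj T Y) m t))"
    by (simp add: ti(5) cls_eq_iff)
  have hdf: "Comp C A D (FObj T X) hd f = hu"
    by (rule pushout_eqI[OF du(1), of "FObj T X"]) (simp_all add: f(2,3) dd(10) du(10))
  have VU: "Comp Q X Y Z V U = cls X Z (Comp C X Y Z v u)" by (simp add: U V)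
  have 1: "triangle_morphism Q T (X, Y, A, U, cls Y A i, cls A (FObj T X) hu)
      (X, Z, D, Comp Q X Y Z V U, cls Z D k, cls D (FObj T X) hd) (Ident Q X) V (cls A D f)"
    unfolding triangle_morphism_def VU U V using T_Ident[of X] by (simp add: f(3) hdf)
  have 2: "triangle_morphism Q T (X, Z, D, Comp Q X Y Z V U, cls Z D k, cls D (FObj T X) hd)
      (Y, Z, E, V, cls Z E (Comp C Z D E gE k), cls E (FObj T Y) (Comp C E M (FObj T Y) m t))
      U (Ident Q Z) (cls D E gE)"
    unfolding triangle_morphism_def VU U V by (simp add: Tu hh)
  show ?thesis
    using cone_in_\<Delta>[OF cu] tri_v cone_in_\<Delta>[OF cd] 1 2 cone_in_\<Delta>[OF cE] unfolding VU U[symmetric] V[symmetric] hE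
    by blast
qed

lemma triangulation_criterion_\<Delta>: "triangulation_criterion Q T \<Delta>"
proof (intro triangulation_criterion.intro triangulation_criterion_axioms.intro)
  show "shifted_category Q T" by (rule shifted_category_axioms)
  show "is_triangle Q T t" if "t \<in> \<Delta>" for t
    using that by (simp add: \<Delta>_def)
qed (fact T_faithful T_full T_surj \<Delta>_iso \<Delta>_Ident \<Delta>_rotate \<Delta>_morphism \<Delta>_weak_cokernel \<Delta>_octahedron)+

theorem triangulated_\<Delta>: "triangulated_category Q T \<Delta>"
  by (rule triangulation_criterion.triangulated[OF triangulation_criterion_\<Delta>])

end

section \<open>The homotopy category of N-complexes\<close>

context hom_ideal
begin

text \<open>
  Outside of the objects the two families of sets may differ, which is why the categories are not equal
  on the nose.
\<close>

lemma quotient_category_same: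
  assumes "\<And>X Y. X \<in> Obj C \<Longrightarrow> Y \<in> Obj C \<Longrightarrow> J' X Y = J X Y"
  shows "same_category (quotient_category C J') Q"
proof -
  interpret J': hom_ideal C J'
    by (intro hom_ideal.intro hom_ideal_axioms.intro preadditive_category_axioms)
      (simp_all add: assms ideal_subgroup ideal_Comp_left ideal_Comp_right)
  have cls: "mor_class C J' X Y f = cls X Y f" if "X \<in> Obj C" "Y \<in> Obj C" for X Y f
    using assms[OF that] by (simp add: mor_class_def)
  have Hom: "Hom J'.Q X Y = Hom Q X Y" if "X \<in> Obj C" "Y \<in> Obj C" for X Y
    using assms[OF that] by (simp add: quotient_category_def)
  have Comp: "Comp J'.Q X Y Z G F = Comp Q X Y Z G F" if "X \<in> Obj C" "Y \<in> Obj C" "Z \<in> Obj C" for X Y Z G F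
    using that by (simp add: quotient_category_def cls)
  show ?thesis
    unfolding same_category_def by (simp only: J'.Obj_quotient Obj_quotient) (simp add: Hom Comp cls)
qed

end

lemma same_category_is_triangle:
  assumes "same_category K K'" and "\<And>X. X \<in> Obj K \<Longrightarrow> FObj T X \<in> Obj K"
  shows "is_triangle K T t \<longleftrightarrow> is_triangle K' T t"
proof -
  obtain X Y Z u v w where t: "t = (X, Y, Z, u, v, w)" by (cases t)
  show ?thesis
    using assms unfolding t is_triangle_def same_category_def by auto
qed

lemma same_category_is_iso:
  assumes s: "same_category K K'" and X: "X \<in> Obj K" and Y: "Y \<in> Obj K"
  shows "is_iso K X Y f \<longleftrightarrow> is_iso K' X Y f"
proof -
  have m: "mor K X Y = mor K' X Y" "mor K Y X = mor K' Y X" "Ident K X = Ident K' X" "Ident K Y = Ident K' Y"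
    using assms unfolding same_category_def by blast+
  have e: "Comp K X Y X g f = Comp K' X Y X g f" "Comp K Y X Y f g = Comp K' Y X Y f g"
    if "f \<in> mor K X Y" "g \<in> mor K Y X" for g
    using s X Y that unfolding same_category_def by blast+
  show ?thesis
    unfolding is_iso_def m[symmetric] by (intro conj_cong refl bex_cong) (simp_all add: e)
qed

lemma same_category_triangle_iso:
  assumes s: "same_category K K'" and T: "is_functor K K T"
    and t: "is_triangle K T t" and t': "is_triangle K T t'"
  shows "triangle_iso K T t t' \<longleftrightarrow> triangle_iso K' T t t'"
proof -
  obtain X Y Z u v w where t_eq: "t = (X, Y, Z, u, v, w)" by (cases t)
  obtain X' Y' Z' u' v' w' where t'_eq: "t' = (X', Y', Z', u', v', w')" by (cases t')
  have ob: "X \<in> Obj K" "Y \<in> Obj K" "Z \<in> Obj K" "X' \<in> Obj K" "Y' \<in> Obj K" "Z' \<in> Obj K"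
    "u \<in> mor K X Y" "v \<in> mor K Y Z" "w \<in> mor K Z (FObj T X)"
    "u' \<in> mor K X' Y'" "v' \<in> mor K Y' Z'" "w' \<in> mor K Z' (FObj T X')"
    using t t' unfolding t_eq t'_eq is_triangle_def by simp_all
  have T': "FObj T X \<in> Obj K" "FObj T X' \<in> Obj K"
    "\<And>a. a \<in> mor K X X' \<Longrightarrow> FMor T X X' a \<in> mor K (FObj T X) (FObj T X')"
    using T ob unfolding is_functor_def by blast+
  have mor: "mor K' X X' = mor K X X'" "mor K' Y Y' = mor K Y Y'" "mor K' Z Z' = mor K Z Z'"
    using s ob unfolding same_category_def by blast+
  have Comp: "Comp K' P Q R g f = Comp K P Q R g f"
    if "P \<in> Obj K" "Q \<in> Obj K" "R \<in> Obj K" "f \<in> mor K P Q" "g \<in> mor K Q R" for P Q R f g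
    using s that unfolding same_category_def by metis
  have "triangle_morphism K' T t t' a b c \<longleftrightarrow> triangle_morphism K T t t' a b c" for a b c
    unfolding t_eq t'_eq triangle_morphism_def
    by (simp add: mor cong: conj_cong) (simp add: Comp ob T' cong: conj_cong)
  then show ?thesis
    unfolding triangle_iso_def t_eq t'_eq using same_category_is_iso[OF s] ob by simp
qed

theorem theorem0p1:
  fixes N :: nat and B :: "('o, 'm) precat"
  assumes "N \<ge> 2" and "additive_category B"
  shows "frobenius_category (ncomplex_category N B) (degreewise_split N B) \<and>
    same_category (stable_category (ncomplex_category N B) (degreewise_split N B))
      (homotopy_category N B) \<and>
    (\<exists>T \<Delta>. triangulated_category (homotopy_category N B) T \<Delta> \<and>
       algebraic_via (ncomplex_category N B) (degreewise_split N B) (homotopy_category N B) T \<Delta>)"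
proof -
  interpret additive_complexes B N
    using assms by (simp add: additive_complexes_def additive_complexes_axioms_def)
  define J where "J X Y = {f \<in> mor CN X Y. null_homotopic N B X Y f}" for X Y
  have K: "homotopy_category N B = quotient_category CN J"
    unfolding homotopy_category_def J_def ..
  interpret F: frobenius_category CN SN by (rule frobenius_CN)
  obtain I \<iota> \<pi> T where shift: "stable_shift CN SN I \<iota> \<pi> T"
    using F.stable_shift_exists by blast
  interpret H: happel_shift CN SN J I \<iota> \<pi> T
    by (intro happel_shift.intro happel_shift_axioms.intro frobenius_CN shift)
      (simp only: J_def stable_ideal_CN)
  have same: "same_category (stable_category CN SN) (quotient_category CN J)"
    unfolding stable_category_def by (rule H.quotient_category_same) (rule H.J_stable[symmetric])
  have Obj: "Obj (stable_category CN SN) = Obj CN"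
    by (simp add: stable_category_def quotient_category_def)
  have is_triangle: "is_triangle (stable_category CN SN) T t \<longleftrightarrow> is_triangle H.Q T t" for t
    by (rule same_category_is_triangle[OF same]) (simp only: Obj H.shift_in(2))
  have same': "same_category H.Q (stable_category CN SN)"
    using same unfolding same_category_def by auto
  have "triangle_iso H.Q T s t \<longleftrightarrow> triangle_iso (stable_category CN SN) T s t"
    if "s \<in> standard_triangles CN SN I \<iota> \<pi> T" "is_triangle H.Q T t" for s t
  proof (rule same_category_triangle_iso[OF same' H.T_functor _ that(2)])
    show "is_triangle H.Q T s"
      using that(1) H.cone_triangle unfolding H.standard_triangles_iff by blast
  qed
  then have "H.\<Delta> = {t. is_triangle (stable_category CN SN) T t \<and>
      (\<exists>s\<in>standard_triangles CN SN I \<iota> \<pi> T. triangle_iso (stable_category CN SN) T s t)}"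
    unfolding H.\<Delta>_def is_triangle by blast
  with shift have "happel_structure CN SN T H.\<Delta>"
    unfolding happel_structure_def by blast
  then have "algebraic_via CN SN (homotopy_category N B) T H.\<Delta>"
    unfolding algebraic_via_def K using frobenius_CN same by blast
  then show ?thesis
    using frobenius_CN same H.triangulated_\<Delta> unfolding K by blast
qed

end
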